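(* There is an algorithm that computes a real number $x\in(0,1)$ that is both absolutely normal and continued fraction normal. Moreover, the computation of the first $n$ digits of the continued fraction expansion of $x$ performs a number of mathematical operations that is in $O(n^4)$.
   Context: Every $x\in(0,1)$ has a continued fraction expansion $x=[a_1,a_2,\dots]=\cfrac{1}{a_1+\cfrac{1}{a_2+\cdots}}$ with positive integers $a_i$. The Gauss map is $T(0)=0$, $T(x)=1/x-\lfloor 1/x\rfloor$, and the Gauss measure is $\mu(dx)=\frac{dx}{(1+x)\log 2}$. For positive integers $v_1,\dots,v_k$, $I_{[v_1,\dots,v_k]}$ denotes the open interval of numbers in $(0,1)$ whose first $k$ continued fraction digits are $v_1,\dots,v_k$. A real $x$ is continued fraction normal if for every $k\ge1$ and every block $v_1,\dots,v_k$ of positive integers, $\lim_{n\to\infty}\frac1n\sum_{j=0}^{n-1}\mathbb{I}_{I_{[v_1,\dots,v_k]}}(T^jx)=\mu(I_{[v_1,\dots,v_k]})$, where $\mathbb I$ denotes the indicator function. For an integer base $b\ge2$, the base-$b$ expansion of $x$ is $x=\sum_{i\ge1}a_ib^{-i}$ with digits $0\le a_i<b$ and $a_i<b-1$ infinitely often; $x$ is simply normal to base $b$ if each digit occurs in this expansion with asymptotic frequency $1/b$; $x$ is absolutely normal if it is simply normal to every integer base $b\ge2$ (equivalently, normal to every integer base). The complexity counts mathematical (arithmetic) operations, not the cost of arbitrary-precision arithmetic. *)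

theory Defs
  imports "HOL-Analysis.Analysis" "HOL-Library.Landau_Symbols"
begin

section \<open>Continued fractions\<close>

text \<open>
  \<open>cf_tail [v\<^sub>1, \<dots>, v\<^sub>k] t\<close> is \<open>1 / (v\<^sub>1 + 1 / (v\<^sub>2 + \<dots> + 1 / (v\<^sub>k + t)))\<close>.
\<close>

primrec cf_tail :: "nat list \<Rightarrow> real \<Rightarrow> real" where
  "cf_tail [] t = t"
| "cf_tail (v # vs) t = 1 / (real v + cf_tail vs t)"

text \<open>
  \<open>x = [a 0, a 1, \<dots>]\<close>: the digit sequence is indexed from 0, so \<open>a i\<close> is the digit number
  \<open>i + 1\<close>. Only infinite expansions (that is, irrational \<open>x\<close>) are covered.
\<close>

definition cf_expansion :: "(nat \<Rightarrow> nat) \<Rightarrow> real \<Rightarrow> bool" where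
  "cf_expansion a x \<longleftrightarrow>
     (\<forall>i. a i > 0) \<and> (\<lambda>n. cf_tail (map a [0..<n]) 0) \<longlonglongrightarrow> x"

text \<open>
  The numbers whose expansion starts with the block \<open>v\<close>, the rest of the expansion being some
  \<open>t \<in> (0,1)\<close>. The values \<open>t = 0\<close> and \<open>t = 1\<close> would give the two (rational) endpoints
  \<open>[v\<^sub>1, \<dots>, v\<^sub>k]\<close> and \<open>[v\<^sub>1, \<dots>, v\<^sub>k + 1]\<close>, so this is the open interval.
\<close>

definition cf_interval :: "nat list \<Rightarrow> real set" where
  "cf_interval v = cf_tail v ` {0<..<1}"

definition gauss_map :: "real \<Rightarrow> real" where
  "gauss_map x = (if x = 0 then 0 else 1 / x - of_int \<lfloor>1 / x\<rfloor>)"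

definition gauss_measure :: "real measure" where
  "gauss_measure =
     density lborel (\<lambda>x. ennreal (indicator {0<..<1} x / ((1 + x) * ln 2)))"

definition cf_normal :: "real \<Rightarrow> bool" where
  "cf_normal x \<longleftrightarrow>
     (\<forall>v. v \<noteq> [] \<and> (\<forall>d\<in>set v. d > 0) \<longrightarrow>
        (\<lambda>n. (\<Sum>j<n. indicator (cf_interval v) ((gauss_map ^^ j) x)) / real n)
          \<longlonglongrightarrow> measure gauss_measure (cf_interval v))"

section \<open>Normality to integer bases\<close>

text \<open>Again \<open>a i\<close> is the digit number \<open>i + 1\<close>, the one with weight \<open>1 / b ^ (i + 1)\<close>.\<close>

definition base_expansion :: "nat \<Rightarrow> (nat \<Rightarrow> nat) \<Rightarrow> real \<Rightarrow> bool" where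
  "base_expansion b a x \<longleftrightarrow>
     (\<forall>i. a i < b) \<and> (\<exists>\<^sub>\<infinity>i. a i < b - 1) \<and> (\<lambda>i. real (a i) / real b ^ (i + 1)) sums x"

definition simply_normal :: "nat \<Rightarrow> real \<Rightarrow> bool" where
  "simply_normal b x \<longleftrightarrow>
     (\<exists>a. base_expansion b a x \<and>
        (\<forall>d<b. (\<lambda>n. real (card {i. i < n \<and> a i = d}) / real n) \<longlonglongrightarrow> 1 / real b))"

definition absolutely_normal :: "real \<Rightarrow> bool" where
  "absolutely_normal x \<longleftrightarrow> (\<forall>b\<ge>2. simply_normal b x)"

section \<open>Algorithms and the number of operations they perform\<close>

text \<open>
  Algorithms are programs of a deterministic while language over unbounded integers, with
  finitely many named arrays indexed by integers (a unit-cost random access machine with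
  structured control flow). A scalar variable is an array of which only cell 0 is used.
  Every operation costs 1, independently of the size of its operands: forming a constant,
  array access, addition, subtraction, multiplication, integer division, comparison, Boolean
  connectives and assignment. In particular the index computations are counted as well.
  Real numbers are not a data type of the language, so that a program is a finite object
  which carries no infinite information.
\<close>

type_synonym state = "string \<Rightarrow> int \<Rightarrow> int"

datatype aexp =
    Const int
  | Get string aexp
  | Add aexp aexp
  | Sub aexp aexp
  | Mul aexp aexp
  | Div aexp aexp

datatype bexp =
    Less aexp aexp
  | Neg bexp
  | Conj bexp bexp

text \<open>\<open>Assign y e e'\<close> stands for \<open>y[e] := e'\<close>.\<close>

datatype com =
    Skip
  | Assign string aexp aexp
  | Seq com com
  | Cond bexp com com
  | While bexp com

primrec aval :: "aexp \<Rightarrow> state \<Rightarrow> int" where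
  "aval (Const k) s = k"
| "aval (Get y e) s = s y (aval e s)"
| "aval (Add e1 e2) s = aval e1 s + aval e2 s"
| "aval (Sub e1 e2) s = aval e1 s - aval e2 s"
| "aval (Mul e1 e2) s = aval e1 s * aval e2 s"
| "aval (Div e1 e2) s = aval e1 s div aval e2 s"

primrec acost :: "aexp \<Rightarrow> nat" where
  "acost (Const k) = 1"
| "acost (Get y e) = acost e + 1"
| "acost (Add e1 e2) = acost e1 + acost e2 + 1"
| "acost (Sub e1 e2) = acost e1 + acost e2 + 1"
| "acost (Mul e1 e2) = acost e1 + acost e2 + 1"
| "acost (Div e1 e2) = acost e1 + acost e2 + 1"

primrec bval :: "bexp \<Rightarrow> state \<Rightarrow> bool" where
  "bval (Less e1 e2) s \<longleftrightarrow> aval e1 s < aval e2 s"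
| "bval (Neg c) s \<longleftrightarrow> \<not> bval c s"
| "bval (Conj c1 c2) s \<longleftrightarrow> bval c1 s \<and> bval c2 s"

primrec bcost :: "bexp \<Rightarrow> nat" where
  "bcost (Less e1 e2) = acost e1 + acost e2 + 1"
| "bcost (Neg c) = bcost c + 1"
| "bcost (Conj c1 c2) = bcost c1 + bcost c2 + 1"

text \<open>
  \<open>exec P s t s'\<close>: started in \<open>s\<close>, the program \<open>P\<close> terminates in \<open>s'\<close> after exactly \<open>t\<close>
  operations.
\<close>

inductive exec :: "com \<Rightarrow> state \<Rightarrow> nat \<Rightarrow> state \<Rightarrow> bool" where
  Skip: "exec Skip s 0 s"
| Assign: "exec (Assign y e e') s (acost e + acost e' + 1) (s(y := (s y)(aval e s := aval e' s)))"
| Seq: "exec P s t s' \<Longrightarrow> exec Q s' t' s'' \<Longrightarrow> exec (Seq P Q) s (t + t') s''"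
| CondTrue: "bval c s \<Longrightarrow> exec P s t s' \<Longrightarrow> exec (Cond c P Q) s (bcost c + t) s'"
| CondFalse: "\<not> bval c s \<Longrightarrow> exec Q s t s' \<Longrightarrow> exec (Cond c P Q) s (bcost c + t) s'"
| WhileFalse: "\<not> bval c s \<Longrightarrow> exec (While c P) s (bcost c) s"
| WhileTrue: "bval c s \<Longrightarrow> exec P s t s' \<Longrightarrow> exec (While c P) s' t' s'' \<Longrightarrow>
    exec (While c P) s (bcost c + t + t') s''"

inductive_cases SkipE: "exec Skip s t s'"
inductive_cases AssignE: "exec (Assign y e e') s t s'"
inductive_cases SeqE: "exec (Seq P Q) s t s'"
inductive_cases CondE: "exec (Cond c P Q) s t s'"
inductive_cases WhileE: "exec (While c P) s t s'"

text \<open>The final state and the number of operations are functions of program and input:\<close>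

lemma exec_deterministic:
  "exec P s t s' \<Longrightarrow> exec P s u s'' \<Longrightarrow> u = t \<and> s'' = s'"
proof (induction arbitrary: u s'' rule: exec.induct)
  case (Skip s)
  then show ?case by (rule SkipE) simp
next
  case (Assign y e e' s)
  then show ?case by (rule AssignE) simp
next
  case (Seq P s t s' Q t' s2)
  from Seq.prems obtain t1 s1 t2 where "exec P s t1 s1" "exec Q s1 t2 s''" "u = t1 + t2"
    by (rule SeqE)
  with Seq.IH show ?case by blast
next
  case (CondTrue c s P t s' Q)
  from CondTrue.prems obtain t1 where "exec P s t1 s''" "u = bcost c + t1"
    by (rule CondE) (use CondTrue.hyps in simp_all)
  with CondTrue.IH show ?case by blast
next
  case (CondFalse c s Q t s' P)
  from CondFalse.prems obtain t1 where "exec Q s t1 s''" "u = bcost c + t1"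
    by (rule CondE) (use CondFalse.hyps in simp_all)
  with CondFalse.IH show ?case by blast
next
  case (WhileFalse c s P)
  from WhileFalse.prems show ?case
    by (rule WhileE) (use WhileFalse.hyps in simp_all)
next
  case (WhileTrue c s P t s' t' s2)
  from WhileTrue.prems obtain t1 s1 t2
    where "exec P s t1 s1" "exec (While c P) s1 t2 s''" "u = bcost c + t1 + t2"
    by (rule WhileE) (use WhileTrue.hyps in simp_all)
  with WhileTrue.IH show ?case by blast
qed

definition input_state :: "nat \<Rightarrow> state" where
  "input_state n = (\<lambda>y i. if y = ''n'' \<and> i = 0 then int n else 0)"

text \<open>
  On input \<open>n\<close> the program \<open>P\<close> performs exactly \<open>time n\<close> operations and leaves the first \<open>n\<close>
  terms of the sequence \<open>a\<close> in the cells \<open>0, \<dots>, n - 1\<close> of the array \<open>''out''\<close>.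
\<close>

definition computes_prefixes :: "com \<Rightarrow> (nat \<Rightarrow> nat) \<Rightarrow> (nat \<Rightarrow> nat) \<Rightarrow> bool" where
  "computes_prefixes P a time \<longleftrightarrow>
     (\<forall>n. \<exists>s. exec P (input_state n) (time n) s \<and> (\<forall>i<n. s ''out'' (int i) = int (a i)))"

end

theory Submission
  imports Defs "HOL-Real_Asymp.Real_Asymp"
begin

text \<open>
  The digits of \<open>x\<close> are produced block by block. Both kinds of normality are equidistribution
  statements in \<open>[0,1]\<close>: of the orbit of \<open>x\<close> under multiplication by \<open>b\<close>, and of
  \<open>log\<^sub>2 (1 + T\<^sup>j x)\<close>, which turns the Gauss measure into Lebesgue measure and makes the cell of
  a rational number decidable in integer arithmetic. An upper bound for the share of each of \<open>K\<close>
  equal cells suffices, because the shares add up to 1.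

  Good blocks exist, of bounded size uniformly in the digits chosen before: the transfer operators
  of both maps contract Lipschitz constants, so correlations decay exponentially and a strong law
  holds almost everywhere; and a point chosen uniformly in a continued fraction interval has, after
  rescaling by the matching power of \<open>b\<close>, a bounded density modulo 1. Hence the program may search
  greedily: among the first \<open>2\<^sup>c\<close> candidate blocks, where \<open>2\<^sup>c\<close> is at most about twice the number
  of digits found so far, it takes one that passes the tests up to the highest level \<open>K\<close>. By
  uniformity these levels tend to infinity. A step costs \<open>O(n\<^sup>3)\<close> operations and yields at least one
  digit.
\<close>

section \<open>Equidistribution from tests on blocks\<close>

text \<open>The almost everywhere laws come without a rate: for a level \<open>K0\<close> they yield
  only some block length \<open>L\<close> and some digit bound \<open>D\<close>. Neither number
  enters the program; what counts is that they are the same for every word already written. A word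
  of length \<open>L\<close> over the digits 1, ..., c has an index below
  \<open>(c + 1) ^ L\<close>, a polynomial in c, while \<open>2 ^ c\<close> candidates are examined
  and c grows like the logarithm of the length. So every level is eventually reached for good, at an
  unknown time. Blocks have at most c digits of size at most c; they are negligible against the
  word, and an unfinished block cannot spoil a frequency. The obstacle is that a test sees only the
  rational number with the digits found so far, not the limit. Hence all comparisons are up to an
  error \<eta>, modulo 1, with a few positions at the end of each block given up, and the laws are
  applied to cells much finer than those of the tests.\<close>

definition occ :: "(nat \<Rightarrow> real) \<Rightarrow> nat set \<Rightarrow> real set \<Rightarrow> nat" where
  "occ z S A = card {j\<in>S. z j \<in> A}"

text \<open>Not cut off at the unit interval: the value 1, which a rational orbit point can take,
  lies in cell number \<open>K\<close>.\<close>

definition cell :: "nat \<Rightarrow> nat \<Rightarrow> real set" where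
  "cell K a = {u. \<lfloor>real K * u\<rfloor> = int a}"

text \<open>Share at most 1/K + 1/K^2, cleared of denominators so that a program can decide it. The
  relative tolerance 1/K tends to 0; for \<open>K = 0\<close> the condition holds trivially.\<close>

definition even_cells :: "nat \<Rightarrow> (nat \<Rightarrow> real) \<Rightarrow> nat set \<Rightarrow> bool" where
  "even_cells K z S \<longleftrightarrow> (\<forall>a. K\<^sup>2 * occ z S (cell K a) \<le> (K + 1) * card S)"

lemma occ_mono: "finite T \<Longrightarrow> S \<subseteq> T \<Longrightarrow> A \<subseteq> B \<Longrightarrow> occ z S A \<le> occ z T B"
  unfolding occ_def by (rule card_mono) auto

lemma occ_le_card: "finite S \<Longrightarrow> occ z S A \<le> card S"
  unfolding occ_def by (rule card_mono) auto

lemma occ_Un: "finite S \<Longrightarrow> finite T \<Longrightarrow> occ z (S \<union> T) A \<le> occ z S A + occ z T A"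
  unfolding occ_def by (rule order_trans[OF card_mono card_Un_le]) auto

text \<open>A value \<open>y j\<close> in the interval forces \<open>z j\<close>, shifted by an
  integer, into the interval enlarged by \<eta>, which meets at most Q times its length plus 2 cells
  of width 1/Q. Each of them has at most \<open>C\<close> visits; positions in the bad set
  \<open>E\<close> are counted in full.\<close>

lemma occ_transfer:
  fixes y z :: "nat \<Rightarrow> real"
  assumes fin: "finite S" and "E \<subseteq> S" and "Q > 0" "\<alpha> \<le> \<beta>"
    and close: "\<And>j. j \<in> S - E \<Longrightarrow> 0 \<le> z j \<and> z j < 1 \<and> (\<exists>k::int. \<bar>y j - z j - of_int k\<bar> \<le> \<eta>)"
    and C: "\<And>a. a < Q \<Longrightarrow> real (occ z S (cell Q a)) \<le> C" and "\<eta> \<ge> 0"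
  shows "real (occ y S {\<alpha>..\<beta>}) \<le> real (card E) + (real Q * (\<beta> - \<alpha> + 2 * \<eta>) + 2) * C"
proof -
  \<comment> \<open>Numbers of the cells met on the whole line; reduction modulo \<open>Q\<close>
    brings them back to the unit interval, where \<open>z j\<close> lives.\<close>
  define R where "R = {\<lfloor>Q * (\<alpha> - \<eta>)\<rfloor>..\<lfloor>Q * (\<beta> + \<eta>)\<rfloor>}"
  have C0: "C \<ge> 0" using C[of 0] \<open>Q > 0\<close> by (meson of_nat_0_le_iff order_trans)
  have sub: "{j\<in>S. y j \<in> {\<alpha>..\<beta>}} \<subseteq> E \<union> (\<Union>r\<in>R. {j\<in>S. z j \<in> cell Q (nat (r mod int Q))})"
  proof
    fix j assume j: "j \<in> {j\<in>S. y j \<in> {\<alpha>..\<beta>}}"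
    show "j \<in> E \<union> (\<Union>r\<in>R. {j\<in>S. z j \<in> cell Q (nat (r mod int Q))})"
    proof (cases "j \<in> E")
      case False
      then obtain k :: int where z: "0 \<le> z j" "z j < 1" and k: "\<bar>y j - z j - of_int k\<bar> \<le> \<eta>"
        using close[of j] j by auto
      define r where "r = \<lfloor>Q * z j\<rfloor> + int Q * k"
      have "real Q * (z j + k) = real Q * z j + of_int (int Q * k)" by (simp add: algebra_simps)
      hence r: "r = \<lfloor>Q * (z j + k)\<rfloor>"
        unfolding r_def by (simp only: floor_add_int)
      have "Q * (\<alpha> - \<eta>) \<le> Q * (z j + k)" "Q * (z j + k) \<le> Q * (\<beta> + \<eta>)"
        using j k by (auto intro!: mult_left_mono simp: abs_le_iff)
      hence "r \<in> R" unfolding r R_def by (auto intro: floor_mono)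
      moreover have fl: "0 \<le> \<lfloor>Q * z j\<rfloor>" "\<lfloor>Q * z j\<rfloor> < int Q"
        using z \<open>Q > 0\<close> by (auto simp: floor_less_iff)
      have "r mod int Q = \<lfloor>Q * z j\<rfloor>" unfolding r_def using fl by simp
      hence "z j \<in> cell Q (nat (r mod int Q))" using fl by (simp add: cell_def)
      ultimately show ?thesis using j by auto
    qed simp
  qed
  have finR: "finite R" by (simp add: R_def)
  have "occ y S {\<alpha>..\<beta>} \<le> card (E \<union> (\<Union>r\<in>R. {j\<in>S. z j \<in> cell Q (nat (r mod int Q))}))"
    unfolding occ_def by (rule card_mono[OF _ sub]) (use fin \<open>E \<subseteq> S\<close> finR finite_subset in auto)
  also have "\<dots> \<le> card E + card (\<Union>r\<in>R. {j\<in>S. z j \<in> cell Q (nat (r mod int Q))})"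
    by (rule card_Un_le)
  also have "\<dots> \<le> card E + (\<Sum>r\<in>R. occ z S (cell Q (nat (r mod int Q))))"
    unfolding occ_def by (intro add_left_mono card_UN_le finR)
  finally have "real (occ y S {\<alpha>..\<beta>}) \<le> real (card E + (\<Sum>r\<in>R. occ z S (cell Q (nat (r mod int Q)))))"
    by (rule of_nat_mono)
  also have "\<dots> = real (card E) + (\<Sum>r\<in>R. real (occ z S (cell Q (nat (r mod int Q)))))" by simp
  also have "\<dots> \<le> real (card E) + (\<Sum>r\<in>R. C)"
    by (intro add_left_mono sum_mono C) (use \<open>Q > 0\<close> in \<open>auto simp: nat_less_iff\<close>)
  also have "\<dots> = real (card E) + real (card R) * C" by simp
  also have "real (card R) \<le> Q * (\<beta> - \<alpha> + 2 * \<eta>) + 2"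
  proof -
    have "\<lfloor>Q * (\<alpha> - \<eta>)\<rfloor> \<le> \<lfloor>Q * (\<beta> + \<eta>)\<rfloor>" using assms by (intro floor_mono mult_left_mono) auto
    hence "real (card R) = \<lfloor>Q * (\<beta> + \<eta>)\<rfloor> - \<lfloor>Q * (\<alpha> - \<eta>)\<rfloor> + 1" by (simp add: R_def)
    also have "\<dots> \<le> Q * (\<beta> + \<eta>) - Q * (\<alpha> - \<eta>) + 2" by linarith
    finally show ?thesis by (simp add: algebra_simps)
  qed
  finally show ?thesis using C0 by (simp add: mult_right_mono)
qed

lemma mult_one_plus_le: "X * d \<le> c \<Longrightarrow> X + c \<le> B \<Longrightarrow> X * (1 + d) \<le> B" for X :: real
  by (simp add: distrib_left)

text \<open>The slack of \<open>even_cells\<close> is 1/K^2, at least \<epsilon>. It is spent as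
  follows: the shift by \<eta> and the two boundary cells of width 1/Q cost \<epsilon>/8 each, the
  excess \<delta> of the fine cells at most \<epsilon>/4, the bad positions \<epsilon>/4.\<close>

lemma even_cells_transfer:
  fixes y z :: "nat \<Rightarrow> real"
  assumes fin: "finite S" and E: "E \<subseteq> S" and "Q > 0" "0 < K" "K \<le> Kmax"
    and close: "\<And>j. j \<in> S - E \<Longrightarrow> 0 \<le> z j \<and> z j < 1 \<and> (\<exists>k::int. \<bar>y j - z j - of_int k\<bar> \<le> \<eta>)"
    and C: "\<And>a. a < Q \<Longrightarrow> real (occ z S (cell Q a)) \<le> (1 / Q + \<delta>) * card S"
    and \<epsilon>: "\<epsilon> = 1 / (real Kmax)\<^sup>2" "0 \<le> \<eta>" "\<eta> \<le> \<epsilon> / 16" "Q \<ge> 16 / \<epsilon>" "0 \<le> \<delta>" "\<delta> \<le> \<epsilon> / (8 * Q)"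
    and sE: "real (card E) \<le> \<epsilon> / 4 * card S"
  shows "even_cells K y S"
proof -
  have Kmax: "Kmax > 0" "real Kmax \<ge> 1" "real K \<ge> 1" using \<open>0 < K\<close> \<open>K \<le> Kmax\<close> by auto
  have e: "0 < \<epsilon>" "\<epsilon> \<le> 1" using Kmax by (auto simp: \<epsilon> field_simps)
  have eK: "\<epsilon> \<le> 1 / (real K)\<^sup>2" unfolding \<epsilon>(1) using \<open>0 < K\<close> \<open>K \<le> Kmax\<close> by (simp add: frac_le)
  have Q2: "2 / Q \<le> \<epsilon> / 8" using \<epsilon>(4) e \<open>Q > 0\<close> by (simp add: field_simps)
  have Qd: "Q * \<delta> \<le> \<epsilon> / 8" using \<epsilon>(6) \<open>Q > 0\<close> by (simp add: field_simps)
  show ?thesis unfolding even_cells_def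
  proof
    fix a
    have "cell K a \<subseteq> {real a / real K..(real a + 1) / real K}"
    proof
      fix u assume "u \<in> cell K a"
      hence "real a \<le> real K * u" "real K * u < real a + 1"
        by (simp_all add: cell_def floor_eq_iff)
      thus "u \<in> {real a / real K..(real a + 1) / real K}"
        using \<open>0 < K\<close> by (simp add: pos_divide_le_eq pos_le_divide_eq mult.commute)
    qed
    hence "real (occ y S (cell K a)) \<le> real (occ y S {real a / real K..(real a + 1) / real K})"
      by (intro of_nat_mono occ_mono fin) auto
    also have "\<dots> \<le> card E + (real Q * ((real a + 1) / real K - real a / real K + 2 * \<eta>) + 2) * ((1 / Q + \<delta>) * card S)"
      by (rule occ_transfer[OF fin E \<open>Q > 0\<close> _ close C \<open>0 \<le> \<eta>\<close>]) (use \<open>0<K\<close> in \<open>auto simp: field_simps\<close>)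
    also have "(real a + 1) / real K - real a / real K = 1 / K" by (simp add: diff_divide_distrib[symmetric])
    also have "(real Q * (1 / K + 2 * \<eta>) + 2) * ((1 / Q + \<delta>) * card S) = 
        (1 / K + 2 * \<eta> + 2 / Q) * (1 + Q * \<delta>) * card S"
      using \<open>Q > 0\<close> by (simp add: field_simps)
    also have "(1 / K + 2 * \<eta> + 2 / Q) * (1 + Q * \<delta>) \<le> (1 / K + \<epsilon> / 4) * (1 + \<epsilon> / 8)"
    proof (rule mult_mono)
      show "1 / real K + 2 * \<eta> + 2 / real Q \<le> 1 / real K + \<epsilon> / 4" using Q2 \<epsilon>(3) by linarith
      show "1 + real Q * \<delta> \<le> 1 + \<epsilon> / 8" using Qd by simp
    qed (use e \<epsilon>(5) in auto)
    also have "\<dots> \<le> 1 / K + 1 / K\<^sup>2 - \<epsilon> / 4"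
    proof -
      have "(1 / K + \<epsilon> / 4) * (\<epsilon> / 8) \<le> 2 * (\<epsilon> / 8)"
      proof (rule mult_right_mono)
        have "1 / real K \<le> 1" using Kmax by simp
        thus "1 / real K + \<epsilon> / 4 \<le> 2" using e by linarith
      qed (use e in simp)
      thus ?thesis by (rule mult_one_plus_le) (use eK e(1) in \<open>unfold of_nat_power, linarith\<close>)
    qed
    finally have "real (occ y S (cell K a)) \<le> card E + (1 / K + 1 / K\<^sup>2 - \<epsilon> / 4) * card S"
      by (simp add: mult_right_mono)
    also have "\<dots> \<le> (1 / K + 1 / K\<^sup>2) * card S" using sE by (simp add: algebra_simps)
    also have "\<dots> = (K + 1) * card S / K\<^sup>2" using \<open>0<K\<close> by (simp add: field_simps power2_eq_square)
    finally have "real (K\<^sup>2 * occ y S (cell K a)) \<le> real ((K + 1) * card S)"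
      using \<open>0<K\<close> by (simp add: field_simps)
    thus "K\<^sup>2 * occ y S (cell K a) \<le> (K + 1) * card S" by (simp only: of_nat_le_iff)
  qed
qed

text \<open>All complete blocks obey the bound, up to finitely many, and the block in which n falls
  has relative length at most \<epsilon>, so it may be counted in full. Empty blocks are allowed, as
  \<open>M\<close> is only monotone.\<close>

lemma occ_blocks:
  fixes M :: "nat \<Rightarrow> nat" and \<alpha> \<epsilon> :: real
  assumes M: "mono M" "filterlim M at_top sequentially" and "\<alpha> \<ge> 0"
    and small: "\<And>\<epsilon>::real. \<epsilon> > 0 \<Longrightarrow> \<forall>\<^sub>F i in sequentially. real (M (Suc i)) - M i \<le> \<epsilon> * M i"
    and bound: "\<And>\<epsilon>::real. \<epsilon> > 0 \<Longrightarrow> \<forall>\<^sub>F i in sequentially.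
       real (occ z {M i..<M (Suc i)} A) \<le> (\<alpha> + \<epsilon>) * (real (M (Suc i)) - M i)"
    and "\<epsilon> > 0"
  shows "\<forall>\<^sub>F n in sequentially. real (occ z {..<n} A) \<le> (\<alpha> + \<epsilon>) * n"
proof -
  define \<epsilon>' where "\<epsilon>' = \<epsilon> / 4"
  have e': "\<epsilon>' > 0" using \<open>\<epsilon> > 0\<close> by (simp add: \<epsilon>'_def)
  obtain i0 where i0: "\<And>i. i \<ge> i0 \<Longrightarrow> real (M (Suc i)) - M i \<le> \<epsilon>' * M i"
    "\<And>i. i \<ge> i0 \<Longrightarrow> real (occ z {M i..<M (Suc i)} A) \<le> (\<alpha> + \<epsilon>') * (real (M (Suc i)) - M i)"
    using eventually_conj[OF small[OF e'] bound[OF e']] unfolding eventually_sequentially by blast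
  have mono: "M i \<le> M j" if "i \<le> j" for i j using M(1) that by (auto simp: mono_def)
  have step: "real (occ z {..<M i} A) \<le> M i0 + (\<alpha> + \<epsilon>') * (real (M i) - M i0)" if "i \<ge> i0" for i
    using that
  proof (induction rule: dec_induct)
    case base
    show ?case using occ_le_card[of "{..<M i0}" z A] by simp
  next
    case (step i)
    have "{..<M (Suc i)} = {..<M i} \<union> {M i..<M (Suc i)}" using mono[of i "Suc i"] by auto
    hence "occ z {..<M (Suc i)} A \<le> occ z {..<M i} A + occ z {M i..<M (Suc i)} A"
      using occ_Un by force
    thus ?case using step.IH i0(2)[OF step.hyps(1)] by (simp add: algebra_simps)
  qed
  show ?thesis unfolding eventually_sequentially
  proof (intro exI allI impI)
    fix n assume n: "n \<ge> max (M i0) (nat \<lceil>2 * M i0 / \<epsilon>\<rceil>)"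
    have "\<forall>\<^sub>F i in sequentially. Suc n \<le> M i" using M(2) by (simp add: filterlim_at_top)
    hence "\<exists>i. n < M i" by (auto simp: eventually_sequentially Suc_le_eq)
    define i1 where "i1 = (LEAST i. n < M i)"
    have i1: "n < M i1" unfolding i1_def by (rule LeastI_ex) fact
    have lt: "\<not> n < M i" if "i < i1" for i using that unfolding i1_def by (rule not_less_Least)
    have "i1 > i0" using i1 n mono[of i1 i0] by (metis leD leI max.boundedE order_trans)
    then obtain i where i: "i1 = Suc i" "i \<ge> i0" by (cases i1) auto
    have Mi: "M i \<le> n" "n < M (Suc i)" using i1 lt[of i] i by auto
    have "{..<n} \<subseteq> {..<M i} \<union> {M i..<n}" by auto
    hence "occ z {..<n} A \<le> occ z ({..<M i} \<union> {M i..<n}) A" by (intro occ_mono) auto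
    also have "\<dots> \<le> occ z {..<M i} A + occ z {M i..<n} A" by (rule occ_Un) auto
    also have "\<dots> \<le> occ z {..<M i} A + (n - M i)" using occ_le_card[of "{M i..<n}" z A] by simp
    finally have "real (occ z {..<n} A) \<le> real (occ z {..<M i} A) + (real n - M i)"
      using Mi(1) by linarith
    also have "\<dots> \<le> M i0 + (\<alpha> + \<epsilon>') * (real (M i) - M i0) + \<epsilon>' * M i"
      using step[OF i(2)] i0(1)[OF i(2)] Mi(2) by linarith
    also have "\<dots> \<le> M i0 + (\<alpha> + \<epsilon>') * M i + \<epsilon>' * M i"
      using \<open>\<alpha> \<ge> 0\<close> e' by (simp add: mult_left_mono)
    also have "\<dots> = M i0 + (\<alpha> + 2 * \<epsilon>') * M i" by (simp add: algebra_simps)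
    also have "\<dots> \<le> M i0 + (\<alpha> + 2 * \<epsilon>') * n" using Mi(1) \<open>\<alpha> \<ge> 0\<close> e' by (simp add: mult_left_mono)
    also have "real (M i0) \<le> \<epsilon> / 2 * n"
    proof -
      have "2 * M i0 / \<epsilon> \<le> real n" using n by linarith
      thus ?thesis using \<open>\<epsilon> > 0\<close> by (simp add: field_simps)
    qed
    finally show "real (occ z {..<n} A) \<le> (\<alpha> + \<epsilon>) * n" by (simp add: \<epsilon>'_def algebra_simps)
  qed
qed

definition equidistributed :: "(nat \<Rightarrow> real) \<Rightarrow> bool" where
  "equidistributed z \<longleftrightarrow> (\<forall>\<alpha> \<beta> \<epsilon>. 0 \<le> \<alpha> \<longrightarrow> \<alpha> \<le> \<beta> \<longrightarrow> \<beta> \<le> 1 \<longrightarrow> \<epsilon> > 0 \<longrightarrow>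
     (\<forall>\<^sub>F n in sequentially. real (occ z {..<n} {\<alpha>..\<beta>}) \<le> (\<beta> - \<alpha> + \<epsilon>) * n))"

text \<open>Every position visits \<open>A\<close> or one of the two complementary closed intervals;
  the upper bounds for these two leave a lower bound for \<open>A\<close>. Since \<open>A\<close>
  may contain its endpoints or not, half-open digit cells and open continued fraction intervals are
  both covered.\<close>

lemma equidistributed_frequency:
  assumes z: "equidistributed z" "\<And>j. 0 \<le> z j \<and> z j \<le> 1"
    and ab: "0 \<le> \<alpha>" "\<alpha> \<le> \<beta>" "\<beta> \<le> 1" and A: "{\<alpha><..<\<beta>} \<subseteq> A" "A \<subseteq> {\<alpha>..\<beta>}"
  shows "(\<lambda>n. real (occ z {..<n} A) / n) \<longlonglongrightarrow> \<beta> - \<alpha>"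
proof (rule LIMSEQ_I)
  fix r :: real assume "r > 0"
  define \<epsilon> where "\<epsilon> = r / 4"
  have e: "\<epsilon> > 0" using \<open>r > 0\<close> by (simp add: \<epsilon>_def)
  have "\<forall>\<^sub>F n in sequentially. real (occ z {..<n} {\<alpha>..\<beta>}) \<le> (\<beta> - \<alpha> + \<epsilon>) * n \<and>
      real (occ z {..<n} {0..\<alpha>}) \<le> (\<alpha> - 0 + \<epsilon>) * n \<and> real (occ z {..<n} {\<beta>..1}) \<le> (1 - \<beta> + \<epsilon>) * n \<and> n > 0"
    using z(1) ab e unfolding equidistributed_def
    by (intro eventually_conj eventually_gt_at_top) auto
  then obtain n0 where n0: "\<And>n. n \<ge> n0 \<Longrightarrow> real (occ z {..<n} {\<alpha>..\<beta>}) \<le> (\<beta> - \<alpha> + \<epsilon>) * n \<and>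
      real (occ z {..<n} {0..\<alpha>}) \<le> (\<alpha> - 0 + \<epsilon>) * n \<and> real (occ z {..<n} {\<beta>..1}) \<le> (1 - \<beta> + \<epsilon>) * n \<and> n > 0"
    unfolding eventually_sequentially by blast
  show "\<exists>no. \<forall>n\<ge>no. norm (real (occ z {..<n} A) / n - (\<beta> - \<alpha>)) < r"
  proof (intro exI allI impI)
    fix n assume "n \<ge> n0"
    note n = n0[OF this]
    have up: "real (occ z {..<n} A) \<le> real (occ z {..<n} {\<alpha>..\<beta>})"
      by (intro of_nat_mono occ_mono) (use A in auto)
    have "{..<n} \<subseteq> {j\<in>{..<n}. z j \<in> A} \<union> {j\<in>{..<n}. z j \<in> {0..\<alpha>}} \<union> {j\<in>{..<n}. z j \<in> {\<beta>..1}}"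
    proof
      fix j assume "j \<in> {..<n}"
      moreover have "z j \<in> A \<or> z j \<in> {0..\<alpha>} \<or> z j \<in> {\<beta>..1}"
        using z(2)[of j] A(1) by (cases "z j \<le> \<alpha>"; cases "z j \<ge> \<beta>") auto
      ultimately show "j \<in> {j\<in>{..<n}. z j \<in> A} \<union> {j\<in>{..<n}. z j \<in> {0..\<alpha>}} \<union> {j\<in>{..<n}. z j \<in> {\<beta>..1}}" by auto
    qed
    hence "card {..<n} \<le> card ({j\<in>{..<n}. z j \<in> A} \<union> {j\<in>{..<n}. z j \<in> {0..\<alpha>}} \<union> {j\<in>{..<n}. z j \<in> {\<beta>..1}})"
      by (intro card_mono) auto
    also have "\<dots> \<le> occ z {..<n} A + occ z {..<n} {0..\<alpha>} + occ z {..<n} {\<beta>..1}"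
      unfolding occ_def by (meson card_Un_le add_mono order_refl order_trans)
    finally have low: "real n \<le> real (occ z {..<n} A) + real (occ z {..<n} {0..\<alpha>}) + real (occ z {..<n} {\<beta>..1})"
      by simp
    have "real (occ z {..<n} A) / n \<le> \<beta> - \<alpha> + \<epsilon>" "real (occ z {..<n} A) / n \<ge> \<beta> - \<alpha> - 2 * \<epsilon>"
      using up low n by (auto simp: field_simps)
    thus "norm (real (occ z {..<n} A) / n - (\<beta> - \<alpha>)) < r" using \<open>r > 0\<close> unfolding \<epsilon>_def real_norm_def by linarith
  qed
qed

text \<open>\<open>y i\<close> is what the test of block \<open>i\<close> sees, an approximation of
  the orbit \<open>z\<close>. It is reliable up to \<eta> except at the last \<open>s\<close>
  positions of the block, where \<open>s\<close> depends on \<eta> alone.\<close>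

lemma equidistributed_from_blocks:
  fixes M K :: "nat \<Rightarrow> nat"
  assumes M: "mono M" "filterlim M at_top sequentially"
    and small: "\<And>\<epsilon>::real. \<epsilon> > 0 \<Longrightarrow> \<forall>\<^sub>F i in sequentially. real (M (Suc i)) - M i \<le> \<epsilon> * M i"
    and K: "filterlim K at_top sequentially"
    and nonneg: "\<And>i j. 0 \<le> y i j"
    and even: "\<forall>\<^sub>F i in sequentially. even_cells (K i) (y i) {M i..<M (Suc i)}"
    and close: "\<And>\<eta>. \<eta> > 0 \<Longrightarrow> \<exists>s. \<forall>i j. M i \<le> j \<longrightarrow> j + s < M (Suc i) \<longrightarrow>
       y i j < 1 \<and> (\<exists>k::int. \<bar>z j - y i j - of_int k\<bar> \<le> \<eta>)"
  shows "equidistributed z"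
  unfolding equidistributed_def
proof (intro allI impI occ_blocks[OF M _ small])
  fix \<alpha> \<beta> \<epsilon>0 \<epsilon>1 :: real assume ab: "0 \<le> \<alpha>" "\<alpha> \<le> \<beta>" "\<beta> \<le> 1" and "\<epsilon>1 > 0"
  define \<epsilon> where "\<epsilon> = min 1 \<epsilon>1"
  have e: "\<epsilon> > 0" "\<epsilon> \<le> 1" "\<epsilon> \<le> \<epsilon>1" using \<open>\<epsilon>1 > 0\<close> by (auto simp: \<epsilon>_def)
  define \<eta> where "\<eta> = \<epsilon> / 8"
  have eta: "\<eta> > 0" using e by (simp add: \<eta>_def)
  obtain s where s: "\<And>i j. M i \<le> j \<Longrightarrow> j + s < M (Suc i) \<Longrightarrow>
       y i j < 1 \<and> (\<exists>k::int. \<bar>z j - y i j - of_int k\<bar> \<le> \<eta>)" using close[OF eta] by blast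
  have evK: "\<forall>\<^sub>F i in sequentially. K i \<ge> nat \<lceil>4 * s / \<epsilon> + 24 / \<epsilon> + 2\<rceil>"
    using K by (auto simp: filterlim_at_top)
  have "\<forall>\<^sub>F i in sequentially. real (occ z {M i..<M (Suc i)} {\<alpha>..\<beta>}) \<le> (\<beta> - \<alpha> + \<epsilon>) * (real (M (Suc i)) - M i)"
    using evK even
  proof eventually_elim
    case (elim i)
    define k where "k = K i"
    define L where "L = real (M (Suc i)) - real (M i)"
    let ?S = "{M i..<M (Suc i)}"
    have "M i \<le> M (Suc i)" using M(1) by (auto simp: mono_def)
    hence L: "real (card ?S) = L" "L \<ge> 0" by (auto simp: L_def)
    have k: "real k \<ge> 4 * s / \<epsilon> + 24 / \<epsilon> + 2" using elim(1) unfolding k_def by linarith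
    have q: "4 * s / \<epsilon> \<ge> 0" "24 / \<epsilon> \<ge> 0" using e by auto
    have k0: "real k > 0" "real k \<ge> 1" "real k \<ge> 24 / \<epsilon>" "real k - 1 \<ge> 4 * s / \<epsilon>"
      using k q by linarith+
    have k1: "k > 0" using k0 by simp
    have ev: "real (occ (y i) ?S (cell k a)) \<le> (k + 1) / k\<^sup>2 * L" for a
    proof -
      have "k\<^sup>2 * occ (y i) ?S (cell k a) \<le> (k + 1) * card ?S"
        using elim(2) by (auto simp: even_cells_def k_def)
      hence "real (k\<^sup>2 * occ (y i) ?S (cell k a)) \<le> real ((k + 1) * card ?S)" by (rule of_nat_mono)
      thus ?thesis using k0 L by (simp add: field_simps)
    qed
    show ?case
    proof (cases "M i < M (Suc i)")
      case False
      hence "{M i..<M (Suc i)} = {}" by simp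
      hence "occ z {M i..<M (Suc i)} {\<alpha>..\<beta>} = 0" by (simp add: occ_def)
      moreover have "M (Suc i) = M i" using False \<open>M i \<le> M (Suc i)\<close> by simp
      ultimately show ?thesis by simp
    next
      case True
      \<comment> \<open>No lower bound on block lengths is assumed: the cell of a single point
        already holds the share 1/L, so a nonempty block that passes level k has L >= k - 1. This
        makes the \<open>s\<close> lost positions negligible.\<close>
      define a where "a = nat \<lfloor>real k * y i (M i)\<rfloor>"
      have "M i \<in> {j\<in>?S. y i j \<in> cell k a}" using True nonneg[of i "M i"] k1
        by (auto simp: cell_def a_def)
      hence "{j\<in>?S. y i j \<in> cell k a} \<noteq> {}" by blast
      hence "1 \<le> occ (y i) ?S (cell k a)" unfolding occ_def
        by (simp add: Suc_le_eq card_gt_0_iff)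
      hence "1 \<le> (k + 1) / k\<^sup>2 * L" using ev[of a] by linarith
      hence "(real k)\<^sup>2 \<le> (real k + 1) * L" using k0 by (simp add: field_simps)
      moreover have "(real k + 1) * (real k - 1) \<le> (real k)\<^sup>2" by (simp add: algebra_simps power2_eq_square)
      ultimately have "(real k + 1) * (real k - 1) \<le> (real k + 1) * L" by linarith
      hence "real k - 1 \<le> L" using k0 by (simp add: mult_le_cancel_left_pos del: of_nat_Suc)
      hence "4 * s / \<epsilon> \<le> L" using k0 by linarith
      hence sL: "real s \<le> \<epsilon> / 4 * L" using e by (simp add: field_simps)
      define E where "E = {j \<in> ?S. j + s \<ge> M (Suc i)}"
      have "E \<subseteq> {M (Suc i) - s..<M (Suc i)}" by (auto simp: E_def)
      hence "card E \<le> card {M (Suc i) - s..<M (Suc i)}" by (intro card_mono) auto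
      hence cE: "card E \<le> s" by simp
      have "real (occ z ?S {\<alpha>..\<beta>}) \<le> card E + (real k * (\<beta> - \<alpha> + 2 * \<eta>) + 2) * ((k + 1) / k\<^sup>2 * L)"
      proof (rule occ_transfer[OF _ _ k1 ab(2) _ ev])
        fix j assume "j \<in> ?S - E"
        thus "0 \<le> y i j \<and> y i j < 1 \<and> (\<exists>k::int. \<bar>z j - y i j - of_int k\<bar> \<le> \<eta>)"
          using s[of i j] nonneg[of i j] by (auto simp: E_def)
      qed (use eta in \<open>auto simp: E_def\<close>)
      also have "\<dots> = card E + ((\<beta> - \<alpha> + 2 * \<eta> + 2 / k) * (1 + 1 / k)) * L"
        using k0 by (simp add: field_simps power2_eq_square)
      also have "(\<beta> - \<alpha> + 2 * \<eta> + 2 / k) * (1 + 1 / k) \<le> \<beta> - \<alpha> + 3 / 4 * \<epsilon>"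
      proof -
        have k1: "1 / k \<le> \<epsilon> / 24" "2 / k \<le> \<epsilon> / 12" using k0 e by (auto simp: field_simps)
        have "(\<beta> - \<alpha> + 2 * \<eta> + 2 / k) * (1 / k) \<le> 4 * (\<epsilon> / 24)"
          using ab e k1 eta by (intro mult_mono) (auto simp: \<eta>_def)
        moreover have "\<beta> - \<alpha> + 2 * \<eta> + 2 / k \<le> \<beta> - \<alpha> + \<epsilon> / 4 + \<epsilon> / 12" using k1 by (simp add: \<eta>_def)
        ultimately show ?thesis using e by - (rule mult_one_plus_le, assumption, linarith)
      qed
      finally have "real (occ z ?S {\<alpha>..\<beta>}) \<le> card E + (\<beta> - \<alpha> + 3 / 4 * \<epsilon>) * L"
        using L(2) by (simp add: mult_right_mono)
      also have "\<dots> \<le> \<epsilon> / 4 * L + (\<beta> - \<alpha> + 3 / 4 * \<epsilon>) * L" using sL cE by simp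
      also have "\<dots> = (\<beta> - \<alpha> + \<epsilon>) * L" by (simp add: field_simps)
      finally show ?thesis unfolding L_def .
    qed
  qed
  thus "\<forall>\<^sub>F i in sequentially. real (occ z {M i..<M (Suc i)} {\<alpha>..\<beta>}) \<le> (\<beta> - \<alpha> + \<epsilon>1) * (real (M (Suc i)) - M i)"
  proof eventually_elim
    case (elim i)
    have "M i \<le> M (Suc i)" using M(1) by (auto simp: mono_def)
    hence "(\<beta> - \<alpha> + \<epsilon>) * (real (M (Suc i)) - M i) \<le> (\<beta> - \<alpha> + \<epsilon>1) * (real (M (Suc i)) - M i)"
      using e by (intro mult_right_mono) auto
    thus ?case using elim by linarith
  qed
qed auto

section \<open>Continued fractions\<close>

text \<open>\<open>cvg w = (p, p', q, q')\<close> encodes \<open>cf_tail w t = (p + p' t) / (q + q' t)\<close>.\<close>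

fun cvg :: "nat list \<Rightarrow> nat \<times> nat \<times> nat \<times> nat" where
  "cvg [] = (0, 1, 1, 0)"
| "cvg (a # w) = (case cvg w of (p, p', q, q') \<Rightarrow> (q, q', a * q + p, a * q' + p'))"

definition num :: "nat list \<Rightarrow> nat" where "num w = fst (cvg w)"
definition num' :: "nat list \<Rightarrow> nat" where "num' w = fst (snd (cvg w))"
definition den :: "nat list \<Rightarrow> nat" where "den w = fst (snd (snd (cvg w)))"
definition den' :: "nat list \<Rightarrow> nat" where "den' w = snd (snd (snd (cvg w)))"

lemma cvg_simps [simp]:
  "num [] = 0" "num' [] = 1" "den [] = 1" "den' [] = 0"
  "num (a # w) = den w" "num' (a # w) = den' w"
  "den (a # w) = a * den w + num w" "den' (a # w) = a * den' w + num' w"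
  by (auto simp: num_def num'_def den_def den'_def split: prod.splits)

definition pos_word :: "nat list \<Rightarrow> bool" where
  "pos_word w \<longleftrightarrow> (\<forall>d\<in>set w. d > 0)"

lemma pos_word_simps [simp]:
  "pos_word []" "pos_word (a # w) \<longleftrightarrow> a > 0 \<and> pos_word w"
  "pos_word (u @ w) \<longleftrightarrow> pos_word u \<and> pos_word w"
  by (auto simp: pos_word_def)

lemma den_pos: "pos_word w \<Longrightarrow> den w > 0"
  by (induction w) auto

lemma num_le_den: "pos_word w \<Longrightarrow> num w \<le> den w"
proof (induction w)
  case (Cons a w)
  then obtain k where "a = Suc k" by (cases a) auto
  then show ?case by simp
qed simp

text \<open>The second conjunct carries the induction; it excludes the empty word, which has
  \<open>num' [] = 1\<close> and \<open>num [] = 0\<close>.\<close>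

lemma den'_le_den: "pos_word w \<Longrightarrow> den' w \<le> den w \<and> (w \<noteq> [] \<longrightarrow> num' w \<le> num w)"
proof (induction w)
  case (Cons a w)
  then show ?case by (cases w) (auto intro!: add_mono mult_le_mono2)
qed simp

text \<open>Prepending a digit multiplies by an integer matrix of determinant -1.\<close>

lemma cvg_det: "\<bar>int (num w) * int (den' w) - int (num' w) * int (den w)\<bar> = 1"
proof (induction w)
  case (Cons a w)
  have "int (num (a # w)) * int (den' (a # w)) - int (num' (a # w)) * int (den (a # w)) =
    - (int (num w) * int (den' w) - int (num' w) * int (den w))"
    by (simp add: algebra_simps)
  then show ?case using Cons.IH by (metis abs_minus_cancel)
qed simp

lemma cf_tail_cvg:
  fixes t :: real
  assumes "pos_word w" "t \<ge> 0"
  shows "cf_tail w t = (num w + num' w * t) / (den w + den' w * t)"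
  using assms(1)
proof (induction w)
  case (Cons a w)
  have "real (den w) > 0" using Cons den_pos by simp
  hence d: "den w + den' w * t > 0" using \<open>t \<ge> 0\<close> by (simp add: add_pos_nonneg)
  have n: "(num w + num' w * t) \<ge> 0" using \<open>t \<ge> 0\<close> by simp
  have "real a + (num w + num' w * t) / (den w + den' w * t) =
      ((a * den w + num w) + (a * den' w + num' w) * t) / (den w + den' w * t)"
  proof -
    have "real a = a * (den w + den' w * t) / (den w + den' w * t)" using d by simp
    hence "real a + (num w + num' w * t) / (den w + den' w * t) = 
      (a * (den w + den' w * t) + (num w + num' w * t)) / (den w + den' w * t)"
      by (metis add_divide_distrib)
    thus ?thesis by (simp add: algebra_simps)
  qed
  then show ?case using Cons by simp
qed simp

lemma cf_tail_append: "cf_tail (u @ w) t = cf_tail u (cf_tail w t)"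
  by (induction u) auto

lemma cf_tail_nonneg: "t \<ge> 0 \<Longrightarrow> cf_tail w t \<ge> 0"
  by (induction w) auto

lemma cf_tail_le_1: "pos_word w \<Longrightarrow> 0 \<le> t \<Longrightarrow> t \<le> 1 \<Longrightarrow> cf_tail w t \<le> 1"
proof (cases w)
  case (Cons a v)
  assume "pos_word w" "0 \<le> t"
  hence "real a \<ge> 1" "cf_tail v t \<ge> 0" using Cons cf_tail_nonneg by auto
  thus ?thesis using Cons by simp
qed simp

lemma cf_tail_pos: "pos_word w \<Longrightarrow> 0 < t \<Longrightarrow> cf_tail w t > 0"
  by (induction w) auto

lemma cf_tail_less_1: "pos_word w \<Longrightarrow> 0 < t \<Longrightarrow> t < 1 \<Longrightarrow> cf_tail w t < 1"
proof (cases w)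
  case (Cons a v)
  assume "pos_word w" "0 < t"
  hence "real a \<ge> 1" "cf_tail v t > 0" using Cons cf_tail_pos by auto
  thus ?thesis using Cons by simp
qed simp

lemma den_append: "den (u @ w) = den u * den w + den' u * num w"
  and num_append: "num (u @ w) = num u * den w + num' u * num w"
  by (induction u) (auto simp: algebra_simps)

lemma den_append_ge: "den u * den w \<le> den (u @ w)"
  by (simp add: den_append)

lemma den_append_le: "pos_word u \<Longrightarrow> pos_word w \<Longrightarrow> den (u @ w) \<le> 2 * (den u * den w)"
  using mult_le_mono[OF conjunct1[OF den'_le_den[of u]] num_le_den[of w]] by (simp add: den_append)

text \<open>Two further digits at least double the denominator, hence multiply its square by 4. The
  factor 2 absorbs an odd length.\<close>

lemma den_ge: "pos_word w \<Longrightarrow> 2 ^ length w \<le> 2 * (den w)\<^sup>2"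
proof (induction w rule: induct_list012)
  case (2 a)
  then show ?case by (auto simp: Suc_le_eq power2_eq_square)
next
  case (3 a b w)
  have "2 * den w \<le> den (a # b # w)"
  proof -
    obtain k l where "a = Suc k" "b = Suc l" using 3 by (cases a; cases b) auto
    thus ?thesis by simp
  qed
  hence "(2 * den w)\<^sup>2 \<le> (den (a # b # w))\<^sup>2" by (rule power_mono) simp
  moreover have "2 ^ length w \<le> 2 * (den w)\<^sup>2" using 3 by simp
  ultimately show ?case by (simp add: power_mult_distrib)
qed simp

lemma den_le: "pos_word w \<Longrightarrow> (\<And>d. d \<in> set w \<Longrightarrow> d \<le> D) \<Longrightarrow> den w \<le> (D + 1) ^ length w"
proof (induction w)
  case (Cons a w)
  have "den (a # w) \<le> a * den w + den w" using num_le_den[of w] Cons.prems by simp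
  also have "\<dots> \<le> (D + 1) * den w" using Cons.prems(2)[of a] by simp
  also have "\<dots> \<le> (D + 1) * (D + 1) ^ length w" using Cons by (intro mult_le_mono) auto
  finally show ?case by simp
qed simp

lemma cf_tail_diff:
  fixes s t :: real
  assumes "pos_word w" "t \<ge> 0" "s \<ge> 0"
  shows "\<bar>cf_tail w t - cf_tail w s\<bar> = \<bar>t - s\<bar> / ((den w + den' w * t) * (den w + den' w * s))"
proof -
  have "real (den w) > 0" using den_pos assms by simp
  hence d: "den w + den' w * t > 0" "den w + den' w * s > 0" using assms by (auto simp: add_pos_nonneg)
  have "cf_tail w t - cf_tail w s =
      ((num w + num' w * t) * (den w + den' w * s) - (num w + num' w * s) * (den w + den' w * t))
        / ((den w + den' w * t) * (den w + den' w * s))"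
    using d assms by (simp add: cf_tail_cvg diff_frac_eq)
  also have "(num w + num' w * t) * (den w + den' w * s) - (num w + num' w * s) * (den w + den' w * t)
     = of_int (int (num w) * int (den' w) - int (num' w) * int (den w)) * (s - t)"
    by (simp add: algebra_simps)
  finally show ?thesis using d cvg_det[of w]
    by (simp only: abs_divide abs_mult of_int_abs[symmetric]) (simp add: abs_minus_commute abs_mult)
qed

text \<open>Two forms of the same contraction: by the denominator for the positions to base
  \<open>b\<close>, by the length for the Gauss orbit.\<close>

lemma cf_tail_close:
  assumes "pos_word w" "0 \<le> t" "t \<le> 1" "0 \<le> s" "s \<le> 1"
  shows "\<bar>cf_tail w t - cf_tail w s\<bar> \<le> 1 / (real (den w))\<^sup>2"
    and "\<bar>cf_tail w t - cf_tail w s\<bar> \<le> 2 / 2 ^ length w"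
proof -
  have d0: "real (den w) > 0" using den_pos assms by simp
  have "real (den w) * real (den w) \<le> (den w + den' w * t) * (den w + den' w * s)"
    using assms by (intro mult_mono) auto
  hence "\<bar>t - s\<bar> / ((den w + den' w * t) * (den w + den' w * s)) \<le> 1 / (real (den w) * real (den w))"
    using assms d0 by (intro frac_le) auto
  thus *: "\<bar>cf_tail w t - cf_tail w s\<bar> \<le> 1 / (real (den w))\<^sup>2"
    using assms by (simp add: cf_tail_diff power2_eq_square)
  have "real (2 ^ length w) \<le> real (2 * (den w)\<^sup>2)" using den_ge[OF assms(1)] by (rule of_nat_mono)
  hence "1 / (real (den w))\<^sup>2 \<le> 2 / 2 ^ length w" using d0 by (simp add: field_simps)
  thus "\<bar>cf_tail w t - cf_tail w s\<bar> \<le> 2 / 2 ^ length w" using * by linarith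
qed

lemma cf_tail_0: "pos_word w \<Longrightarrow> cf_tail w 0 = num w / den w"
  by (simp add: cf_tail_cvg)

text \<open>A \<open>t\<close> strictly between 0 and 1 keeps every tail strictly inside the unit
  interval, so the floor recovers the digit.\<close>

lemma gauss_map_cf_tail:
  assumes "a > 0" "pos_word w" "0 < t" "t < 1"
  shows "gauss_map (cf_tail (a # w) t) = cf_tail w t"
proof -
  have "0 < cf_tail w t" "cf_tail w t < 1" using assms cf_tail_pos cf_tail_less_1 by auto
  moreover from this have "\<lfloor>real a + cf_tail w t\<rfloor> = int a" by (simp add: floor_eq_iff)
  ultimately show ?thesis by (simp add: gauss_map_def)
qed

lemma gauss_map_iter_cf_tail:
  assumes "pos_word w" "0 < t" "t < 1" "j \<le> length w"
  shows "(gauss_map ^^ j) (cf_tail w t) = cf_tail (drop j w) t"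
  using assms
proof (induction j arbitrary: w)
  case (Suc j)
  then obtain a v where w: "w = a # v" by (cases w) auto
  have "(gauss_map ^^ Suc j) (cf_tail w t) = (gauss_map ^^ j) (gauss_map (cf_tail w t))"
    by (simp add: funpow_swap1)
  also have "\<dots> = (gauss_map ^^ j) (cf_tail v t)"
    using Suc.prems w by (subst w, subst gauss_map_cf_tail) auto
  finally show ?case using Suc w by simp
qed simp

lemma gauss_map_range: "0 \<le> gauss_map x \<and> gauss_map x < 1"
  by (auto simp: gauss_map_def intro: floor_le_ceiling) linarith+

lemma gauss_map_irrational:
  assumes "x \<notin> \<rat>" shows "gauss_map x \<notin> \<rat>"
proof
  assume g: "gauss_map x \<in> \<rat>"
  have "x \<noteq> 0" using assms by auto
  hence "1 / x = gauss_map x + of_int \<lfloor>1 / x\<rfloor>" by (simp add: gauss_map_def)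
  also have "\<dots> \<in> \<rat>" using g by (intro Rats_add) auto
  finally have "inverse (1 / x) \<in> \<rat>" by (rule Rats_inverse)
  thus False using assms by simp
qed

text \<open>If the orbit hits 0, as it does for rational \<open>t\<close>, the digit becomes 0
  because of \<open>1 / 0 = 0\<close>; genuine digits are claimed for irrational \<open>t\<close>
  only.\<close>

definition cf_digit :: "real \<Rightarrow> nat \<Rightarrow> nat" where
  "cf_digit t i = nat \<lfloor>1 / (gauss_map ^^ i) t\<rfloor>"

lemma gauss_iter_unit:
  assumes "t \<notin> \<rat>" "0 < t" "t < 1"
  shows "(gauss_map ^^ i) t \<notin> \<rat> \<and> 0 < (gauss_map ^^ i) t \<and> (gauss_map ^^ i) t < 1"
proof (induction i)
  case (Suc i)
  have "gauss_map ((gauss_map ^^ i) t) \<notin> \<rat>" using Suc gauss_map_irrational by blast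
  moreover from this have "gauss_map ((gauss_map ^^ i) t) \<noteq> 0" by auto
  ultimately show ?case using gauss_map_range[of "(gauss_map ^^ i) t"] by auto
qed (use assms in auto)

lemma cf_digit_step:
  assumes "t \<notin> \<rat>" "0 < t" "t < 1"
  shows "cf_digit t i > 0" "(gauss_map ^^ i) t = 1 / (real (cf_digit t i) + (gauss_map ^^ Suc i) t)"
proof -
  define s where "s = (gauss_map ^^ i) t"
  have s: "0 < s" "s < 1" using gauss_iter_unit[OF assms] by (auto simp: s_def)
  have "1 / s \<ge> 1" using s by simp
  hence f: "\<lfloor>1 / s\<rfloor> \<ge> 1" by linarith
  thus "cf_digit t i > 0" unfolding cf_digit_def s_def[symmetric] by linarith
  have "gauss_map s = 1 / s - real (nat \<lfloor>1 / s\<rfloor>)" using s f by (simp add: gauss_map_def)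
  thus "(gauss_map ^^ i) t = 1 / (real (cf_digit t i) + (gauss_map ^^ Suc i) t)"
    unfolding cf_digit_def using s by (simp add: s_def[symmetric])
qed

lemma cf_tail_digits:
  assumes "t \<notin> \<rat>" "0 < t" "t < 1"
  shows "cf_tail (map (cf_digit t) [i..<i + n]) ((gauss_map ^^ (i + n)) t) = (gauss_map ^^ i) t"
proof (induction n arbitrary: i)
  case (Suc n)
  have "cf_tail (map (cf_digit t) [i..<i + Suc n]) r =
      1 / (real (cf_digit t i) + cf_tail (map (cf_digit t) [Suc i..<Suc i + n]) r)" for r
    by (simp add: upt_conv_Cons del: upt_Suc)
  from this[of "(gauss_map ^^ (Suc i + n)) t"]
  show ?case
    using Suc.IH[of "Suc i"] cf_digit_step(2)[OF assms, of i] by (simp only: add_Suc add_Suc_right)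
qed simp

lemma pos_word_map: "(\<And>i. a i > 0) \<Longrightarrow> pos_word (map a xs)"
  by (auto simp: pos_word_def)

text \<open>Longer convergents are values of the same contraction \<open>cf_tail\<close> at other
  points of [0,1]. The start \<open>m\<close> is arbitrary because the tails will be the orbit under
  the Gauss map.\<close>

lemma cf_converges:
  fixes a :: "nat \<Rightarrow> nat"
  assumes "\<And>i. a i > 0"
  shows "convergent (\<lambda>n. cf_tail (map a [m..<m + n]) 0)"
proof (rule Cauchy_convergent, rule CauchyI')
  fix e :: real assume "e > 0"
  obtain N where N: "(1/2::real) ^ N < e / 2" using real_arch_pow_inv[of "e/2" "1/2"] \<open>e > 0\<close> by auto
  have "dist (cf_tail (map a [m..<m + i]) 0) (cf_tail (map a [m..<m + j]) 0) < e" if "i \<ge> N" "i < j" for i j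
  proof -
    have "[m..<m + j] = [m..<m + i] @ [m + i..<m + j]"
      using upt_add_eq_append[of m "m + i" "j - i"] that by simp
    hence "dist (cf_tail (map a [m..<m + i]) 0) (cf_tail (map a [m..<m + j]) 0) =
        \<bar>cf_tail (map a [m..<m + i]) 0 - cf_tail (map a [m..<m + i]) (cf_tail (map a [m + i..<m + j]) 0)\<bar>"
      by (simp add: cf_tail_append dist_real_def)
    also have "\<dots> \<le> 2 / 2 ^ length (map a [m..<m + i])"
      by (intro cf_tail_close pos_word_map assms cf_tail_nonneg cf_tail_le_1) auto
    also have "\<dots> = 2 * (1/2) ^ i" by (simp add: power_divide)
    also have "\<dots> \<le> 2 * (1/2) ^ N" using that by (simp add: power_decreasing)
    also have "\<dots> < e" using N by simp
    finally show ?thesis .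
  qed
  thus "\<exists>M. \<forall>i\<ge>M. \<forall>j>i. dist (cf_tail (map a [m..<m + i]) 0) (cf_tail (map a [m..<m + j]) 0) < e"
    by blast
qed

definition cf_lim :: "(nat \<Rightarrow> nat) \<Rightarrow> nat \<Rightarrow> real" where
  "cf_lim a m = lim (\<lambda>n. cf_tail (map a [m..<m + n]) 0)"

lemma cf_lim:
  assumes "\<And>i. a i > 0"
  shows "(\<lambda>n. cf_tail (map a [m..<m + n]) 0) \<longlonglongrightarrow> cf_lim a m"
  using cf_converges[of a m, OF assms] unfolding cf_lim_def by (simp add: convergent_LIMSEQ_iff)

lemma cf_lim_step:
  assumes a: "\<And>i. a i > 0"
  shows "cf_lim a m = 1 / (a m + cf_lim a (Suc m))" "0 \<le> cf_lim a m"
proof -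
  show nn: "0 \<le> cf_lim a m" for m
    by (rule LIMSEQ_le_const[OF cf_lim[of a m, OF a]]) (auto intro: cf_tail_nonneg)
  have "a m + cf_lim a (Suc m) \<noteq> 0" using a[of m] nn[of "Suc m"] by (simp add: add_nonneg_eq_0_iff)
  hence "(\<lambda>n. 1 / (a m + cf_tail (map a [Suc m..<Suc m + n]) 0)) \<longlonglongrightarrow> 1 / (a m + cf_lim a (Suc m))"
    by (intro tendsto_intros cf_lim[of a, OF a])
  moreover have "(\<lambda>n. 1 / (a m + cf_tail (map a [Suc m..<Suc m + n]) 0)) = 
      (\<lambda>n. cf_tail (map a [m..<m + Suc n]) 0)"
    by (intro ext) (simp add: upt_conv_Cons del: upt_Suc)
  ultimately have "(\<lambda>n. cf_tail (map a [m..<m + Suc n]) 0) \<longlonglongrightarrow> 1 / (a m + cf_lim a (Suc m))" by simp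
  from LIMSEQ_unique[OF LIMSEQ_Suc[OF cf_lim[of a m, OF a]] this]
  show "cf_lim a m = 1 / (a m + cf_lim a (Suc m))" .
qed

lemma cf_lim_unit:
  assumes a: "\<And>i. a i > 0"
  shows "0 < cf_lim a m" "cf_lim a m < 1"
proof -
  show pos: "0 < cf_lim a m" for m
    using cf_lim_step[of a m, OF a] cf_lim_step(2)[of a "Suc m", OF a] a[of m]
    by (metis add_pos_nonneg of_nat_0_less_iff zero_less_divide_1_iff)
  have "real (a m) \<ge> 1" using a[of m] by (simp add: Suc_le_eq)
  thus "cf_lim a m < 1" using cf_lim_step(1)[of a m, OF a] pos[of "Suc m"] by (simp add: divide_less_eq)
qed

lemma cf_lim_tail:
  assumes a: "\<And>i. a i > 0"
  shows "cf_lim a m = cf_tail (map a [m..<m + n]) (cf_lim a (m + n))"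
proof (induction n arbitrary: m)
  case (Suc n)
  have "cf_tail (map a [m..<m + Suc n]) r = 1 / (real (a m) + cf_tail (map a [Suc m..<Suc m + n]) r)" for r
    by (simp add: upt_conv_Cons del: upt_Suc)
  from this[of "cf_lim a (Suc m + n)"]
  show ?case using Suc.IH[of "Suc m"] cf_lim_step(1)[of a m, OF a] by simp
qed simp

lemma gauss_map_iter_cf_lim:
  assumes a: "\<And>i. a i > 0"
  shows "(gauss_map ^^ j) (cf_lim a 0) = cf_lim a j"
proof -
  have "cf_lim a 0 = cf_tail (map a [0..<j]) (cf_lim a j)" using cf_lim_tail[of a 0 j, OF a] by simp
  thus ?thesis using gauss_map_iter_cf_tail[OF pos_word_map[of a, OF a] cf_lim_unit[of a j, OF a], of j "[0..<j]"] by simp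
qed

section \<open>A strong law of large numbers\<close>

text \<open>Between consecutive squares there are only 2k further indices, negligible against k^2,
  and the terms are bounded.\<close>

lemma average_along_squares:
  fixes a :: "nat \<Rightarrow> real"
  assumes B: "\<And>j. \<bar>a j\<bar> \<le> B"
    and sq: "(\<lambda>k. (\<Sum>j<k\<^sup>2. a j) / (real k)\<^sup>2) \<longlonglongrightarrow> 0"
  shows "(\<lambda>n. (\<Sum>j<n. a j) / n) \<longlonglongrightarrow> 0"
proof -
  define r where "r n = nat \<lfloor>sqrt (real n)\<rfloor>" for n
  have B0: "B \<ge> 0" using B[of 0] by linarith
  have r_le: "real (r n) \<le> sqrt n" "sqrt n < real (r n) + 1" for n
    unfolding r_def by (simp_all add: of_nat_nat)
  have r_lim: "filterlim r at_top sequentially"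
    unfolding filterlim_at_top eventually_sequentially
  proof (intro allI exI impI)
    fix Z n :: nat assume "n \<ge> Z\<^sup>2"
    hence "real Z ^ 2 \<le> real n" by (metis of_nat_le_iff of_nat_power)
    hence "real Z \<le> sqrt n" by (rule real_le_rsqrt)
    thus "Z \<le> r n" using r_le(2)[of n] by linarith
  qed
  have sq': "(\<lambda>n. \<bar>(\<Sum>j<(r n)\<^sup>2. a j) / (real (r n))\<^sup>2\<bar> + 2 * B / real (r n)) \<longlonglongrightarrow> \<bar>0\<bar> + 0"
  proof (intro tendsto_add tendsto_rabs)
    show "(\<lambda>n. (\<Sum>j<(r n)\<^sup>2. a j) / (real (r n))\<^sup>2) \<longlonglongrightarrow> 0"
      by (rule filterlim_compose[OF sq r_lim])
    show "(\<lambda>n. 2 * B / real (r n)) \<longlonglongrightarrow> 0"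
      by (rule filterlim_compose[OF _ r_lim, of "\<lambda>k. 2 * B / real k"]) (rule lim_const_over_n)
  qed
  show ?thesis
  proof (rule Lim_null_comparison[OF _ sq'[simplified]])
    show "\<forall>\<^sub>F n in sequentially. norm ((\<Sum>j<n. a j) / n) \<le> \<bar>\<Sum>j<(r n)\<^sup>2. a j\<bar> / (real (r n))\<^sup>2 + 2 * B / real (r n)"
      using eventually_ge_at_top[of 1]
    proof eventually_elim
      case (elim n)
      define k where "k = r n"
      have "1 \<le> sqrt n" using elim by simp
      hence k1: "k \<ge> 1" using r_le(2)[of n] unfolding k_def by linarith
      have "(real k)\<^sup>2 \<le> (sqrt n)\<^sup>2" unfolding k_def by (rule power_mono[OF r_le(1)]) simp
      hence kn: "(real k)\<^sup>2 \<le> n" by simp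
      hence kn': "k\<^sup>2 \<le> n" by (metis of_nat_le_iff of_nat_power)
      have "(sqrt n)\<^sup>2 < (real k + 1)\<^sup>2" unfolding k_def by (rule power_strict_mono[OF r_le(2)]) auto
      hence nk: "real n - (real k)\<^sup>2 \<le> 2 * k + 1" by (simp add: power2_eq_square algebra_simps)
      have "n < (k + 1)\<^sup>2" using \<open>(sqrt n)\<^sup>2 < (real k + 1)\<^sup>2\<close> 
        by (metis of_nat_0_le_iff of_nat_1 of_nat_add of_nat_less_iff of_nat_power real_sqrt_pow2)
      hence nk: "n - k\<^sup>2 \<le> 2 * k" by (simp add: power2_eq_square)
      have split: "(\<Sum>j<n. a j) = (\<Sum>j<k\<^sup>2. a j) + (\<Sum>j\<in>{k\<^sup>2..<n}. a j)"
        using kn' by (simp add: lessThan_atLeast0 sum.atLeastLessThan_concat)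
      have "\<bar>\<Sum>j\<in>{k\<^sup>2..<n}. a j\<bar> \<le> (\<Sum>j\<in>{k\<^sup>2..<n}. B)"
        by (rule order_trans[OF sum_abs sum_mono]) (rule B)
      also have "\<dots> = real (n - k\<^sup>2) * B" by simp
      also have "\<dots> \<le> real (2 * k) * B" using nk B0 by (intro mult_right_mono of_nat_mono)
      finally have tail: "\<bar>\<Sum>j\<in>{k\<^sup>2..<n}. a j\<bar> \<le> 2 * k * B" by simp
      have "norm ((\<Sum>j<n. a j) / n) \<le> (\<bar>\<Sum>j<k\<^sup>2. a j\<bar> + 2 * k * B) / n"
        using tail unfolding split by (simp add: divide_right_mono)
      also have "\<dots> \<le> (\<bar>\<Sum>j<k\<^sup>2. a j\<bar> + 2 * k * B) / (real k)\<^sup>2"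
        using kn k1 B0 elim by (intro divide_left_mono) (auto intro!: mult_pos_pos)
      also have "\<dots> = \<bar>\<Sum>j<k\<^sup>2. a j\<bar> / (real k)\<^sup>2 + 2 * B / k"
        using k1 by (simp add: field_simps power2_eq_square)
      finally show ?case by (simp add: k_def)
    qed
  qed
qed

text \<open>Decaying correlations give a second moment O(n) for the sum of n terms. Along n = k^2
  the mean squares of the averages are at most a constant over k^2, so their series is integrable
  and the averages tend to 0 almost everywhere; boundedness fills the gaps between squares.\<close>

lemma (in finite_measure) strong_law_decay:
  fixes X :: "nat \<Rightarrow> 'a \<Rightarrow> real"
  assumes [measurable]: "\<And>j. X j \<in> borel_measurable M"
    and B: "\<And>j x. \<bar>X j x\<bar> \<le> B"
    and cov: "\<And>i j. i \<le> j \<Longrightarrow> (\<integral>x. X i x * X j x \<partial>M) \<le> C * \<theta> ^ (j - i)"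
    and C: "0 \<le> C" "0 \<le> \<theta>" "\<theta> < 1"
  shows "AE x in M. (\<lambda>n. (\<Sum>j<n. X j x) / n) \<longlonglongrightarrow> 0"
proof -
  define S where "S n x = (\<Sum>j<n. X j x)" for n x
  have [measurable]: "S n \<in> borel_measurable M" for n unfolding S_def by measurable
  have B0: "B \<ge> 0" using B[of 0 undefined] by linarith
  have intXX: "integrable M (\<lambda>x. X i x * X j x)" for i j
    by (rule integrable_const_bound[where B = "B * B"])
       (auto simp: abs_mult intro!: AE_I2 mult_mono B B0)
  \<comment> \<open>Twice the geometric series with first term \<open>C\<close>: the step from n to
    n + 1 adds the products with earlier terms twice and the diagonal one once; counting the
    diagonal twice completes the series.\<close>
  define D where "D = 2 * C / (1 - \<theta>)"
  have D0: "D \<ge> 0" using C by (simp add: D_def)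
  have intS: "integrable M (\<lambda>x. (S n x)\<^sup>2)" for n
    unfolding S_def power2_eq_square sum_product by (intro Bochner_Integration.integrable_sum intXX)
  have var: "(\<integral>x. (S n x)\<^sup>2 \<partial>M) \<le> D * n" for n
  proof (induction n)
    case (Suc n)
    have "(\<integral>x. (S (Suc n) x)\<^sup>2 \<partial>M) = 
        (\<integral>x. (S n x)\<^sup>2 + (2 * (\<Sum>i<n. X i x * X n x) + X n x * X n x) \<partial>M)"
      by (intro Bochner_Integration.integral_cong)
         (auto simp: S_def power2_eq_square algebra_simps sum_distrib_left)
    also have "\<dots> = (\<integral>x. (S n x)\<^sup>2 \<partial>M) + (2 * (\<Sum>i<n. (\<integral>x. X i x * X n x \<partial>M)) + (\<integral>x. X n x * X n x \<partial>M))"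
      using intXX intS by (subst Bochner_Integration.integral_add, simp, simp, subst Bochner_Integration.integral_add) auto
    also have "\<dots> \<le> D * n + (2 * (\<Sum>i<n. C * \<theta> ^ (n - i)) + 2 * (C * \<theta> ^ (n - n)))"
      using Suc cov[of n n] cov[of _ n] C by (intro add_mono mult_left_mono sum_mono) auto
    also have "\<dots> = D * n + 2 * C * (\<Sum>i<Suc n. \<theta> ^ (n - i))"
      by (simp add: sum_distrib_left algebra_simps)
    also have "(\<Sum>i<Suc n. \<theta> ^ (n - i)) = (\<Sum>i<Suc n. \<theta> ^ i)"
      by (rule sum.reindex_bij_witness[of _ "\<lambda>i. n - i" "\<lambda>i. n - i"]) auto
    also have "\<dots> = (1 - \<theta> ^ Suc n) / (1 - \<theta>)" using C by (subst sum_gp_strict) auto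
    also have "2 * C * ((1 - \<theta> ^ Suc n) / (1 - \<theta>)) \<le> 2 * C * (1 / (1 - \<theta>))"
      using C by (intro mult_left_mono divide_right_mono) auto
    finally show ?case by (simp add: D_def algebra_simps add_divide_distrib)
  qed (simp add: S_def)
  define Y where "Y k x = (S ((Suc k)\<^sup>2) x / (real (Suc k))\<^sup>2)\<^sup>2" for k x
  have [measurable]: "Y k \<in> borel_measurable M" for k unfolding Y_def by measurable
  have nn: "(\<integral>\<^sup>+x. ennreal (Y k x) \<partial>M) \<le> ennreal (D * (1 / (real (Suc k))\<^sup>2))" for k
  proof -
    have "(\<integral>\<^sup>+x. ennreal (Y k x) \<partial>M) = ennreal (\<integral>x. Y k x \<partial>M)"
      unfolding Y_def power_divide by (intro nn_integral_eq_integral) (auto intro!: intS)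
    also have "(\<integral>x. Y k x \<partial>M) = (\<integral>x. (S ((Suc k)\<^sup>2) x)\<^sup>2 \<partial>M) / ((real (Suc k))\<^sup>2)\<^sup>2"
      unfolding Y_def power_divide by simp
    also have "\<dots> \<le> (D * real ((Suc k)\<^sup>2)) / ((real (Suc k))\<^sup>2)\<^sup>2"
      by (intro divide_right_mono var) simp
    also have "\<dots> = D * (1 / (real (Suc k))\<^sup>2)"
      unfolding of_nat_power by (simp add: power2_eq_square del: of_nat_Suc)
    finally show ?thesis by (simp add: ennreal_leI)
  qed
  have summ: "summable (\<lambda>k. D * (1 / (real (Suc k))\<^sup>2))"
    using inverse_squares_sums by (intro summable_mult) (simp add: sums_iff)
  have "(\<integral>\<^sup>+x. (\<Sum>k. ennreal (Y k x)) \<partial>M) = (\<Sum>k. \<integral>\<^sup>+x. ennreal (Y k x) \<partial>M)"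
    by (rule nn_integral_suminf) simp
  also have "\<dots> \<le> (\<Sum>k. ennreal (D * (1 / (real (Suc k))\<^sup>2)))" by (intro suminf_le nn) auto
  also have "\<dots> = ennreal (\<Sum>k. D * (1 / (real (Suc k))\<^sup>2))"
    using summ D0 by (intro suminf_ennreal2) auto
  also have "\<dots> < \<infinity>" by simp
  finally have "(\<integral>\<^sup>+x. (\<Sum>k. ennreal (Y k x)) \<partial>M) \<noteq> \<infinity>" by simp
  hence "AE x in M. (\<Sum>k. ennreal (Y k x)) \<noteq> \<infinity>" by (intro nn_integral_PInf_AE) auto
  thus ?thesis
  proof eventually_elim
    case (elim x)
    have "summable (\<lambda>k. Y k x)" using elim by (intro summable_suminf_not_top) (auto simp: Y_def)
    hence "(\<lambda>k. Y k x) \<longlonglongrightarrow> 0" by (rule summable_LIMSEQ_zero)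
    hence "(\<lambda>k. sqrt (Y k x)) \<longlonglongrightarrow> sqrt 0" by (rule tendsto_real_sqrt)
    hence "(\<lambda>k. \<bar>S ((Suc k)\<^sup>2) x / (real (Suc k))\<^sup>2\<bar>) \<longlonglongrightarrow> 0" by (simp add: Y_def)
    hence "(\<lambda>k. S ((Suc k)\<^sup>2) x / (real (Suc k))\<^sup>2) \<longlonglongrightarrow> 0" by (rule tendsto_rabs_zero_cancel)
    hence "(\<lambda>k. S (k\<^sup>2) x / (real k)\<^sup>2) \<longlonglongrightarrow> 0" by (rule LIMSEQ_imp_Suc)
    thus ?case using average_along_squares[of "\<lambda>j. X j x" B] B by (simp add: S_def)
  qed
qed

section \<open>Transfer operators\<close>

definition lip :: "real \<Rightarrow> (real \<Rightarrow> real) \<Rightarrow> bool" where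
  "lip c g \<longleftrightarrow> c \<ge> 0 \<and> (\<forall>x\<in>{0..1}. \<forall>y\<in>{0..1}. \<bar>g x - g y\<bar> \<le> c * \<bar>x - y\<bar>)"

lemma lip_continuous: "lip c g \<Longrightarrow> continuous_on {0..1} g"
  by (rule lipschitz_on_continuous_on[of c], rule lipschitz_onI) (auto simp: lip_def dist_real_def)

lemma lip_bounded: "lip c g \<Longrightarrow> x \<in> {0..1} \<Longrightarrow> \<bar>g x\<bar> \<le> \<bar>g 0\<bar> + c"
proof -
  assume "lip c g" "x \<in> {0..1}"
  hence "\<bar>g x - g 0\<bar> \<le> c * \<bar>x - 0\<bar>" "c \<ge> 0" unfolding lip_def by force+
  moreover have "c * \<bar>x\<bar> \<le> c * 1" using \<open>c \<ge> 0\<close> \<open>x \<in> {0..1}\<close> by (intro mult_left_mono) auto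
  ultimately show ?thesis by simp
qed

abbreviation U :: "real set" where "U \<equiv> {0<..<1}"

text \<open>A map \<open>T\<close> of the unit interval with countably many full branches:
  \<open>\<phi> k\<close> are the inverse branches, \<rho> is the invariant density, and
  \<open>p k t\<close> is the conditional probability of the preimage \<open>\<phi> k t\<close> of
  t. That the weights add up to 1 expresses the invariance of \<rho>. Indices outside
  \<open>I\<close> have weight 0, so that finitely and infinitely many branches share one series
  over the naturals. The heart is \<open>contr\<close>: averaging over preimages contracts Lipschitz
  constants by \<theta>.\<close>

locale transfer_system =
  fixes \<rho> :: "real \<Rightarrow> real" and T :: "real \<Rightarrow> real" and \<phi> \<phi>' p :: "nat \<Rightarrow> real \<Rightarrow> real"
    and l r :: "nat \<Rightarrow> real" and I :: "nat set" and \<theta> :: real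
  assumes \<rho>_cont: "continuous_on {0..1} \<rho>" and \<rho>_nonneg: "\<And>x. x \<in> {0..1} \<Longrightarrow> 0 \<le> \<rho> x"
    and \<rho>_int: "(LINT x:U|lebesgue. \<rho> x) = 1"
    and T_meas [measurable]: "T \<in> borel_measurable borel"
    and T_\<phi>: "\<And>k t. k \<in> I \<Longrightarrow> t \<in> U \<Longrightarrow> T (\<phi> k t) = t"
    and \<phi>_img: "\<And>k. k \<in> I \<Longrightarrow> \<phi> k ` U = {l k<..<r k}"
    and \<phi>_sub: "\<And>k. k \<in> I \<Longrightarrow> {l k<..<r k} \<subseteq> U"
    and \<phi>_disj: "\<And>i j. i \<in> I \<Longrightarrow> j \<in> I \<Longrightarrow> i \<noteq> j \<Longrightarrow> {l i<..<r i} \<inter> {l j<..<r j} = {}"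
    and \<phi>_cover: "AE x in lebesgue. x \<in> U \<longrightarrow> (\<exists>k\<in>I. x \<in> {l k<..<r k})"
    and \<phi>_deriv: "\<And>k t. k \<in> I \<Longrightarrow> t \<in> U \<Longrightarrow> (\<phi> k has_real_derivative \<phi>' k t) (at t)"
    and \<phi>_range: "\<And>k t. t \<in> {0..1} \<Longrightarrow> \<phi> k t \<in> {0..1}"
    and \<phi>_cont: "\<And>k. continuous_on {0..1} (\<phi> k)"
    and p_cont: "\<And>k. continuous_on {0..1} (p k)"
    and p_nonneg: "\<And>k t. t \<in> {0..1} \<Longrightarrow> 0 \<le> p k t"
    and p_off: "\<And>k t. k \<notin> I \<Longrightarrow> p k t = 0"
    and p_sums: "\<And>t. t \<in> {0..1} \<Longrightarrow> (\<lambda>k. p k t) sums 1"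
    and jac: "\<And>k t. k \<in> I \<Longrightarrow> t \<in> U \<Longrightarrow> \<rho> (\<phi> k t) * \<bar>\<phi>' k t\<bar> = p k t * \<rho> t"
    and contr: "\<And>g c. lip c g \<Longrightarrow> lip (\<theta> * c) (\<lambda>x. \<Sum>k. p k x * g (\<phi> k x))"
    and \<theta>: "0 \<le> \<theta>" "\<theta> < 1"
begin

text \<open>The transfer operator normalised by \<rho>: the adjoint of composition with
  \<open>T\<close> for the measure with density \<rho>, see \<open>duality\<close>.\<close>

definition P :: "(real \<Rightarrow> real) \<Rightarrow> real \<Rightarrow> real" where
  "P g x = (\<Sum>k. p k x * g (\<phi> k x))"

definition E :: "(real \<Rightarrow> real) \<Rightarrow> real" where
  "E F = (LINT x:U|lebesgue. \<rho> x * F x)"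

text \<open>The factor \<open>indicator U\<close> is there because nothing is known about \<rho> or
  \<open>P g\<close> outside the unit interval.\<close>

definition bm :: "(real \<Rightarrow> real) \<Rightarrow> bool" where
  "bm F \<longleftrightarrow> (\<exists>B. \<forall>x\<in>U. \<bar>F x\<bar> \<le> B) \<and> (\<lambda>x. indicator U x * F x) \<in> borel_measurable borel"

lemma cont_meas: "continuous_on {0..1} g \<Longrightarrow> (\<lambda>x. indicator U x * g x :: real) \<in> borel_measurable borel"
  using borel_measurable_continuous_on_indicator[of U g] continuous_on_subset[of "{0..1}" g U]
  by (simp add: greaterThanLessThan_subseteq_atLeastAtMost_iff)

lemma bm_lip: "lip c g \<Longrightarrow> bm g"
  unfolding bm_def using lip_bounded cont_meas lip_continuous 
  by (meson greaterThanLessThan_subseteq_atLeastAtMost_iff order_refl subsetD)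

lemma bm_bounded: "f \<in> borel_measurable borel \<Longrightarrow> (\<And>x. \<bar>f x\<bar> \<le> B) \<Longrightarrow> bm f"
  unfolding bm_def by (intro conjI exI[of _ B]) auto

lemma bm_mult: assumes "bm F" "bm G" shows "bm (\<lambda>x. F x * G x)"
proof -
  obtain B C where B: "\<And>x. x \<in> U \<Longrightarrow> \<bar>F x\<bar> \<le> B" and C: "\<And>x. x \<in> U \<Longrightarrow> \<bar>G x\<bar> \<le> C"
    using assms unfolding bm_def by blast
  have "\<bar>F x * G x\<bar> \<le> B * C" if "x \<in> U" for x
    unfolding abs_mult using B[OF that] C[OF that] by (intro mult_mono) auto
  moreover have "(\<lambda>x. (indicator U x * F x) * (indicator U x * G x)) \<in> borel_measurable borel"
    by (rule borel_measurable_times) (use assms in \<open>simp_all add: bm_def\<close>)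
  moreover have "(\<lambda>x. (indicator U x * F x) * (indicator U x * G x)) = (\<lambda>x. indicator U x * (F x * G x))"
    by (auto simp: indicator_def)
  ultimately show ?thesis unfolding bm_def by (intro conjI exI[of _ "B * C"]) auto
qed

lemma bm_\<rho>: "bm \<rho>"
proof -
  have "compact (\<rho> ` {0..1})" by (rule compact_continuous_image[OF \<rho>_cont]) simp
  hence "bounded (\<rho> ` {0..1})" by (rule compact_imp_bounded)
  thus ?thesis using cont_meas[OF \<rho>_cont] unfolding bm_def bounded_iff by force
qed

lemma bm_integrable: assumes "bm F" shows "set_integrable lebesgue U F"
proof -
  obtain B where B: "\<And>x. x \<in> U \<Longrightarrow> \<bar>F x\<bar> \<le> B" and m: "(\<lambda>x. indicator U x * F x) \<in> borel_measurable borel"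
    using assms unfolding bm_def by blast
  have "integrable lborel (\<lambda>x. indicator U x * F x)"
  proof (rule Bochner_Integration.integrable_bound[of _ "\<lambda>x. indicator U x * B"])
    show "AE x in lborel. norm (indicator U x * F x) \<le> norm (indicator U x * B)"
      using B by (auto simp: indicator_def intro!: AE_I2) (meson abs_ge_self order_trans B greaterThanLessThan_iff)
  qed (use m in auto)
  thus ?thesis unfolding set_integrable_def by (simp add: integrable_completion)
qed

lemma bm_integrable_\<rho>: "bm F \<Longrightarrow> set_integrable lebesgue U (\<lambda>x. \<rho> x * F x)"
  by (intro bm_integrable bm_mult bm_\<rho>)

lemma p_summable: 
  assumes "lip c g" "x \<in> {0..1}" shows "summable (\<lambda>k. p k x * g (\<phi> k x))"
proof (rule summable_comparison_test[of _ "\<lambda>k. (\<bar>g 0\<bar> + c) * p k x"])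
  show "\<exists>N. \<forall>k\<ge>N. norm (p k x * g (\<phi> k x)) \<le> (\<bar>g 0\<bar> + c) * p k x"
    using lip_bounded[OF assms(1) \<phi>_range[OF assms(2)]] p_nonneg[OF assms(2)]
    by (intro exI[of _ 0] allI impI) (simp add: abs_mult mult.commute mult_left_mono)
  show "summable (\<lambda>k. (\<bar>g 0\<bar> + c) * p k x)" using p_sums[OF assms(2)] by (intro summable_mult) (auto simp: sums_iff)
qed

lemma lip_P: "lip c g \<Longrightarrow> lip (\<theta> * c) (P g)"
  using contr unfolding P_def[abs_def] .

text \<open>Substitution of \<open>\<phi> k t\<close> for x on a single branch, where
  \<open>T\<close> undoes \<open>\<phi> k\<close>; the Jacobian is traded for the weight by
  \<open>jac\<close>.\<close>

lemma branch_integral: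
  assumes k: "k \<in> I" and f: "f \<in> borel_measurable borel" "\<And>x. \<bar>f x\<bar> \<le> B" and g: "lip c g"
  shows "(LINT x:{l k<..<r k}|lebesgue. \<rho> x * (f (T x) * g x)) =
         (LINT x:U|lebesgue. \<rho> x * (f x * (p k x * g (\<phi> k x))))"
proof -
  let ?F = "\<lambda>x. \<rho> x * (f (T x) * g x)"
  have "bm (\<lambda>x. f (T x))" using f by (intro bm_bounded[of _ B]) auto
  hence "set_integrable lebesgue U ?F" by (intro bm_integrable_\<rho> bm_mult bm_lip[OF g])
  hence int: "set_integrable lebesgue {l k<..<r k} ?F" by (rule set_integrable_subset) (use \<phi>_sub[OF k] in auto)
  have inj: "inj_on (\<phi> k) U" by (rule inj_on_inverseI[of _ T]) (use T_\<phi>[OF k] in auto)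
  have der: "(\<phi> k has_field_derivative \<phi>' k t) (at t within U)" if "t \<in> U" for t
    using \<phi>_deriv[OF k that] by (rule DERIV_subset) simp
  have U: "U \<in> sets lebesgue" by simp
  note cv = has_absolute_integral_change_of_variables_1'[OF U der inj, of ?F "integral {l k<..<r k} ?F", unfolded \<phi>_img[OF k]]
  have 1: "(\<lambda>t. \<bar>\<phi>' k t\<bar> * ?F (\<phi> k t)) absolutely_integrable_on U"
    "integral U (\<lambda>t. \<bar>\<phi>' k t\<bar> * ?F (\<phi> k t)) = integral {l k<..<r k} ?F" using cv int by blast+
  have "(LINT x:{l k<..<r k}|lebesgue. ?F x) = integral {l k<..<r k} ?F"
    using set_lebesgue_integral_eq_integral(2)[OF int] .
  also have "\<dots> = (LINT t:U|lebesgue. \<bar>\<phi>' k t\<bar> * ?F (\<phi> k t))"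
    using set_lebesgue_integral_eq_integral(2)[OF 1(1)] 1(2) by simp
  also have "\<dots> = (LINT x:U|lebesgue. \<rho> x * (f x * (p k x * g (\<phi> k x))))"
  proof (intro set_lebesgue_integral_cong allI impI)
    fix t assume t: "t \<in> U"
    have "\<bar>\<phi>' k t\<bar> * ?F (\<phi> k t) = (\<rho> (\<phi> k t) * \<bar>\<phi>' k t\<bar>) * (f (T (\<phi> k t)) * g (\<phi> k t))"
      by (simp add: mult_ac)
    also have "\<dots> = \<rho> t * (f t * (p k t * g (\<phi> k t)))" using T_\<phi>[OF k t] jac[OF k t] by (simp add: mult_ac)
    finally show "\<bar>\<phi>' k t\<bar> * ?F (\<phi> k t) = \<rho> t * (f t * (p k t * g (\<phi> k t)))" .
  qed simp
  finally show ?thesis .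
qed

text \<open>Sum of \<open>branch_integral\<close> over all branches. The partial sums are dominated
  because the weights add up to 1 and a Lipschitz function is bounded on [0,1].\<close>

lemma duality:
  assumes f: "f \<in> borel_measurable borel" "\<And>x. \<bar>f x\<bar> \<le> B" and g: "lip c g"
  shows "E (\<lambda>x. f (T x) * g x) = E (\<lambda>x. f x * P g x)"
proof -
  have B0: "B \<ge> 0" using f(2)[of 0] by linarith
  let ?F = "\<lambda>x. \<rho> x * (f (T x) * g x)"
  define A where "A k = (if k \<in> I then {l k<..<r k} else {})" for k
  have A_sub: "(\<Union>k. A k) \<subseteq> U" using \<phi>_sub by (auto simp: A_def split: if_splits)
  have "bm (\<lambda>x. f (T x))" using f by (intro bm_bounded[of _ B]) auto
  hence int: "set_integrable lebesgue U ?F" by (intro bm_integrable_\<rho> bm_mult bm_lip[OF g])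
  hence intA: "set_integrable lebesgue (\<Union>k. A k) ?F"
    by (rule set_integrable_subset) (use A_sub in \<open>auto simp: A_def\<close>)
  define G where "G k x = \<rho> x * (f x * (p k x * g (\<phi> k x)))" for k x
  have bmg: "bm (\<lambda>x. p k x * g (\<phi> k x))" for k
  proof -
    have "continuous_on {0..1} (\<lambda>x. p k x * g (\<phi> k x))"
      by (intro continuous_on_mult p_cont continuous_on_compose2[OF lip_continuous[OF g] \<phi>_cont]) (use \<phi>_range in auto)
    moreover from this have "compact ((\<lambda>x. p k x * g (\<phi> k x)) ` {0..1})" by (rule compact_continuous_image) simp
    hence "bounded ((\<lambda>x. p k x * g (\<phi> k x)) ` {0..1})" by (rule compact_imp_bounded)
    ultimately show ?thesis using cont_meas unfolding bm_def bounded_iff by force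
  qed
  have intG: "set_integrable lebesgue U (G k)" for k
    unfolding G_def by (intro bm_integrable_\<rho> bm_mult bmg bm_bounded[OF f])
  have "E (\<lambda>x. f (T x) * g x) = (LINT x:(\<Union>k. A k)|lebesgue. ?F x)"
    unfolding E_def set_lebesgue_integral_def
  proof (rule integral_cong_AE)
    show "AE x in lebesgue. indicator U x *\<^sub>R ?F x = indicator (\<Union>k. A k) x *\<^sub>R ?F x"
      using \<phi>_cover
    proof eventually_elim
      case (elim x)
      have "x \<in> U \<longrightarrow> x \<in> (\<Union>k. A k)" using elim by (auto simp: A_def)
      hence "x \<in> U \<longleftrightarrow> x \<in> (\<Union>k. A k)" using A_sub by blast
      thus ?case by (simp add: indicator_def)
    qed
  qed (use int intA in \<open>auto simp: set_integrable_def\<close>)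
  also have "\<dots> = (\<Sum>k. LINT x:A k|lebesgue. ?F x)"
  proof (intro lebesgue_integral_countable_add intA)
    show "A i \<inter> A j = {}" if "i \<noteq> j" for i j
      using \<phi>_disj[of i j] that unfolding A_def by (simp del: greaterThanLessThan_iff Int_greaterThanLessThan)
  qed (auto simp: A_def)
  also have "(\<lambda>k. LINT x:A k|lebesgue. ?F x) = (\<lambda>k. LINT x:U|lebesgue. G k x)"
    using branch_integral[OF _ f g] p_off by (auto simp: A_def G_def set_lebesgue_integral_def)
  also have "(\<Sum>k. LINT x:U|lebesgue. G k x) = E (\<lambda>x. f x * P g x)"
  proof -
    have "(\<lambda>n. LINT x|lebesgue. (\<Sum>k<n. indicator U x * G k x)) \<longlonglongrightarrow> (LINT x|lebesgue. indicator U x * (\<rho> x * (f x * P g x)))"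
    proof (rule integral_dominated_convergence[where w = "\<lambda>x. indicator U x * (\<rho> x * (B * (\<bar>g 0\<bar> + c)))"])
      show "(\<lambda>x. indicator U x * (\<rho> x * (f x * P g x))) \<in> borel_measurable lebesgue"
        using bm_integrable_\<rho>[OF bm_mult[OF bm_bounded[OF f] bm_lip[OF lip_P[OF g]]]] by (simp add: set_integrable_def)
      show "(\<lambda>x. \<Sum>k<n. indicator U x * G k x) \<in> borel_measurable lebesgue" for n
        using intG by (intro borel_measurable_sum) (auto simp: set_integrable_def)
      show "integrable lebesgue (\<lambda>x. indicator U x * (\<rho> x * (B * (\<bar>g 0\<bar> + c))))"
        using bm_integrable_\<rho>[of "\<lambda>_. B * (\<bar>g 0\<bar> + c)"] bm_bounded[of "\<lambda>_. B * (\<bar>g 0\<bar> + c)" "\<bar>B * (\<bar>g 0\<bar> + c)\<bar>"] by (simp add: set_integrable_def)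
      show "AE x in lebesgue. (\<lambda>n. \<Sum>k<n. indicator U x * G k x) \<longlonglongrightarrow> indicator U x * (\<rho> x * (f x * P g x))"
      proof (intro AE_I2)
        fix x
        show "(\<lambda>n. \<Sum>k<n. indicator U x * G k x) \<longlonglongrightarrow> indicator U x * (\<rho> x * (f x * P g x))"
        proof (cases "x \<in> U")
          case True
          hence "summable (\<lambda>k. p k x * g (\<phi> k x))" by (intro p_summable[OF g]) auto
          hence "(\<lambda>k. p k x * g (\<phi> k x)) sums P g x" unfolding P_def by (rule summable_sums)
          hence "(\<lambda>k. \<rho> x * (f x * (p k x * g (\<phi> k x)))) sums (\<rho> x * (f x * P g x))"
            by (intro sums_mult)
          thus ?thesis using True by (simp add: sums_def G_def)
        qed simp
      qed
      show "AE x in lebesgue. norm (\<Sum>k<n. indicator U x * G k x) \<le> indicator U x * (\<rho> x * (B * (\<bar>g 0\<bar> + c)))" for n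
      proof (intro AE_I2)
        fix x
        show "norm (\<Sum>k<n. indicator U x * G k x) \<le> indicator U x * (\<rho> x * (B * (\<bar>g 0\<bar> + c)))"
        proof (cases "x \<in> U")
          case True
          hence x: "x \<in> {0..1}" by auto
          have c0: "c \<ge> 0" using g by (simp add: lip_def)
          have "\<bar>\<Sum>k<n. p k x * g (\<phi> k x)\<bar> \<le> (\<Sum>k<n. p k x * (\<bar>g 0\<bar> + c))"
            using p_nonneg[OF x] lip_bounded[OF g \<phi>_range[OF x]]
            by (intro order_trans[OF sum_abs sum_mono]) (auto simp: abs_mult intro!: mult_left_mono)
          also have "\<dots> = (\<Sum>k<n. p k x) * (\<bar>g 0\<bar> + c)" by (simp add: sum_distrib_right)
          also have "\<dots> \<le> 1 * (\<bar>g 0\<bar> + c)"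
            using sum_le_suminf[of "\<lambda>k. p k x" "{..<n}"] p_sums[OF x] p_nonneg[OF x] c0
            by (intro mult_right_mono) (auto simp: sums_iff)
          finally have *: "\<bar>\<Sum>k<n. p k x * g (\<phi> k x)\<bar> \<le> \<bar>g 0\<bar> + c" by simp
          have "(\<Sum>k<n. G k x) = \<rho> x * (f x * (\<Sum>k<n. p k x * g (\<phi> k x)))"
            by (simp add: G_def sum_distrib_left)
          also have "\<bar>\<dots>\<bar> \<le> \<rho> x * (B * (\<bar>g 0\<bar> + c))"
            unfolding abs_mult using \<rho>_nonneg[OF x] f(2) * B0 by (intro mult_mono) auto
          finally show ?thesis using True by simp
        qed simp
      qed
    qed
    moreover have "(LINT x|lebesgue. (\<Sum>k<n. indicator U x * G k x)) = (\<Sum>k<n. LINT x:U|lebesgue. G k x)" for n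
      using intG by (subst Bochner_Integration.integral_sum) (auto simp: set_integrable_def set_lebesgue_integral_def)
    ultimately have "(\<lambda>k. LINT x:U|lebesgue. G k x) sums E (\<lambda>x. f x * P g x)"
      by (simp add: sums_def E_def set_lebesgue_integral_def)
    thus ?thesis by (simp add: sums_iff)
  qed
  finally show ?thesis .
qed

lemma E_const [simp]: "E (\<lambda>x. c) = c"
  using \<rho>_int unfolding E_def set_lebesgue_integral_def by (simp flip: mult.assoc)

lemma E_diff: "bm F \<Longrightarrow> bm G \<Longrightarrow> E (\<lambda>x. F x - G x) = E F - E G"
  unfolding E_def right_diff_distrib by (intro set_integral_diff bm_integrable_\<rho>)

lemma E_mono: "bm F \<Longrightarrow> bm G \<Longrightarrow> (\<And>x. x \<in> U \<Longrightarrow> F x \<le> G x) \<Longrightarrow> E F \<le> E G"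
  unfolding E_def by (intro set_integral_mono bm_integrable_\<rho> mult_left_mono \<rho>_nonneg) auto

lemma bm_const: "bm (\<lambda>x. c)" by (rule bm_bounded[of _ "\<bar>c\<bar>"]) auto

lemma P_1: "x \<in> {0..1} \<Longrightarrow> P (\<lambda>_. c) x = c"
  unfolding P_def using p_sums[of x] sums_mult2[of "\<lambda>k. p k x" 1 c] by (simp add: sums_iff)

lemma E_cong: "(\<And>x. x \<in> U \<Longrightarrow> F x = G x) \<Longrightarrow> E F = E G"
  unfolding E_def by (intro set_lebesgue_integral_cong) auto

lemma lip_const: "lip 0 (\<lambda>_. c)" by (simp add: lip_def)

text \<open>Duality with the constant 1, which \<open>P\<close> fixes.\<close>

lemma E_invariant:
  assumes "f \<in> borel_measurable borel" "\<And>x. \<bar>f x\<bar> \<le> B" shows "E (\<lambda>x. f (T x)) = E f"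
proof -
  have "E (\<lambda>x. f (T x) * 1) = E (\<lambda>x. f x * P (\<lambda>_. 1) x)" by (rule duality[OF assms lip_const])
  also have "\<dots> = E f" by (rule E_cong) (simp add: P_1)
  finally show ?thesis by simp
qed

lemma funpow_meas [measurable]: "(T ^^ n) \<in> borel_measurable borel"
  by (induction n) (auto intro: measurable_comp)

lemma E_invariant_iter:
  assumes "f \<in> borel_measurable borel" "\<And>x. \<bar>f x\<bar> \<le> B" shows "E (\<lambda>x. f ((T ^^ n) x)) = E f"
proof (induction n)
  case (Suc n)
  have "E (\<lambda>x. f ((T ^^ Suc n) x)) = E (\<lambda>x. f ((T ^^ n) (T x)))" by (simp add: funpow_swap1)
  also have "\<dots> = E (\<lambda>x. f ((T ^^ n) x))"
    using assms by (intro E_invariant[of _ B]) auto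
  finally show ?case using Suc by simp
qed simp

text \<open>As \<open>g\<close> has mean 0, the value \<open>g x\<close> is the mean of
  \<open>g x - g y\<close> over y, and the oscillation of \<open>g\<close> is at most
  \<open>c\<close>.\<close>

lemma lip_mean:
  assumes g: "lip c g" and "E g = 0" and x: "x \<in> U"
  shows "\<bar>g x\<bar> \<le> c"
proof -
  have le: "\<bar>g x - g y\<bar> \<le> c" if "y \<in> U" for y
  proof -
    have "\<bar>g x - g y\<bar> \<le> c * \<bar>x - y\<bar>" "c \<ge> 0" using g x that by (auto simp: lip_def)
    moreover have "c * \<bar>x - y\<bar> \<le> c * 1" using \<open>c \<ge> 0\<close> x that by (intro mult_left_mono) auto
    ultimately show ?thesis by simp
  qed
  have "E (\<lambda>y. g x - g y) = g x - 0" using E_diff[OF bm_const bm_lip[OF g]] \<open>E g = 0\<close> by simp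
  moreover have "bm (\<lambda>y. g x - g y)" using g by (intro bm_lip[of c]) (auto simp: lip_def abs_minus_commute)
  hence "E (\<lambda>y. g x - g y) \<le> E (\<lambda>_. c)" "E (\<lambda>_. - c) \<le> E (\<lambda>y. g x - g y)"
    using le by (auto intro!: E_mono bm_const simp: abs_le_iff simp del: E_const) (smt (verit) le greaterThanLessThan_iff)+
  ultimately show ?thesis by simp
qed

text \<open>Duality turns each application of \<open>T\<close> inside \<open>f\<close> into an
  application of \<open>P\<close> to \<open>g\<close>. After n of them the Lipschitz constant has
  shrunk by \<theta>^n and the mean is still 0, so \<open>lip_mean\<close> bounds the supremum. Only
  \<open>g\<close> has to be Lipschitz; \<open>f\<close> is merely bounded.\<close>

lemma correlation_decay:
  assumes f: "f \<in> borel_measurable borel" "\<And>x. \<bar>f x\<bar> \<le> B" and g: "lip c g" "E g = 0"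
  shows "E (\<lambda>x. f ((T ^^ n) x) * g x) \<le> B * c * \<theta> ^ n"
  using g
proof (induction n arbitrary: g c)
  case 0
  have B0: "B \<ge> 0" using f(2)[of 0] by linarith
  have "E (\<lambda>x. f x * g x) \<le> E (\<lambda>_. B * c)"
  proof (rule E_mono)
    fix x assume "x \<in> U"
    have "f x * g x \<le> \<bar>f x\<bar> * \<bar>g x\<bar>" by (simp flip: abs_mult)
    also have "\<dots> \<le> B * c" using lip_mean[OF 0 \<open>x \<in> U\<close>] f(2) B0 by (intro mult_mono) auto
    finally show "f x * g x \<le> B * c" .
  qed (intro bm_mult bm_bounded[OF f] bm_lip[OF 0(1)] bm_const)+
  thus ?case by simp
next
  case (Suc n)
  have "E (\<lambda>x. f ((T ^^ Suc n) x) * g x) = E (\<lambda>x. (\<lambda>y. f ((T ^^ n) y)) (T x) * g x)" by (simp add: funpow_swap1)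
  also have "\<dots> = E (\<lambda>x. f ((T ^^ n) x) * P g x)"
    using f by (intro duality[OF _ _ Suc.prems(1), of _ B]) auto
  also have "\<dots> \<le> B * (\<theta> * c) * \<theta> ^ n"
  proof (rule Suc.IH[OF lip_P[OF Suc.prems(1)]])
    have "E (\<lambda>x. (\<lambda>_. 1) (T x) * g x) = E (\<lambda>x. (\<lambda>_. 1) x * P g x)"
      by (rule duality[OF _ _ Suc.prems(1), of _ 1]) auto
    thus "E (P g) = 0" using Suc.prems(2) by simp
  qed
  finally show ?case by (simp add: mult_ac)
qed

text \<open>\<open>strong_law_decay\<close> for the centred observable under the measure with
  density \<rho>; where \<rho> is positive, the null sets of that measure are Lebesgue null
  sets.\<close>

lemma strong_law:
  assumes f: "f \<in> borel_measurable borel" "\<And>x. \<bar>f x\<bar> \<le> B" "lip c f"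
  shows "AE x in lebesgue. x \<in> U \<longrightarrow> \<rho> x > 0 \<longrightarrow> (\<lambda>n. (\<Sum>j<n. f ((T ^^ j) x)) / n) \<longlonglongrightarrow> E f"
proof -
  define N where "N = density lebesgue (\<lambda>x. ennreal (indicator U x * \<rho> x))"
  have m: "(\<lambda>x. indicator U x * \<rho> x) \<in> borel_measurable lebesgue"
    using bm_integrable[OF bm_\<rho>] by (simp add: set_integrable_def)
  have nonneg: "0 \<le> indicator U x * \<rho> x" for x using \<rho>_nonneg[of x] by (auto simp: indicator_def)
  have int: "integral\<^sup>L N F = E F" if "F \<in> borel_measurable borel" for F
    unfolding N_def using that m nonneg
    by (subst integral_density) (auto simp: E_def set_lebesgue_integral_def mult_ac intro: measurable_completion)
  interpret N: finite_measure N
  proof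
    have "emeasure N (space N) = (\<integral>\<^sup>+x. ennreal (indicator U x * \<rho> x) \<partial>lebesgue)"
      unfolding N_def using m by (subst emeasure_density) (auto intro!: nn_integral_cong)
    also have "\<dots> = ennreal (LINT x|lebesgue. indicator U x * \<rho> x)"
      using nonneg bm_integrable[OF bm_\<rho>] by (intro nn_integral_eq_integral) (auto simp: set_integrable_def)
    finally show "emeasure N (space N) \<noteq> \<infinity>" by simp
  qed
  define h where "h x = f x - E f" for x
  define C where "C = B + \<bar>E f\<bar>"
  have h: "h \<in> borel_measurable borel" "\<And>x. \<bar>h x\<bar> \<le> C" "lip c h"
    using f by (auto simp: h_def[abs_def] C_def lip_def intro: order_trans[OF abs_triangle_ineq4])
  have C0: "C \<ge> 0" using h(2)[of 0] by linarith
  have Eh: "E h = 0" unfolding h_def by (subst E_diff) (auto intro: bm_const bm_bounded[OF f(1,2)])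
  have hm: "(\<lambda>x. h ((T ^^ j) x)) \<in> borel_measurable borel" for j using h(1) by measurable
  have "AE x in N. (\<lambda>n. (\<Sum>j<n. h ((T ^^ j) x)) / n) \<longlonglongrightarrow> 0"
  proof (rule N.strong_law_decay[where B = C and C = "C * c" and \<theta> = \<theta>])
    show "(\<lambda>x. h ((T ^^ j) x)) \<in> borel_measurable N" for j
      using hm[of j] unfolding N_def by (simp add: measurable_completion)
    fix i j :: nat assume "i \<le> j"
    have b: "\<bar>h ((T ^^ (j - i)) x) * h x\<bar> \<le> C * C" for x
      unfolding abs_mult using h(2) C0 by (intro mult_mono) auto
    have "(\<integral>x. h ((T ^^ i) x) * h ((T ^^ j) x) \<partial>N) = E (\<lambda>x. h ((T ^^ i) x) * h ((T ^^ j) x))"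
      by (intro int borel_measurable_times hm)
    \<comment> \<open>Invariance shifts the pair of times i, j to 0, j - i.\<close>
    also have "\<dots> = E (\<lambda>x. (\<lambda>y. h ((T ^^ (j - i)) y) * h y) ((T ^^ i) x))"
    proof -
      have "(T ^^ j) x = (T ^^ (j - i)) ((T ^^ i) x)" for x
        using \<open>i \<le> j\<close> funpow_add[of "j - i" i T] by (simp add: fun_eq_iff)
      thus ?thesis by (simp add: mult.commute)
    qed
    also have "\<dots> = E (\<lambda>y. h ((T ^^ (j - i)) y) * h y)"
      by (rule E_invariant_iter[of _ "C * C"]) (use b hm[of "j - i"] h(1) in auto)
    also have "\<dots> \<le> C * c * \<theta> ^ (j - i)" by (rule correlation_decay[OF h(1,2,3) Eh])
    finally show "(\<integral>x. h ((T ^^ i) x) * h ((T ^^ j) x) \<partial>N) \<le> C * c * \<theta> ^ (j - i)" .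
  qed (use h \<theta> C0 in \<open>auto simp: lip_def\<close>)
  hence "AE x in lebesgue. 0 < ennreal (indicator U x * \<rho> x) \<longrightarrow> (\<lambda>n. (\<Sum>j<n. h ((T ^^ j) x)) / n) \<longlonglongrightarrow> 0"
    unfolding N_def using m by (subst (asm) AE_density) auto
  thus ?thesis
  proof eventually_elim
    case (elim x)
    show ?case
    proof (intro impI)
      assume "x \<in> U" "\<rho> x > 0"
      hence "(\<lambda>n. (\<Sum>j<n. h ((T ^^ j) x)) / n) \<longlonglongrightarrow> 0" using elim by simp
      hence "(\<lambda>n. (\<Sum>j<n. h ((T ^^ j) x)) / n + E f) \<longlonglongrightarrow> 0 + E f" by (intro tendsto_intros)
      moreover have "\<forall>\<^sub>F n in sequentially. (\<Sum>j<n. h ((T ^^ j) x)) / n + E f = (\<Sum>j<n. f ((T ^^ j) x)) / n"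
        using eventually_gt_at_top[of 0]
        by eventually_elim (simp add: h_def sum_subtractf field_simps)
      ultimately show "(\<lambda>n. (\<Sum>j<n. f ((T ^^ j) x)) / n) \<longlonglongrightarrow> E f"
        by (simp add: tendsto_cong)
    qed
  qed
qed

end

section \<open>Typical points: frequencies of cells along almost every orbit\<close>

definition tent :: "real \<Rightarrow> real \<Rightarrow> real \<Rightarrow> real \<Rightarrow> real" where
  "tent \<alpha> \<beta> k v = max 0 (1 - k * max 0 (max (\<alpha> - v) (v - \<beta>)))"

lemma tent_bounds: "k \<ge> 0 \<Longrightarrow> 0 \<le> tent \<alpha> \<beta> k v \<and> tent \<alpha> \<beta> k v \<le> 1"
  by (simp add: tent_def)

lemma tent_eq_1: "\<alpha> \<le> v \<Longrightarrow> v \<le> \<beta> \<Longrightarrow> tent \<alpha> \<beta> k v = 1"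
  by (simp add: tent_def max_def)

lemma tent_supp: 
  assumes "k > 0" "tent \<alpha> \<beta> k v \<noteq> 0" shows "\<alpha> - 1 / k \<le> v \<and> v \<le> \<beta> + 1 / k"
proof -
  define m where "m = max 0 (max (\<alpha> - v) (v - \<beta>))"
  have "k * m < 1" using assms(2) unfolding tent_def m_def[symmetric] by (auto simp: max_def split: if_splits)
  hence "m < 1 / k" using assms(1) by (simp add: field_simps)
  moreover have "\<alpha> - v \<le> m" "v - \<beta> \<le> m" by (auto simp: m_def)
  ultimately show ?thesis by linarith
qed

lemma tent_lip: "k \<ge> 0 \<Longrightarrow> \<bar>tent \<alpha> \<beta> k u - tent \<alpha> \<beta> k v\<bar> \<le> k * \<bar>u - v\<bar>"
proof -
  assume k: "k \<ge> 0"
  define m where "m v = max 0 (max (\<alpha> - v) (v - \<beta>))" for v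
  have "\<bar>m u - m v\<bar> \<le> \<bar>u - v\<bar>" unfolding m_def by linarith
  hence "k * \<bar>m u - m v\<bar> \<le> k * \<bar>u - v\<bar>" using k by (rule mult_left_mono)
  moreover have "\<bar>max 0 (1 - p) - max 0 (1 - q)\<bar> \<le> \<bar>p - q\<bar>" for p q :: real by linarith
  moreover have "\<bar>k * m u - k * m v\<bar> = k * \<bar>m u - m v\<bar>" using k by (simp add: abs_mult flip: right_diff_distrib)
  ultimately show ?thesis unfolding tent_def m_def[symmetric] by (metis order_trans)
qed

lemma tent_meas [measurable]: "tent \<alpha> \<beta> k \<in> borel_measurable borel"
  unfolding tent_def[abs_def] by measurable

lemma cell_meas [measurable]: "cell K a \<in> sets borel"
proof -
  have "cell K a = (\<lambda>u. real K * u) -` ({real a..<real a + 1})" by (auto simp: cell_def floor_eq_iff)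
  moreover have "(\<lambda>u::real. real K * u) -` ({real a..<real a + 1}) \<inter> space borel \<in> sets borel"
    by (rule measurable_sets[of _ _ borel]) auto
  ultimately show ?thesis by simp
qed

lemma occ_sum: "finite S \<Longrightarrow> real (occ z S A) = (\<Sum>j\<in>S. indicator A (z j))"
  by (simp add: occ_def indicator_def sum.If_cases Int_def)

text \<open>From time \<Lambda> on, no cell is visited too often. The threshold is explicit because
  it decides how long a block has to be.\<close>

definition typical :: "nat \<Rightarrow> real \<Rightarrow> nat \<Rightarrow> (nat \<Rightarrow> real) \<Rightarrow> bool" where
  "typical Q \<delta> \<Lambda> z \<longleftrightarrow> (\<forall>L\<ge>\<Lambda>. \<forall>a<Q. real (occ z {..<L} (cell Q a)) \<le> (1 / Q + \<delta>) * L)"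

text \<open>The coordinate \<open>h\<close> pushes the invariant measure to one dominated by
  Lebesgue measure, so that cells of equal length get equal upper bounds.\<close>

locale transfer_system_coord = transfer_system +
  fixes h :: "real \<Rightarrow> real" and c0 :: real
  assumes h_meas [measurable]: "h \<in> borel_measurable borel" and h_lip: "lip c0 h"
    and h_unif: "\<And>\<alpha> \<beta>. \<alpha> \<le> \<beta> \<Longrightarrow> E (\<lambda>x. indicator {\<alpha>..\<beta>} (h x)) \<le> \<beta> - \<alpha>"
    and \<rho>_pos: "\<And>x. x \<in> U \<Longrightarrow> \<rho> x > 0"
begin

text \<open>The strong law needs a Lipschitz observable, so a cell is replaced by a
  \<open>tent\<close> that is 1 on it and falls to 0 within a short distance on either side. Only
  countably many tents occur, hence one null set serves all \<open>Q\<close> and \<delta>.\<close>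

lemma typical_AE:
  "AE x in lebesgue. x \<in> U \<longrightarrow> (\<forall>Q>0. \<forall>\<delta>>0. \<exists>\<Lambda>. typical Q \<delta> \<Lambda> (\<lambda>j. h ((T ^^ j) x)))"
proof -
  define f where "f Q a k x = tent (real a / real Q) ((real a + 1) / real Q) (real (Suc k)) (h x)" for Q a k :: nat and x
  have fm: "f Q a k \<in> borel_measurable borel" for Q a k unfolding f_def[abs_def] by measurable
  have fb: "\<bar>f Q a k x\<bar> \<le> 1" "0 \<le> f Q a k x" for Q a k x
    using tent_bounds[of "real (Suc k)" "real a / real Q" "(real a + 1) / real Q" "h x"] unfolding f_def by auto
  have c0: "c0 \<ge> 0" using h_lip by (simp add: lip_def)
  have fl: "lip (real (Suc k) * c0) (f Q a k)" for Q a k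
    unfolding lip_def
  proof (intro conjI ballI)
    fix x y :: real assume "x \<in> {0..1}" "y \<in> {0..1}"
    hence "\<bar>h x - h y\<bar> \<le> c0 * \<bar>x - y\<bar>" using h_lip by (auto simp: lip_def)
    hence "real (Suc k) * \<bar>h x - h y\<bar> \<le> real (Suc k) * (c0 * \<bar>x - y\<bar>)" by (intro mult_left_mono) auto
    thus "\<bar>f Q a k x - f Q a k y\<bar> \<le> real (Suc k) * c0 * \<bar>x - y\<bar>"
      unfolding f_def using tent_lip[of "real (Suc k)"] by (intro order_trans[OF tent_lip]) (auto simp: mult_ac)
  qed (use c0 in auto)
  have Ef: "E (f Q a k) \<le> 1 / real Q + 2 / real (Suc k)" if "Q > 0" for Q a k
  proof -
    let ?A = "{real a / real Q - 1 / real (Suc k)..(real a + 1) / real Q + 1 / real (Suc k)}"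
    have ab: "real a / real Q \<le> (real a + 1) / real Q" by (simp add: divide_right_mono)
    have "E (f Q a k) \<le> E (\<lambda>x. indicator ?A (h x))"
    proof (rule E_mono)
      fix x
      show "f Q a k x \<le> indicator ?A (h x)"
        using fb[of Q a k x] tent_supp[of "real (Suc k)" "real a / real Q" "(real a + 1) / real Q" "h x"]
        by (cases "f Q a k x = 0") (auto simp: f_def indicator_def simp del: of_nat_Suc)
    qed (auto intro!: bm_bounded[of _ 1] fm fb simp: indicator_def simp del: of_nat_Suc)
    also have "\<dots> \<le> ((real a + 1) / real Q + 1 / real (Suc k)) - (real a / real Q - 1 / real (Suc k))"
    proof (rule h_unif)
      have "0 \<le> 1 / real (Suc k)" by simp
      thus "real a / real Q - 1 / real (Suc k) \<le> (real a + 1) / real Q + 1 / real (Suc k)" using ab by linarith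
    qed
    also have "\<dots> = 1 / real Q + 2 / real (Suc k)"
      by (simp add: add_divide_distrib)
    finally show ?thesis .
  qed
  have "AE x in lebesgue. \<forall>Q a k. x \<in> U \<longrightarrow> \<rho> x > 0 \<longrightarrow> (\<lambda>n. (\<Sum>j<n. f Q a k ((T ^^ j) x)) / n) \<longlonglongrightarrow> E (f Q a k)"
    unfolding AE_all_countable using strong_law[OF fm fb(1) fl] by blast
  thus ?thesis
  proof eventually_elim
    case (elim x)
    show ?case
    proof (intro impI allI)
      fix Q :: nat and \<delta> :: real assume x: "x \<in> U" and Q: "Q > 0" and d: "\<delta> > 0"
      \<comment> \<open>The tent costs 2 / (k + 1) in the mean; 3 in place of 2 makes the inequality
        strict.\<close>
      obtain k where k: "real (Suc k) > 3 / \<delta>" using reals_Archimedean2[of "3 / \<delta>"]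
        by (metis less_Suc_eq of_nat_less_iff order_less_trans lessI)
      hence k': "3 / real (Suc k) < \<delta>" using d by (simp add: field_simps)
      have lim: "(\<lambda>n. (\<Sum>j<n. f Q a k ((T ^^ j) x)) / n) \<longlonglongrightarrow> E (f Q a k)" for a
        using elim x \<rho>_pos by blast
      have "\<forall>\<^sub>F n in sequentially. (\<Sum>j<n. f Q a k ((T ^^ j) x)) / n < 1 / real Q + \<delta>" for a
      proof (rule order_tendstoD(2)[OF lim])
        show "E (f Q a k) < 1 / real Q + \<delta>" using Ef[OF Q, of a k] k' d
          by (smt (verit) divide_right_mono of_nat_0_le_iff)
      qed
      hence "\<forall>\<^sub>F n in sequentially. \<forall>a\<in>{..<Q}. (\<Sum>j<n. f Q a k ((T ^^ j) x)) / n < 1 / real Q + \<delta>"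
        by (intro eventually_ball_finite) auto
      then obtain \<Lambda> where L: "\<And>n a. n \<ge> \<Lambda> \<Longrightarrow> a < Q \<Longrightarrow> (\<Sum>j<n. f Q a k ((T ^^ j) x)) / n < 1 / real Q + \<delta>"
        unfolding eventually_sequentially by blast
      show "\<exists>\<Lambda>. typical Q \<delta> \<Lambda> (\<lambda>j. h ((T ^^ j) x))"
        unfolding typical_def
      proof (intro exI[of _ "max 1 \<Lambda>"] allI impI)
        fix n a assume n: "max 1 \<Lambda> \<le> n" and a: "a < Q"
        have "real (occ (\<lambda>j. h ((T ^^ j) x)) {..<n} (cell Q a)) = (\<Sum>j<n. indicator (cell Q a) (h ((T ^^ j) x)))"
          by (rule occ_sum) simp
        also have "\<dots> \<le> (\<Sum>j<n. f Q a k ((T ^^ j) x))"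
        proof (rule sum_mono)
          fix j
          have "v \<in> cell Q a \<Longrightarrow> real a / real Q \<le> v \<and> v \<le> (real a + 1) / real Q" for v
            using Q by (auto simp: cell_def floor_eq_iff field_simps)
          thus "indicator (cell Q a) (h ((T ^^ j) x)) \<le> f Q a k ((T ^^ j) x)"
            using fb(2)[of Q a k "(T ^^ j) x"] unfolding f_def by (auto simp: indicator_def tent_eq_1)
        qed
        also have "\<dots> \<le> (1 / real Q + \<delta>) * n" using L[of n a] n a by (auto simp: field_simps)
        finally show "real (occ (\<lambda>j. h ((T ^^ j) x)) {..<n} (cell Q a)) \<le> (1 / real Q + \<delta>) * n" .
      qed
    qed
  qed
qed

end

text \<open>Continuity from above, as in Egorov's theorem. It turns a threshold that depends on the
  point into one threshold valid outside a small set.\<close>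

lemma eventually_small_measure:
  fixes A :: "nat \<Rightarrow> real set"
  assumes m: "\<And>n. A n \<in> sets lborel" and sub: "\<And>n. A n \<subseteq> U"
    and dec: "\<And>n. A (Suc n) \<subseteq> A n"
    and ae: "AE x in lebesgue. x \<in> U \<longrightarrow> (\<exists>n. x \<notin> A n)" and "\<epsilon> > 0"
  shows "\<exists>n. emeasure lborel (A n) < ennreal \<epsilon>"
proof -
  have fin: "emeasure lborel (A n) \<noteq> \<infinity>" for n
    using emeasure_mono[OF sub[of n], of lborel] by (auto simp: top_unique)
  have "(\<lambda>n. emeasure lborel (A n)) \<longlonglongrightarrow> emeasure lborel (\<Inter>n. A n)"
    by (intro Lim_emeasure_decseq fin) (use m dec in \<open>auto simp: decseq_Suc_iff\<close>)
  moreover have "emeasure lborel (\<Inter>n. A n) = 0"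
  proof -
    have "AE x in lborel. x \<notin> (\<Inter>n. A n)"
      using ae[unfolded AE_completion_iff] by eventually_elim (use sub in blast)
    moreover have "(\<Inter>n. A n) \<in> sets lborel" using m by blast
    ultimately have "(\<Inter>n. A n) \<in> null_sets lborel" by (subst AE_iff_null_sets)
    thus ?thesis by (rule null_setsD1)
  qed
  ultimately have "(\<lambda>n. emeasure lborel (A n)) \<longlonglongrightarrow> 0" by simp
  hence "\<forall>\<^sub>F n in sequentially. emeasure lborel (A n) < ennreal \<epsilon>"
    using \<open>\<epsilon> > 0\<close> by (intro order_tendstoD(2)) auto
  thus ?thesis by (auto simp: eventually_sequentially)
qed

lemma typical_meas:
  assumes [measurable]: "\<And>j. w j \<in> borel_measurable borel"
  shows "{x\<in>U. \<not> typical Q \<delta> \<Lambda> (\<lambda>j. w j x)} \<in> sets lborel"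
proof -
  have "{x\<in>U. \<not> typical Q \<delta> \<Lambda> (\<lambda>j. w j x)} = U \<inter> {x\<in>space borel. \<not> (\<forall>L\<in>{\<Lambda>..}. \<forall>a\<in>{..<Q}. 
     (\<Sum>j<L. indicator (cell Q a) (w j x)) \<le> (1 / Q + \<delta>) * L)}"
    by (auto simp: typical_def occ_sum)
  also have "\<dots> \<in> sets lborel" by (intro sets.Int) (auto, measurable)
  finally show ?thesis .
qed

lemma typical_mono: "typical Q \<delta> \<Lambda> z \<Longrightarrow> \<Lambda> \<le> \<Lambda>' \<Longrightarrow> typical Q \<delta> \<Lambda>' z"
  by (auto simp: typical_def)

lemma (in transfer_system_coord) atypical_small:
  assumes "Q > 0" "\<delta> > 0" "\<epsilon> > 0"
  shows "\<exists>\<Lambda>. emeasure lborel {x\<in>U. \<not> typical Q \<delta> \<Lambda> (\<lambda>j. h ((T ^^ j) x))} < ennreal \<epsilon>"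
proof (rule eventually_small_measure[OF typical_meas _ _ _ \<open>\<epsilon> > 0\<close>])
  show "AE x in lebesgue. x \<in> U \<longrightarrow> (\<exists>n. x \<notin> {x \<in> U. \<not> typical Q \<delta> n (\<lambda>j. h ((T ^^ j) x))})"
    using typical_AE by eventually_elim (use assms in blast)
qed (auto intro: typical_mono)

section \<open>Multiplication by an integer base\<close>

lemma AE_not_countable: "countable S \<Longrightarrow> AE x in lebesgue. (x::real) \<notin> S"
  unfolding AE_completion_iff by (intro AE_not_in countable_imp_null_set_lborel)

definition base_map :: "nat \<Rightarrow> real \<Rightarrow> real" where "base_map b x = frac (real b * x)"

lemma base_map_iter: "0 \<le> x \<Longrightarrow> x < 1 \<Longrightarrow> (base_map b ^^ j) x = frac (real b ^ j * x)"
proof (induction j)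
  case (Suc j)
  have "real b * (real b ^ j * x - of_int \<lfloor>real b ^ j * x\<rfloor>) = 
    real b ^ Suc j * x - of_int (int b * \<lfloor>real b ^ j * x\<rfloor>)"
    by (simp add: algebra_simps)
  hence "frac (real b * frac (real b ^ j * x)) = frac (real b ^ Suc j * x - of_int (int b * \<lfloor>real b ^ j * x\<rfloor>))"
    by (simp only: frac_def[of "real b ^ j * x"])
  also have "\<dots> = frac (real b ^ Suc j * x)" by (simp only: frac_def floor_diff_of_int of_int_diff)
  finally show ?case using Suc by (simp add: base_map_def)
qed (simp add: frac_eq)

text \<open>\<open>k mod b\<close> rather than k: the locale wants every branch to map [0,1] into
  itself, also at indices of weight 0. All branches have slope 1/b, which is therefore the
  contraction factor.\<close>

lemma base_system:
  assumes b: "b \<ge> 2"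
  shows "transfer_system_coord (\<lambda>_. 1) (base_map b) (\<lambda>k t. (t + real (k mod b)) / real b) (\<lambda>_ _. 1 / real b)
     (\<lambda>k t. if k < b then 1 / real b else 0) (\<lambda>k. real k / real b) (\<lambda>k. (real k + 1) / real b) {..<b} (1 / real b)
     (\<lambda>x. x) 1"
proof -
  have b0: "real b > 0" using b by simp
  have sum_p: "(\<Sum>k. (if k < b then 1 / real b else 0) * G k) = (\<Sum>k<b. 1 / real b * G k)" for G :: "nat \<Rightarrow> real"
    by (subst suminf_finite[of "{..<b}"]) auto
  interpret transfer_system "\<lambda>_. 1" "base_map b" "\<lambda>k t. (t + real (k mod b)) / real b" "\<lambda>_ _. 1 / real b"
     "\<lambda>k t. if k < b then 1 / real b else 0" "\<lambda>k. real k / real b" "\<lambda>k. (real k + 1) / real b" "{..<b}" "1 / real b"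
  proof
    show "base_map b \<in> borel_measurable borel" unfolding base_map_def[abs_def] frac_def by measurable
    show "base_map b ((t + real (k mod b)) / real b) = t" if "k \<in> {..<b}" "t \<in> U" for k t
    proof -
      have "base_map b ((t + real (k mod b)) / real b) = frac (t + of_int (int k))" using that b0 by (simp add: base_map_def)
      also have "\<dots> = t" using that by (simp add: frac_def floor_eq_iff)
      finally show ?thesis .
    qed
    show "(\<lambda>t. (t + real (k mod b)) / real b) ` U = {real k / real b<..<(real k + 1) / real b}" if "k \<in> {..<b}" for k
    proof (intro set_eqI iffI)
      fix x assume "x \<in> {real k / real b<..<(real k + 1) / real b}"
      hence "real b * x - real k \<in> U" "x = ((real b * x - real k) + real (k mod b)) / real b"
        using that b0 by (auto simp: field_simps)
      thus "x \<in> (\<lambda>t. (t + real (k mod b)) / real b) ` U" by blast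
    qed (use that b0 in \<open>auto simp: field_simps\<close>)
    show "{real k / real b<..<(real k + 1) / real b} \<subseteq> U" if "k \<in> {..<b}" for k
    proof
      fix x assume x: "x \<in> {real k / real b<..<(real k + 1) / real b}"
      have "real k + 1 \<le> real b" using that by simp
      hence "(real k + 1) / real b \<le> 1" using b0 by (simp add: divide_le_eq)
      moreover have "0 < x" by (rule le_less_trans[of 0 "real k / real b"]) (use x in auto)
      ultimately show "x \<in> U" using x by auto
    qed
    show "{real i / real b<..<(real i + 1) / real b} \<inter> {real j / real b<..<(real j + 1) / real b} = {}" if "i \<noteq> j" for i j
    proof (rule ccontr)
      assume "\<not> ?thesis"
      then obtain x where "x \<in> {real i / real b<..<(real i + 1) / real b}" "x \<in> {real j / real b<..<(real j + 1) / real b}"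
        by blast
      hence "real i < b * x" "b * x < real i + 1" "real j < b * x" "b * x < real j + 1"
        using b0 by (auto simp: field_simps)
      hence "i = j" by linarith
      thus False using that by simp
    qed
    show "AE x in lebesgue. x \<in> U \<longrightarrow> (\<exists>k\<in>{..<b}. x \<in> {real k / real b<..<(real k + 1) / real b})"
      using AE_not_countable[of "range (\<lambda>k. real k / real b)", OF countable_image[OF countableI_type]]
    proof eventually_elim
      case (elim x)
      show ?case
      proof
        assume x: "x \<in> U"
        define k where "k = nat \<lfloor>real b * x\<rfloor>"
        have "real k = \<lfloor>real b * x\<rfloor>" using x by (simp add: k_def)
        hence k: "real k \<le> b * x" "b * x < real k + 1" by linarith+
        have "x \<noteq> real k / real b" using elim by blast
        hence "real k \<noteq> real b * x" using b0 by (metis nonzero_mult_div_cancel_left less_irrefl)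
        hence "real k < b * x" using k by linarith
        moreover have "b * x < b" using x b0 by simp
        hence "real k < real b" using k by linarith
        ultimately show "\<exists>k\<in>{..<b}. x \<in> {real k / real b<..<(real k + 1) / real b}"
          using k b0 by (intro bexI[of _ k]) (auto simp: pos_divide_less_eq[OF b0] pos_less_divide_eq[OF b0] mult.commute)
      qed
    qed
    show "((\<lambda>t. (t + real (k mod b)) / real b) has_real_derivative 1 / real b) (at t)" for k t
      using b0 by (auto intro!: derivative_eq_intros)
    show "(t + real (k mod b)) / real b \<in> {0..1}" if "t \<in> {0..1}" for k t
    proof -
      have "k mod b < b" using b by simp
      hence "real (k mod b) + 1 \<le> real b" by linarith
      thus ?thesis using that b0 by (simp add: divide_le_eq)
    qed
    show "(\<lambda>k. if k < b then 1 / real b else 0) sums 1"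
      using sums_If_finite_set[of "{..<b}" "\<lambda>_. 1 / real b"] b0 by simp
    show "lip (1 / real b * c) (\<lambda>x. \<Sum>k. (if k < b then 1 / real b else 0) * g ((x + real (k mod b)) / real b))"
      if g: "lip c g" for g c
      unfolding lip_def sum_p
    proof (intro conjI ballI)
      show "0 \<le> 1 / real b * c" using g by (simp add: lip_def)
      fix x y :: real assume xy: "x \<in> {0..1}" "y \<in> {0..1}"
      have "\<bar>(\<Sum>k<b. 1 / real b * g ((x + real (k mod b)) / real b)) - (\<Sum>k<b. 1 / real b * g ((y + real (k mod b)) / real b))\<bar>
        \<le> (\<Sum>k<b. \<bar>1 / real b * g ((x + real (k mod b)) / real b) - 1 / real b * g ((y + real (k mod b)) / real b)\<bar>)"
        unfolding sum_subtractf[symmetric] by (rule sum_abs)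
      also have "\<dots> \<le> (\<Sum>k<b. 1 / real b * (c * \<bar>x - y\<bar> / real b))"
      proof (rule sum_mono)
        fix k assume "k \<in> {..<b}"
        hence "real k + 1 \<le> real b" by simp
        hence "(x + real k) / real b \<in> {0..1}" "(y + real k) / real b \<in> {0..1}"
          using xy b0 by (auto simp: divide_le_eq)
        hence "\<bar>g ((x + real k) / real b) - g ((y + real k) / real b)\<bar> \<le> c * \<bar>(x + real k) / real b - (y + real k) / real b\<bar>"
          using g by (auto simp: lip_def)
        also have "(x + real k) / real b - (y + real k) / real b = (x - y) / real b" by (simp add: diff_divide_distrib[symmetric])
        finally have "\<bar>g ((x + real k) / real b) - g ((y + real k) / real b)\<bar> \<le> c * \<bar>x - y\<bar> / real b" by simp
        hence *: "1 / real b * \<bar>g ((x + real k) / real b) - g ((y + real k) / real b)\<bar> \<le> 1 / real b * (c * \<bar>x - y\<bar> / real b)"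
          by (intro mult_left_mono) auto
        thus "\<bar>1 / real b * g ((x + real (k mod b)) / real b) - 1 / real b * g ((y + real (k mod b)) / real b)\<bar> \<le> 1 / real b * (c * \<bar>x - y\<bar> / real b)"
        proof -
          have "k mod b = k" using \<open>k \<in> {..<b}\<close> by simp
          moreover have "\<bar>1 / real b * G - 1 / real b * H\<bar> = 1 / real b * \<bar>G - H\<bar>" for G H :: real
            by (simp only: right_diff_distrib[symmetric] abs_mult) simp
          ultimately show ?thesis using * by (simp only:)
        qed
      qed
      also have "\<dots> = 1 / real b * c * \<bar>x - y\<bar>" using b0 by simp
      finally show "\<bar>(\<Sum>k<b. 1 / real b * g ((x + real (k mod b)) / real b)) - (\<Sum>k<b. 1 / real b * g ((y + real (k mod b)) / real b))\<bar>
        \<le> 1 / real b * c * \<bar>x - y\<bar>" .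
    qed
    show "(LINT x:U|lebesgue. 1) = (1::real)" by (simp add: set_lebesgue_integral_def)
  qed (use b in \<open>auto intro!: continuous_intros\<close>)
  show ?thesis
  proof unfold_locales
    fix \<alpha> \<beta> :: real assume "\<alpha> \<le> \<beta>"
    have "E (indicator {\<alpha>..\<beta>}) = (LINT x|lebesgue. indicator (U \<inter> {\<alpha>..\<beta>}) x)"
      unfolding E_def set_lebesgue_integral_def by (simp add: indicator_inter_arith)
    also have "\<dots> = measure lebesgue (U \<inter> {\<alpha>..\<beta>})" by simp
    also have "\<dots> \<le> measure lebesgue {\<alpha>..\<beta>}" by (intro measure_mono_fmeasurable) auto
    also have "\<dots> = \<beta> - \<alpha>" using \<open>\<alpha> \<le> \<beta>\<close> by simp
    finally show "E (\<lambda>x. indicator {\<alpha>..\<beta>} x) \<le> \<beta> - \<alpha>" .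
  qed (auto simp: lip_def)
qed

lemma base_atypical_small:
  assumes "b \<ge> 2" "Q > 0" "\<delta> > 0" "\<epsilon> > 0"
  shows "\<exists>\<Lambda>. emeasure lborel {x\<in>U. \<not> typical Q \<delta> \<Lambda> (\<lambda>j. frac (real b ^ j * x))} < ennreal \<epsilon>"
proof -
  interpret transfer_system_coord "\<lambda>_. 1" "base_map b" "\<lambda>k t. (t + real (k mod b)) / real b" "\<lambda>_ _. 1 / real b"
     "\<lambda>k t. if k < b then 1 / real b else 0" "\<lambda>k. real k / real b" "\<lambda>k. (real k + 1) / real b" "{..<b}" "1 / real b" "\<lambda>x. x" 1
    by (rule base_system) fact
  have "{x\<in>U. \<not> typical Q \<delta> \<Lambda> (\<lambda>j. (base_map b ^^ j) x)} = {x\<in>U. \<not> typical Q \<delta> \<Lambda> (\<lambda>j. frac (real b ^ j * x))}" for \<Lambda>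
    by (auto simp: base_map_iter)
  thus ?thesis using atypical_small[OF assms(2-4)] by simp
qed

section \<open>The Gauss map\<close>

definition gauss_dens :: "real \<Rightarrow> real" where "gauss_dens x = 1 / ((1 + x) * ln 2)"

text \<open>For the Gauss measure, the conditional probability that the digit k + 1 precedes the
  tail t.\<close>

definition gauss_p :: "nat \<Rightarrow> real \<Rightarrow> real" where
  "gauss_p k t = (1 + t) / ((real k + 1 + t) * (real k + 2 + t))"

text \<open>For t >= 0, the total weight of the branches from k on, in closed form.\<close>

definition gauss_tail :: "nat \<Rightarrow> real \<Rightarrow> real" where
  "gauss_tail k t = (1 + t) / (real k + 1 + t)"

lemma gauss_p_tail: "t \<ge> 0 \<Longrightarrow> gauss_p k t = gauss_tail k t - gauss_tail (Suc k) t"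
proof -
  assume "t \<ge> 0"
  hence "real k + 1 + t > 0" "real k + 2 + t > 0" by auto
  thus ?thesis by (simp add: gauss_p_def gauss_tail_def field_simps)
qed

lemma gauss_tail_lim: "(\<lambda>k. gauss_tail k t) \<longlonglongrightarrow> 0"
  unfolding gauss_tail_def by real_asymp

lemma gauss_p_sums: "t \<ge> 0 \<Longrightarrow> (\<lambda>k. gauss_p k t) sums 1"
  using telescope_sums'[OF gauss_tail_lim[of t]] by (simp add: gauss_p_tail gauss_tail_def)

lemma gauss_p_nonneg: "t \<ge> 0 \<Longrightarrow> gauss_p k t \<ge> 0"
  by (simp add: gauss_p_def)

lemma abel_sum:
  fixes d G :: "nat \<Rightarrow> real"
  shows "(\<Sum>k<Suc n. (d k - d (Suc k)) * G k) = d 0 * G 0 + (\<Sum>k<n. d (Suc k) * (G (Suc k) - G k)) - d (Suc n) * G n"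
  by (induction n) (auto simp: algebra_simps)

lemma recip_diff: "a > 0 \<Longrightarrow> b > 0 \<Longrightarrow> \<bar>1 / a - 1 / b\<bar> = \<bar>a - b\<bar> / (a * b)" for a b :: real
  by (simp add: abs_divide abs_mult diff_frac_eq abs_minus_commute)

text \<open>
  Replacing \<open>x\<close> by \<open>y\<close> in the arguments of \<open>g\<close> costs a factor 5/8. Replacing it in the weights is
  treated by Abel summation, as the tails of the weights are explicit, and costs 1/4.
\<close>

lemma gauss_contraction:
  assumes g: "lip c g"
  shows "lip (7 / 8 * c) (\<lambda>x. \<Sum>k. gauss_p k x * g (1 / (real k + 1 + x)))"
  unfolding lip_def
proof (intro conjI ballI)
  have c0: "c \<ge> 0" using g by (simp add: lip_def)
  thus "0 \<le> 7 / 8 * c" by simp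
  define \<phi> where "\<phi> k x = 1 / (real k + 1 + x)" for k x
  have \<phi>01: "\<phi> k x \<in> {0..1}" if "x \<in> {0..1}" for k x using that by (auto simp: \<phi>_def divide_le_eq)
  have glip: "\<bar>g u - g v\<bar> \<le> c * \<bar>u - v\<bar>" if "u \<in> {0..1}" "v \<in> {0..1}" for u v
    using g that by (auto simp: lip_def)
  have summ: "summable (\<lambda>k. gauss_p k x * g (\<phi> k x))" if x: "x \<in> {0..1}" for x
  proof (rule summable_comparison_test[of _ "\<lambda>k. (\<bar>g 0\<bar> + c) * gauss_p k x"])
    show "\<exists>N. \<forall>k\<ge>N. norm (gauss_p k x * g (\<phi> k x)) \<le> (\<bar>g 0\<bar> + c) * gauss_p k x"
      using lip_bounded[OF g \<phi>01[OF x]] gauss_p_nonneg[of x] x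
      by (intro exI[of _ 0] allI impI) (simp add: abs_mult mult.commute mult_left_mono)
    show "summable (\<lambda>k. (\<bar>g 0\<bar> + c) * gauss_p k x)"
      using gauss_p_sums[of x] x by (intro summable_mult) (auto simp: sums_iff)
  qed
  fix x y :: real assume x: "x \<in> {0..1}" and y: "y \<in> {0..1}"
  define S where "S n x = (\<Sum>k<n. gauss_p k x * g (\<phi> k x))" for n x
  define d where "d k = gauss_tail k x - gauss_tail k y" for k
  have d0: "d 0 = 0" using x y by (simp add: d_def gauss_tail_def)
  have d_lim: "d \<longlonglongrightarrow> 0" unfolding d_def using tendsto_diff[OF gauss_tail_lim[of x] gauss_tail_lim[of y]] by simp
  have d_eq: "\<bar>d (Suc k)\<bar> = \<bar>x - y\<bar> * (real k + 1) / ((real k + 2 + x) * (real k + 2 + y))" for k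
  proof -
    have p: "real k + 2 + x > 0" "real k + 2 + y > 0" using x y by auto
    have "d (Suc k) = (x - y) * (real k + 1) / ((real k + 2 + x) * (real k + 2 + y))"
      using p unfolding d_def gauss_tail_def by (simp add: diff_frac_eq) (simp add: algebra_simps)
    thus ?thesis using p by (simp add: abs_mult abs_divide)
  qed
  have main: "\<bar>S (Suc n) x - S (Suc n) y\<bar> \<le> 7 / 8 * c * \<bar>x - y\<bar> + \<bar>d (Suc n)\<bar> * (\<bar>g 0\<bar> + c)" for n
  proof -
    \<comment> \<open>5/8 = 1/4 + 3/4 times 1/2: branch 0 has slope at most 1 but weight at most
      1/2, all other branches have slope at most 1/4.\<close>
    have 1: "\<bar>\<Sum>k<Suc n. gauss_p k x * (g (\<phi> k x) - g (\<phi> k y))\<bar> \<le> 5 / 8 * c * \<bar>x - y\<bar>"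
    proof -
      have "\<bar>\<Sum>k<Suc n. gauss_p k x * (g (\<phi> k x) - g (\<phi> k y))\<bar> \<le>
          (\<Sum>k<Suc n. (1 / 4 * gauss_p k x + (if k = 0 then 3 / 4 * gauss_p 0 x else 0)) * (c * \<bar>x - y\<bar>))"
      proof (rule order_trans[OF sum_abs sum_mono])
        fix k
        have p: "real k + 1 + x > 0" "real k + 1 + y > 0" using x y by auto
        have "\<bar>g (\<phi> k x) - g (\<phi> k y)\<bar> \<le> c * \<bar>\<phi> k x - \<phi> k y\<bar>" by (intro glip \<phi>01 x y)
        also have "\<bar>\<phi> k x - \<phi> k y\<bar> = \<bar>x - y\<bar> / ((real k + 1 + x) * (real k + 1 + y))"
          unfolding \<phi>_def using p by (subst recip_diff) auto
        also have "\<dots> \<le> \<bar>x - y\<bar> * (if k = 0 then 1 else 1 / 4)"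
        proof -
          have "(if k = 0 then 1 else 4) \<le> (real k + 1) * (real k + 1)"
            by (cases k) (auto simp: algebra_simps)
          also have "\<dots> \<le> (real k + 1 + x) * (real k + 1 + y)" using x y by (intro mult_mono) auto
          finally have "1 / ((real k + 1 + x) * (real k + 1 + y)) \<le> 1 / (if k = 0 then 1 else 4)"
            by (intro divide_left_mono) (use p in \<open>auto split: if_splits\<close>)
          hence "\<bar>x - y\<bar> * (1 / ((real k + 1 + x) * (real k + 1 + y))) \<le> \<bar>x - y\<bar> * (1 / (if k = 0 then 1 else 4))"
            by (intro mult_left_mono) auto
          thus ?thesis by (simp split: if_splits)
        qed
        finally have "\<bar>g (\<phi> k x) - g (\<phi> k y)\<bar> \<le> c * (\<bar>x - y\<bar> * (if k = 0 then 1 else 1 / 4))"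
          using c0 by (simp add: mult_left_mono)
        hence "gauss_p k x * \<bar>g (\<phi> k x) - g (\<phi> k y)\<bar> \<le> gauss_p k x * (c * (\<bar>x - y\<bar> * (if k = 0 then 1 else 1 / 4)))"
          using gauss_p_nonneg x by (intro mult_left_mono) auto
        moreover have "\<bar>gauss_p k x * (g (\<phi> k x) - g (\<phi> k y))\<bar> = gauss_p k x * \<bar>g (\<phi> k x) - g (\<phi> k y)\<bar>"
          using gauss_p_nonneg[of x k] x by (simp add: abs_mult)
        ultimately have "\<bar>gauss_p k x * (g (\<phi> k x) - g (\<phi> k y))\<bar> \<le> gauss_p k x * (c * (\<bar>x - y\<bar> * (if k = 0 then 1 else 1 / 4)))"
          by simp
        also have "\<dots> = (1 / 4 * gauss_p k x + (if k = 0 then 3 / 4 * gauss_p 0 x else 0)) * (c * \<bar>x - y\<bar>)"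
          by (cases "k = 0") (simp_all add: algebra_simps)
        finally show "\<bar>gauss_p k x * (g (\<phi> k x) - g (\<phi> k y))\<bar> \<le> (1 / 4 * gauss_p k x + (if k = 0 then 3 / 4 * gauss_p 0 x else 0)) * (c * \<bar>x - y\<bar>)" .
      qed
      also have "\<dots> = (1 / 4 * (\<Sum>k<Suc n. gauss_p k x) + 3 / 4 * gauss_p 0 x) * (c * \<bar>x - y\<bar>)"
        unfolding sum_distrib_right[symmetric] sum.distrib sum_distrib_left[symmetric]
        by (simp add: sum.delta del: sum.lessThan_Suc)
      also have "\<dots> \<le> (1 / 4 * 1 + 3 / 4 * (1 / 2)) * (c * \<bar>x - y\<bar>)"
      proof (intro mult_right_mono add_mono mult_left_mono)
        show "(\<Sum>k<Suc n. gauss_p k x) \<le> 1"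
          using sum_le_suminf[of "\<lambda>k. gauss_p k x" "{..<Suc n}"] gauss_p_sums[of x] gauss_p_nonneg[of x] x
          by (auto simp: sums_iff)
        have "gauss_p 0 x = 1 / (2 + x)" using x by (simp add: gauss_p_def)
        thus "gauss_p 0 x \<le> 1 / 2" using x by (simp add: divide_le_eq)
      qed (use c0 in auto)
      finally show ?thesis by simp
    qed
    \<comment> \<open>Differences of weights become differences \<open>d\<close> of tails, each
      paired with the small change of \<open>g\<close> from one branch to the next. There is no term
      at 0 because both tails start at 1; the boundary term with \<open>d (Suc n)\<close> vanishes
      in the limit.\<close>
    have 2: "\<bar>\<Sum>k<Suc n. (gauss_p k x - gauss_p k y) * g (\<phi> k y)\<bar> \<le> 1 / 4 * c * \<bar>x - y\<bar> + \<bar>d (Suc n)\<bar> * (\<bar>g 0\<bar> + c)"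
    proof -
      have "(\<Sum>k<Suc n. (gauss_p k x - gauss_p k y) * g (\<phi> k y)) = (\<Sum>k<Suc n. (d k - d (Suc k)) * g (\<phi> k y))"
        by (intro sum.cong refl) (use x y in \<open>simp add: gauss_p_tail d_def\<close>)
      also have "\<dots> = (\<Sum>k<n. d (Suc k) * (g (\<phi> (Suc k) y) - g (\<phi> k y))) - d (Suc n) * g (\<phi> n y)"
        using abel_sum[of d "\<lambda>k. g (\<phi> k y)" n] d0 by simp
      finally have eq: "(\<Sum>k<Suc n. (gauss_p k x - gauss_p k y) * g (\<phi> k y)) = \<dots>" .
      have "\<bar>\<Sum>k<n. d (Suc k) * (g (\<phi> (Suc k) y) - g (\<phi> k y))\<bar> \<le> 
         (\<Sum>k<n. c * \<bar>x - y\<bar> * (1 / 2 * (1 / ((real k + 1) * (real k + 2)) - 1 / ((real (Suc k) + 1) * (real (Suc k) + 2)))))"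
      proof (rule order_trans[OF sum_abs sum_mono])
        fix k
        define K where "K = real k + 1"
        have K: "K \<ge> 1" by (simp add: K_def)
        have xy: "0 \<le> x" "0 \<le> y" using x y by auto
        have "\<bar>g (\<phi> (Suc k) y) - g (\<phi> k y)\<bar> \<le> c * \<bar>\<phi> (Suc k) y - \<phi> k y\<bar>" by (intro glip \<phi>01 y)
        also have "\<bar>\<phi> (Suc k) y - \<phi> k y\<bar> = 1 / ((K + 1 + y) * (K + y))"
          unfolding \<phi>_def using xy by (subst recip_diff) (auto simp: K_def)
        also have "c * (1 / ((K + 1 + y) * (K + y))) \<le> c * (1 / ((K + 1) * K))"
          using c0 K xy by (intro mult_left_mono divide_left_mono mult_mono) (auto intro!: mult_pos_pos)
        finally have a: "\<bar>g (\<phi> (Suc k) y) - g (\<phi> k y)\<bar> \<le> c * (1 / ((K + 1) * K))" .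
        have "\<bar>d (Suc k)\<bar> = \<bar>x - y\<bar> * (K / ((K + 1 + x) * (K + 1 + y)))" unfolding d_eq by (simp add: K_def add_ac)
        also have "\<dots> \<le> \<bar>x - y\<bar> * (K / ((K + 1) * (K + 1)))"
          using K xy by (intro mult_left_mono divide_left_mono mult_mono) (auto intro!: mult_pos_pos)
        finally have b: "\<bar>d (Suc k)\<bar> \<le> \<bar>x - y\<bar> * (K / ((K + 1) * (K + 1)))" .
        have "\<bar>d (Suc k) * (g (\<phi> (Suc k) y) - g (\<phi> k y))\<bar> \<le> (\<bar>x - y\<bar> * (K / ((K + 1) * (K + 1)))) * (c * (1 / ((K + 1) * K)))"
          unfolding abs_mult using a b K by (intro mult_mono) auto
        also have "\<dots> = c * \<bar>x - y\<bar> * (1 / ((K + 1) * (K + 1) * (K + 1)))"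
        proof -
          have "\<bar>x - y\<bar> * (K / (M * M)) * (c * (1 / (M * K))) = c * \<bar>x - y\<bar> * (1 / (M * M * M))" if "M > 0" for M
            using K that by (simp add: field_simps)
          from this[of "K + 1"] K show ?thesis by simp
        qed
        \<comment> \<open>Weakened to a product that telescopes; its sum over all K >= 1 is
          1/4.\<close>
        also have "\<dots> \<le> c * \<bar>x - y\<bar> * (1 / (K * (K + 1) * (K + 2)))"
        proof (intro mult_left_mono divide_left_mono)
          have "K * (K + 2) \<le> (K + 1) * (K + 1)" by (simp add: algebra_simps)
          hence "K * (K + 2) * (K + 1) \<le> (K + 1) * (K + 1) * (K + 1)" using K by (intro mult_right_mono) auto
          thus "K * (K + 1) * (K + 2) \<le> (K + 1) * (K + 1) * (K + 1)" by (simp add: mult_ac)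
        qed (use K c0 in auto)
        also have "1 / (K * (K + 1) * (K + 2)) = 1 / 2 * (1 / (K * (K + 1)) - 1 / ((K + 1) * (K + 2)))"
        proof -
          have "1 / (K * M) - 1 / (M * N) = (N - K) / (K * M * N)" if "M > 0" "N > 0" for M N :: real
            using K that by (simp add: field_simps)
          from this[of "K + 1" "K + 2"] K show ?thesis by simp
        qed
        finally show "\<bar>d (Suc k) * (g (\<phi> (Suc k) y) - g (\<phi> k y))\<bar> \<le> c * \<bar>x - y\<bar> * (1 / 2 * (1 / ((real k + 1) * (real k + 2)) - 1 / ((real (Suc k) + 1) * (real (Suc k) + 2))))"
          by (simp add: K_def add_ac)
      qed
      also have "\<dots> = c * \<bar>x - y\<bar> * (1 / 2 * (\<Sum>k<n. 1 / ((real k + 1) * (real k + 2)) - 1 / ((real (Suc k) + 1) * (real (Suc k) + 2))))"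
        by (simp only: sum_distrib_left)
      also have "(\<Sum>k<n. 1 / ((real k + 1) * (real k + 2)) - 1 / ((real (Suc k) + 1) * (real (Suc k) + 2))) = 
          1 / ((real 0 + 1) * (real 0 + 2)) - 1 / ((real n + 1) * (real n + 2))"
        by (rule sum_lessThan_telescope')
      also have "c * \<bar>x - y\<bar> * (1 / 2 * \<dots>) \<le> c * \<bar>x - y\<bar> * (1 / 2 * (1 / 2))"
        using c0 by (intro mult_left_mono) auto
      finally have A: "\<bar>\<Sum>k<n. d (Suc k) * (g (\<phi> (Suc k) y) - g (\<phi> k y))\<bar> \<le> 1 / 4 * c * \<bar>x - y\<bar>" by simp
      have "\<bar>d (Suc n) * g (\<phi> n y)\<bar> \<le> \<bar>d (Suc n)\<bar> * (\<bar>g 0\<bar> + c)"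
        unfolding abs_mult by (intro mult_left_mono lip_bounded[OF g] \<phi>01 y) auto
      thus ?thesis unfolding eq using A by linarith
    qed
    have "S (Suc n) x - S (Suc n) y = (\<Sum>k<Suc n. gauss_p k x * (g (\<phi> k x) - g (\<phi> k y))) + (\<Sum>k<Suc n. (gauss_p k x - gauss_p k y) * g (\<phi> k y))"
      unfolding S_def sum.distrib[symmetric] sum_subtractf[symmetric] by (intro sum.cong refl) (simp add: algebra_simps)
    thus ?thesis using 1 2 by linarith
  qed
  have lim: "(\<lambda>n. S (Suc n) x) \<longlonglongrightarrow> (\<Sum>k. gauss_p k x * g (\<phi> k x))" if "x \<in> {0..1}" for x
    unfolding S_def by (rule LIMSEQ_Suc[OF summable_LIMSEQ[OF summ[OF that]]])
  have "(\<lambda>n. \<bar>S (Suc n) x - S (Suc n) y\<bar>) \<longlonglongrightarrow> \<bar>(\<Sum>k. gauss_p k x * g (\<phi> k x)) - (\<Sum>k. gauss_p k y * g (\<phi> k y))\<bar>"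
    by (intro tendsto_intros lim x y)
  moreover have "(\<lambda>n. 7 / 8 * c * \<bar>x - y\<bar> + \<bar>d (Suc n)\<bar> * (\<bar>g 0\<bar> + c)) \<longlonglongrightarrow> 7 / 8 * c * \<bar>x - y\<bar> + \<bar>0\<bar> * (\<bar>g 0\<bar> + c)"
    by (intro tendsto_intros LIMSEQ_Suc[OF d_lim])
  ultimately have "\<bar>(\<Sum>k. gauss_p k x * g (\<phi> k x)) - (\<Sum>k. gauss_p k y * g (\<phi> k y))\<bar> \<le> 7 / 8 * c * \<bar>x - y\<bar> + \<bar>0\<bar> * (\<bar>g 0\<bar> + c)"
    by (rule LIMSEQ_le) (use main in blast)
  thus "\<bar>(\<Sum>k. gauss_p k x * g (1 / (real k + 1 + x))) - (\<Sum>k. gauss_p k y * g (1 / (real k + 1 + y)))\<bar> \<le> 7 / 8 * c * \<bar>x - y\<bar>"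
    by (simp add: \<phi>_def)
qed

text \<open>The distribution function of the Gauss measure on [0,1], see
  \<open>gauss_dens_integral\<close>.\<close>

definition gauss_coord :: "real \<Rightarrow> real" where "gauss_coord x = log 2 (1 + x)"

lemma gauss_map_meas [measurable]: "gauss_map \<in> borel_measurable borel"
  unfolding gauss_map_def[abs_def] by measurable

lemma gauss_coord_meas [measurable]: "gauss_coord \<in> borel_measurable borel"
  unfolding gauss_coord_def[abs_def] by measurable

lemma gauss_dens_integral:
  assumes "- 1 < a" "a \<le> b"
  shows "has_bochner_integral lborel (\<lambda>x. gauss_dens x * indicator {a..b} x) (gauss_coord b - gauss_coord a)"
proof (rule has_bochner_integral_FTC_Icc_nonneg)
  show "gauss_dens \<in> borel_measurable borel" unfolding gauss_dens_def[abs_def] by measurable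
  fix x assume x: "x \<in> {a..b}"
  hence "a \<le> x" by simp
  show "0 \<le> gauss_dens x" using x assms by (simp add: gauss_dens_def)
  show "(gauss_coord has_real_derivative gauss_dens x) (at x)"
  proof -
    have "((\<lambda>x. ln (1 + x) / ln 2) has_real_derivative 1 / (1 + x) / ln 2) (at x)"
      using assms \<open>a \<le> x\<close> by (intro DERIV_cdivide) (auto intro!: derivative_eq_intros)
    thus ?thesis by (simp add: gauss_coord_def[abs_def] gauss_dens_def log_def)
  qed
qed fact

lemma gauss_coord_lip:
  assumes "x \<ge> 0" "y \<ge> 0" shows "\<bar>gauss_coord x - gauss_coord y\<bar> \<le> 2 * \<bar>x - y\<bar>"
proof -
  have *: "\<bar>gauss_coord x - gauss_coord y\<bar> \<le> 2 * \<bar>x - y\<bar>" if "0 \<le> y" "y \<le> x" for x y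
  proof -
    have "ln ((1 + x) / (1 + y)) \<le> (1 + x) / (1 + y) - 1" using that by (intro ln_le_minus_one) auto
    also have "\<dots> = (x - y) / (1 + y)" using that by (simp add: field_simps)
    also have "\<dots> \<le> (x - y) / 1" using that by (intro divide_left_mono) auto
    finally have "ln (1 + x) - ln (1 + y) \<le> x - y" using that by (simp add: ln_div)
    moreover have "ln (1 + x) - ln (1 + y) \<ge> 0" using that by simp
    moreover have "ln 2 \<ge> (1/2 :: real)" using ln_le_minus_one[of "1/2 :: real"] by (simp add: ln_div)
    hence "1 / ln 2 \<le> (2::real)" by (simp add: divide_le_eq)
    ultimately have "(ln (1 + x) - ln (1 + y)) * (1 / ln 2) \<le> (x - y) * 2" by (intro mult_mono) auto
    moreover have "gauss_coord x - gauss_coord y = (ln (1 + x) - ln (1 + y)) * (1 / ln 2)"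
      by (simp add: gauss_coord_def log_def diff_divide_distrib)
    moreover have "gauss_coord x - gauss_coord y \<ge> 0" using that by (simp add: gauss_coord_def)
    ultimately show ?thesis using that by simp
  qed
  show ?thesis using *[of y x] *[of x y] assms by (cases "y \<le> x") (auto simp: abs_minus_commute)
qed

lemma gauss_system:
  "transfer_system_coord gauss_dens gauss_map (\<lambda>k t. 1 / (real k + 1 + t)) (\<lambda>k t. - 1 / (real k + 1 + t)\<^sup>2)
     gauss_p (\<lambda>k. 1 / (real k + 2)) (\<lambda>k. 1 / (real k + 1)) UNIV (7 / 8) gauss_coord 2"
proof -
  interpret transfer_system gauss_dens gauss_map "\<lambda>k t. 1 / (real k + 1 + t)" "\<lambda>k t. - 1 / (real k + 1 + t)\<^sup>2"
     gauss_p "\<lambda>k. 1 / (real k + 2)" "\<lambda>k. 1 / (real k + 1)" UNIV "7 / 8"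
  proof
    show "continuous_on {0..1} gauss_dens" unfolding gauss_dens_def[abs_def] by (intro continuous_intros) auto
    show "(LINT x:U|lebesgue. gauss_dens x) = 1"
    proof -
      have "(LINT x:U|lebesgue. gauss_dens x) = (LINT x|lebesgue. gauss_dens x * indicator {0..1} x)"
        unfolding set_lebesgue_integral_def
      proof (rule integral_cong_AE)
        show "AE x in lebesgue. indicat_real U x *\<^sub>R gauss_dens x = gauss_dens x * indicat_real {0..1} x"
        proof -
          have "AE x in lebesgue. (x::real) \<notin> {0, 1}" by (rule AE_not_countable) auto
          thus ?thesis by eventually_elim (auto simp: indicator_def)
        qed
      qed (auto simp: gauss_dens_def[abs_def] intro!: measurable_completion)
      also have "\<dots> = (LINT x|lborel. gauss_dens x * indicator {0..1} x)"
        by (intro integral_completion) (auto simp: gauss_dens_def[abs_def])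
      also have "\<dots> = gauss_coord 1 - gauss_coord 0"
        using has_bochner_integral_integral_eq[OF gauss_dens_integral[of 0 1]] by simp
      finally show ?thesis by (simp add: gauss_coord_def)
    qed
    show "gauss_map (1 / (real k + 1 + t)) = t" if "t \<in> U" for k t
    proof -
      have "\<lfloor>real k + 1 + t\<rfloor> = int k + 1" using that by (simp add: floor_eq_iff)
      thus ?thesis using that by (simp add: gauss_map_def)
    qed
    show "(\<lambda>t. 1 / (real k + 1 + t)) ` U = {1 / (real k + 2)<..<1 / (real k + 1)}" for k
    proof (intro set_eqI iffI)
      fix x assume x: "x \<in> {1 / (real k + 2)<..<1 / (real k + 1)}"
      hence "0 < x" by (smt (verit) divide_nonneg_nonneg greaterThanLessThan_iff of_nat_0_le_iff)
      hence "1 / x - (real k + 1) \<in> U" "x = 1 / (real k + 1 + (1 / x - (real k + 1)))" using x by (auto simp: field_simps)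
      thus "x \<in> (\<lambda>t. 1 / (real k + 1 + t)) ` U" by blast
    qed (auto intro!: divide_strict_left_mono mult_pos_pos)
    show "{1 / (real k + 2)<..<1 / (real k + 1)} \<subseteq> U" for k
    proof
      fix x assume x: "x \<in> {1 / (real k + 2)<..<1 / (real k + 1)}"
      have "0 < x" by (rule le_less_trans[of 0 "1 / (real k + 2)"]) (use x in auto)
      moreover have "x < 1" by (rule less_le_trans[of x "1 / (real k + 1)"]) (use x in auto)
      ultimately show "x \<in> U" by auto
    qed
    show "{1 / (real i + 2)<..<1 / (real i + 1)} \<inter> {1 / (real j + 2)<..<1 / (real j + 1)} = {}" if "i \<noteq> j" for i j
    proof (rule ccontr)
      assume "\<not> ?thesis"
      then obtain x where "x \<in> {1 / (real i + 2)<..<1 / (real i + 1)}" "x \<in> {1 / (real j + 2)<..<1 / (real j + 1)}"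
        by blast
      hence x: "1 / (real i + 2) < x" "x < 1 / (real i + 1)" "1 / (real j + 2) < x" "x < 1 / (real j + 1)" by auto
      have x0: "x > 0" using x(1) by (smt (verit) divide_nonneg_nonneg of_nat_0_le_iff)
      have "1 / x < real i + 2" "real i + 1 < 1 / x" "1 / x < real j + 2" "real j + 1 < 1 / x"
        using x x0 by (auto simp: field_simps)
      hence "i = j" by linarith
      thus False using that by simp
    qed
    show "AE x in lebesgue. x \<in> U \<longrightarrow> (\<exists>k\<in>UNIV. x \<in> {1 / (real k + 2)<..<1 / (real k + 1)})"
      using AE_not_countable[OF countable_rat]
    proof eventually_elim
      case (elim x)
      show ?case
      proof
        assume x: "x \<in> U"
        hence x1: "1 / x > 1" by simp
        define k where "k = nat (\<lfloor>1 / x\<rfloor> - 1)"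
        have k: "real k = of_int \<lfloor>1 / x\<rfloor> - 1" using x1 by (simp add: k_def)
        hence "real k + 1 \<le> 1 / x" "1 / x < real k + 2" by linarith+
        moreover have "real k + 1 \<noteq> 1 / x"
        proof
          assume "real k + 1 = 1 / x"
          hence "x = 1 / (real k + 1)" using x by (simp add: field_simps)
          also have "\<dots> \<in> \<rat>" by (intro Rats_divide Rats_add) auto
          finally show False using elim by simp
        qed
        ultimately have "real k + 1 < 1 / x" "1 / x < real k + 2" by auto
        thus "\<exists>k\<in>UNIV. x \<in> {1 / (real k + 2)<..<1 / (real k + 1)}" using x by (intro bexI[of _ k]) (auto simp: field_simps)
      qed
    qed
    show "((\<lambda>t. 1 / (real k + 1 + t)) has_real_derivative - 1 / (real k + 1 + t)\<^sup>2) (at t)" if "t \<in> U" for k t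
      using that by (auto intro!: derivative_eq_intros simp: power2_eq_square)
    show "continuous_on {0..1} (\<lambda>t. 1 / (real k + 1 + t))" for k by (intro continuous_intros) auto
    show "continuous_on {0..1} (gauss_p k)" for k unfolding gauss_p_def[abs_def] by (intro continuous_intros) auto
    show "(\<lambda>k. gauss_p k t) sums 1" if "t \<in> {0..1}" for t using that by (intro gauss_p_sums) auto
    show "gauss_dens (1 / (real k + 1 + t)) * \<bar>- 1 / (real k + 1 + t)\<^sup>2\<bar> = gauss_p k t * gauss_dens t" if "t \<in> U" for k t
    proof -
      define s where "s = real k + 1 + t"
      have "s > 0" using that by (simp add: s_def)
      have "gauss_dens (1 / s) * \<bar>- 1 / s\<^sup>2\<bar> = 1 / (s * (s + 1) * ln 2)"
        using \<open>s > 0\<close> by (simp add: gauss_dens_def power2_eq_square field_simps)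
      also have "\<dots> = gauss_p k t * gauss_dens t"
        using that \<open>s > 0\<close> by (simp add: gauss_p_def gauss_dens_def s_def add_ac)
      finally show ?thesis by (simp add: s_def)
    qed
    show "lip (7 / 8 * c) (\<lambda>x. \<Sum>k. gauss_p k x * g (1 / (real k + 1 + x)))" if "lip c g" for g c
      using gauss_contraction[OF that] .
  qed (auto simp: gauss_dens_def gauss_p_nonneg divide_le_eq)
  show ?thesis
  proof unfold_locales
    show "lip 2 gauss_coord" using gauss_coord_lip by (auto simp: lip_def)
    fix \<alpha> \<beta> :: real assume ab: "\<alpha> \<le> \<beta>"
    \<comment> \<open>The points with coordinates \<alpha> and \<beta>.\<close>
    define a b where "a = 2 powr \<alpha> - 1" and "b = 2 powr \<beta> - 1"
    have a: "-1 < a" "a \<le> b" using ab by (auto simp: a_def b_def)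
    have iff: "\<alpha> \<le> gauss_coord x \<longleftrightarrow> a \<le> x" "gauss_coord x \<le> \<beta> \<longleftrightarrow> x \<le> b" if "x \<in> U" for x
      using that unfolding gauss_coord_def a_def b_def by (auto simp: le_log_iff log_le_iff)
    have "E (\<lambda>x. indicator {\<alpha>..\<beta>} (gauss_coord x)) \<le> (LINT x|lborel. gauss_dens x * indicator {a..b} x)"
    proof -
      have "E (\<lambda>x. indicator {\<alpha>..\<beta>} (gauss_coord x)) = (LINT x|lborel. indicator U x * (gauss_dens x * indicator {\<alpha>..\<beta>} (gauss_coord x)))"
        unfolding E_def set_lebesgue_integral_def real_scaleR_def
        by (intro integral_completion) (auto simp: gauss_dens_def[abs_def] gauss_coord_def)
      also have "\<dots> \<le> (LINT x|lborel. gauss_dens x * indicator {a..b} x)"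
      proof (rule integral_mono)
        show int: "integrable lborel (\<lambda>x. gauss_dens x * indicat_real {a..b} x)"
          using gauss_dens_integral[OF a] by (simp add: has_bochner_integral_iff)
        have *: "0 \<le> indicator U x * (gauss_dens x * indicator {\<alpha>..\<beta>} (gauss_coord x))" 
          "indicator U x * (gauss_dens x * indicator {\<alpha>..\<beta>} (gauss_coord x)) \<le> gauss_dens x * indicator {a..b} x" for x
        proof -
          show "0 \<le> indicator U x * (gauss_dens x * indicator {\<alpha>..\<beta>} (gauss_coord x))"
            by (auto simp: indicator_def gauss_dens_def)
          show "indicator U x * (gauss_dens x * indicator {\<alpha>..\<beta>} (gauss_coord x)) \<le> gauss_dens x * indicator {a..b} x"
            using iff[of x] a by (auto simp: indicator_def gauss_dens_def)
        qed
        show "integrable lborel (\<lambda>x. indicator U x * (gauss_dens x * indicator {\<alpha>..\<beta>} (gauss_coord x)))"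
        proof (rule Bochner_Integration.integrable_bound[OF int])
          show "AE x in lborel. norm (indicator U x * (gauss_dens x * indicator {\<alpha>..\<beta>} (gauss_coord x))) \<le> norm (gauss_dens x * indicat_real {a..b} x)"
          proof (intro AE_I2)
            fix x show "norm (indicator U x * (gauss_dens x * indicator {\<alpha>..\<beta>} (gauss_coord x))) \<le> norm (gauss_dens x * indicat_real {a..b} x)"
              using *[of x] unfolding real_norm_def by linarith
          qed
        qed (auto simp: gauss_dens_def[abs_def] gauss_coord_def)
        show "indicator U x * (gauss_dens x * indicator {\<alpha>..\<beta>} (gauss_coord x)) \<le> gauss_dens x * indicator {a..b} x" for x
          by (rule *)
      qed
      finally show ?thesis .
    qed
    also have "\<dots> = gauss_coord b - gauss_coord a"
      using has_bochner_integral_integral_eq[OF gauss_dens_integral[OF a]] by simp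
    also have "\<dots> = \<beta> - \<alpha>" by (simp add: gauss_coord_def a_def b_def)
    finally show "E (\<lambda>x. indicator {\<alpha>..\<beta>} (gauss_coord x)) \<le> \<beta> - \<alpha>" .
  qed (auto simp: gauss_dens_def)
qed

lemma gauss_atypical_small:
  assumes "Q > 0" "\<delta> > 0" "\<epsilon> > 0"
  shows "\<exists>\<Lambda>. emeasure lborel {x\<in>U. \<not> typical Q \<delta> \<Lambda> (\<lambda>j. gauss_coord ((gauss_map ^^ j) x))} < ennreal \<epsilon>"
proof -
  interpret transfer_system_coord gauss_dens gauss_map "\<lambda>k t. 1 / (real k + 1 + t)" "\<lambda>k t. - 1 / (real k + 1 + t)\<^sup>2"
     gauss_p "\<lambda>k. 1 / (real k + 2)" "\<lambda>k. 1 / (real k + 1)" UNIV "7 / 8" gauss_coord 2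
    by (rule gauss_system)
  show ?thesis by (rule atypical_small[OF assms])
qed

section \<open>Good extensions of a word\<close>

text \<open>
  The interval of a word with denominator \<open>q\<close> has length between \<open>1 / (2 q\<^sup>2)\<close> and \<open>1 / q\<^sup>2\<close>, so it
  determines about \<open>digit_pos b q\<close> digits to base \<open>b\<close>.
\<close>

definition digit_pos :: "nat \<Rightarrow> nat \<Rightarrow> nat" where
  "digit_pos b q = (LEAST m. q\<^sup>2 \<le> b ^ m)"

lemma mb_ge: assumes "b \<ge> 2" shows "q\<^sup>2 \<le> b ^ digit_pos b q"
proof -
  have "q\<^sup>2 \<le> 2 ^ q\<^sup>2" by (simp add: less_imp_le)
  also have "\<dots> \<le> b ^ q\<^sup>2" using assms by (simp add: power_mono)
  finally show ?thesis unfolding digit_pos_def by (rule LeastI)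
qed

lemma mb_less: "j < digit_pos b q \<Longrightarrow> b ^ j < q\<^sup>2"
  unfolding digit_pos_def using not_less_Least not_le by blast

lemma mb_le: "q\<^sup>2 \<le> b ^ j \<Longrightarrow> digit_pos b q \<le> j"
  unfolding digit_pos_def by (rule Least_le)

lemma mb_mono: "b \<ge> 2 \<Longrightarrow> q \<le> q' \<Longrightarrow> digit_pos b q \<le> digit_pos b q'"
  by (intro mb_le order_trans[OF power_mono mb_ge]) auto

lemma mb_upper: assumes "q > 0" "b > 0" shows "b ^ digit_pos b q \<le> b * q\<^sup>2"
proof (cases "digit_pos b q")
  case 0
  then show ?thesis using assms by (simp add: Suc_le_eq)
next
  case (Suc m)
  hence "b ^ m < q\<^sup>2" by (intro mb_less) simp
  then show ?thesis using Suc by simp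
qed

lemma frac_mult_frac: "frac (real n * frac v) = frac (real n * v)"
proof -
  have "real n * frac v = real n * v - of_int (int n * \<lfloor>v\<rfloor>)" by (simp add: frac_def algebra_simps)
  hence "frac (real n * frac v) = frac (real n * v - of_int (int n * \<lfloor>v\<rfloor>))" by simp
  also have "\<dots> = frac (real n * v)" by (simp only: frac_def floor_diff_of_int of_int_diff)
  finally show ?thesis .
qed

text \<open>Scaling by b^j leaves an error of at most b^(-s) as long as b^(j+s) < q^2. The integer k
  is needed because close numbers may have fractional parts near 0 and near 1.\<close>

lemma base_close:
  fixes x y :: real
  assumes xy: "\<bar>x - y\<bar> \<le> 1 / (real q)\<^sup>2" and b: "b \<ge> 2" and j: "j + s < digit_pos b q"
  shows "\<exists>k::int. \<bar>frac (real b ^ j * x) - frac (real b ^ j * y) - of_int k\<bar> \<le> 1 / 2 ^ s"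
proof (intro exI)
  have "b ^ (j + s) < q\<^sup>2" using j by (rule mb_less)
  hence "real b ^ (j + s) \<le> (real q)\<^sup>2" by (metis less_imp_le of_nat_le_iff of_nat_power)
  moreover have "real b ^ j > 0" "real b ^ s > 0" using b by auto
  ultimately have q: "real b ^ j * real b ^ s \<le> (real q)\<^sup>2" by (simp add: power_add)
  have "0 < real b ^ j * real b ^ s" using b by simp
  with q have q2: "(real q)\<^sup>2 > 0" by linarith
  have "frac (real b ^ j * x) - frac (real b ^ j * y) - of_int (\<lfloor>real b ^ j * y\<rfloor> - \<lfloor>real b ^ j * x\<rfloor>)
    = real b ^ j * (x - y)" by (simp add: frac_def algebra_simps)
  also have "\<bar>\<dots>\<bar> = real b ^ j * \<bar>x - y\<bar>" by (simp add: abs_mult)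
  also have "\<dots> \<le> real b ^ j * (1 / (real q)\<^sup>2)" using xy by (intro mult_left_mono) auto
  also have "\<dots> \<le> 1 / real b ^ s" using q q2 \<open>real b ^ s > 0\<close> by (simp add: field_simps)
  also have "\<dots> \<le> 1 / 2 ^ s" using b by (intro divide_left_mono power_mono) auto
  finally show "\<bar>frac (real b ^ j * x) - frac (real b ^ j * y) - of_int (\<lfloor>real b ^ j * y\<rfloor> - \<lfloor>real b ^ j * x\<rfloor>)\<bar> \<le> 1 / 2 ^ s" .
qed

lemma gauss_close:
  assumes "pos_word v" "0 \<le> t" "t \<le> 1" "s \<le> length v"
  shows "\<bar>gauss_coord (cf_tail v t) - gauss_coord (cf_tail v 0)\<bar> \<le> 4 / 2 ^ s"
proof -
  have "\<bar>gauss_coord (cf_tail v t) - gauss_coord (cf_tail v 0)\<bar> \<le> 2 * \<bar>cf_tail v t - cf_tail v 0\<bar>"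
    using assms by (intro gauss_coord_lip cf_tail_nonneg) auto
  also have "\<dots> \<le> 2 * (2 / 2 ^ length v)" using assms by (intro mult_left_mono cf_tail_close(2)) auto
  also have "\<dots> \<le> 2 * (2 / 2 ^ s)" using assms by (intro mult_left_mono divide_left_mono power_increasing) auto
  finally show ?thesis by simp
qed

text \<open>The windows are the positions that \<open>w\<close> adds: its own digits, and for each
  base the digits that the longer word fixes beyond the shorter one. Windows of consecutive blocks
  therefore tile all positions. The tail 0 makes every tested point rational. \<open>K\<close>
  governs both the number of cells and the range of bases.\<close>

definition passes :: "nat \<Rightarrow> nat list \<Rightarrow> nat list \<Rightarrow> bool" where
  "passes K ws w \<longleftrightarrow>
     even_cells K (\<lambda>j. gauss_coord (cf_tail (drop j (ws @ w)) 0)) {length ws..<length (ws @ w)} \<and>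
     (\<forall>b\<in>{2..K}. even_cells K (\<lambda>j. frac (real b ^ j * cf_tail (ws @ w) 0))
        {digit_pos b (den ws)..<digit_pos b (den (ws @ w))})"

lemma occ_shift: "occ (\<lambda>j. v (j - m)) {m..<m + L} A = occ v {..<L} A"
  unfolding occ_def
  by (rule bij_betw_same_card[of "\<lambda>j. j - m"], rule bij_betwI[of _ _ _ "\<lambda>j. j + m"]) auto

lemma cf_tail_irrational: "t \<notin> \<rat> \<Longrightarrow> cf_tail w t \<notin> \<rat>"
proof (induction w)
  case (Cons a w)
  show ?case
  proof
    assume "cf_tail (a # w) t \<in> \<rat>"
    hence "inverse (1 / (real a + cf_tail w t)) - real a \<in> \<rat>" by (intro Rats_diff Rats_inverse) auto
    thus False using Cons by simp
  qed
qed simp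

lemma cf_tail_deriv:
  assumes "pos_word w" "t \<in> U"
  shows "\<exists>D. (cf_tail w has_real_derivative D) (at t) \<and> \<bar>D\<bar> = 1 / (real (den w) + real (den' w) * t)\<^sup>2"
proof (intro exI conjI)
  let ?f = "\<lambda>t::real. (num w + num' w * t) / (den w + den' w * t)"
  let ?D = "((num' w) * (den w + den' w * t) - (num w + num' w * t) * (den' w)) / ((den w + den' w * t) * (den w + den' w * t))"
  have "real (den w) > 0" using den_pos assms by simp
  hence d: "real (den w) + den' w * t > 0" using assms(2) by (intro add_pos_nonneg) auto
  have "(?f has_real_derivative ?D) (at t)" using d by (auto intro!: derivative_eq_intros)
  moreover have "\<forall>\<^sub>F s in nhds t. cf_tail w s = ?f s"
    using eventually_nhds_in_open[of U t] assms(2) by (auto elim!: eventually_mono intro!: cf_tail_cvg assms(1))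
  ultimately show "(cf_tail w has_real_derivative ?D) (at t)" by (subst DERIV_cong_ev[OF refl _ refl])
  have "(num' w) * (den w + den' w * t) - (num w + num' w * t) * (den' w) = 
     - of_int (int (num w) * int (den' w) - int (num' w) * int (den w))" by (simp add: algebra_simps)
  hence "\<bar>(num' w) * (den w + den' w * t) - (num w + num' w * t) * (den' w)\<bar> = 1"
    using cvg_det[of w] by (metis abs_minus_cancel of_int_1 of_int_abs)
  thus "\<bar>?D\<bar> = 1 / (real (den w) + real (den' w) * t)\<^sup>2"
    using d by (simp only: abs_divide) (simp add: power2_eq_square)
qed

text \<open>With q = \<open>den w\<close>, the factor c lies between q^2 and b q^2, and the
  denominator of the Moebius map \<open>cf_tail w\<close> between q and 2q. So the scaled map has
  slope between 1/4 and b in absolute value. The lower bound costs the factor 4; by the upper bound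
  the image has length at most b and meets at most b + 2 integer translates of \<open>A\<close>. The
  constant is the same for all \<open>w\<close>, which is the source of uniformity.\<close>

lemma pushforward_bound:
  assumes w: "pos_word w" and c: "(real (den w))\<^sup>2 \<le> c" "c \<le> real b * (real (den w))\<^sup>2"
    and A: "A \<in> sets lborel" "A \<subseteq> U"
  shows "{t\<in>U. frac (c * cf_tail w t) \<in> A} \<in> sets lborel"
    and "emeasure lborel {t\<in>U. frac (c * cf_tail w t) \<in> A} \<le> ennreal (4 * (real b + 2)) * emeasure lborel A"
proof -
  define q q' where "q = real (den w)" and "q' = real (den' w)"
  have q0: "q > 0" "0 \<le> q'" "q' \<le> q" using den_pos[OF w] den'_le_den[OF w] by (auto simp: q_def q'_def)
  define \<psi> where "\<psi> t = c * cf_tail w t" for t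
  define D where "D t = c / (q + q' * t)\<^sup>2" for t
  have den0: "q + q' * t > 0" if "t \<in> U" for t using q0 that by (intro add_pos_nonneg) auto
  have c0: "c > 0" using c q0 by (smt (verit) q_def zero_less_power)
  have [measurable]: "cf_tail w \<in> borel_measurable borel"
    by (induction w) (auto)
  hence [measurable]: "\<psi> \<in> borel_measurable borel" unfolding \<psi>_def[abs_def] by measurable
  define S where "S = {t\<in>U. frac (\<psi> t) \<in> A}"
  have fm: "(\<lambda>t. frac (\<psi> t)) \<in> borel_measurable borel" unfolding frac_def by measurable
  have Sb: "S \<in> sets borel"
  proof -
    have "S = U \<inter> ((\<lambda>t. frac (\<psi> t)) -` A \<inter> space borel)" by (auto simp: S_def)
    moreover have "((\<lambda>t. frac (\<psi> t)) -` A \<inter> space borel) \<in> sets borel"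
      using fm A(1) by (intro measurable_sets[of _ borel borel]) auto
    ultimately show ?thesis by auto
  qed
  thus "{t\<in>U. frac (c * cf_tail w t) \<in> A} \<in> sets lborel" by (simp add: S_def \<psi>_def)
  have SU: "S \<subseteq> U" by (auto simp: S_def)
  have "\<exists>D'. \<forall>t\<in>U. (\<psi> has_real_derivative D' t) (at t) \<and> \<bar>D' t\<bar> = D t"
  proof (rule bchoice, rule ballI)
    fix t assume t: "t \<in> U"
    obtain D1 where D1: "(cf_tail w has_real_derivative D1) (at t)" "\<bar>D1\<bar> = 1 / (q + q' * t)\<^sup>2"
      using cf_tail_deriv[OF w t] unfolding q_def q'_def by blast
    have "(\<psi> has_real_derivative c * D1) (at t)" unfolding \<psi>_def[abs_def] by (intro DERIV_cmult D1)
    moreover have "\<bar>c * D1\<bar> = D t" using D1 c0 by (simp add: abs_mult D_def)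
    ultimately show "\<exists>D'. (\<psi> has_real_derivative D') (at t) \<and> \<bar>D'\<bar> = D t" by blast
  qed
  then obtain D' where D': "\<And>t. t \<in> U \<Longrightarrow> (\<psi> has_real_derivative D' t) (at t)" "\<And>t. t \<in> U \<Longrightarrow> \<bar>D' t\<bar> = D t" by blast
  have D_bounds: "1 / 4 \<le> D t" "D t \<le> b" if "t \<in> U" for t
  proof -
    have "q + q' * t \<le> q + q * 1" using q0 that by (intro add_left_mono mult_mono) auto
    hence "(q + q' * t)\<^sup>2 \<le> (2 * q)\<^sup>2" using den0[OF that] by (intro power_mono) auto
    hence "(q + q' * t)\<^sup>2 \<le> 4 * c" using c by (simp add: power_mult_distrib q_def)
    thus "1 / 4 \<le> D t" using den0[OF that] by (simp add: D_def field_simps)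
    have "q\<^sup>2 \<le> (q + q' * t)\<^sup>2" using q0 that by (intro power_mono) auto
    hence "real b * q\<^sup>2 \<le> real b * (q + q' * t)\<^sup>2" by (intro mult_left_mono) auto
    thus "D t \<le> b" using c den0[OF that] by (simp add: D_def q_def divide_le_eq)
  qed
  have diff: "\<bar>\<psi> t - \<psi> s\<bar> \<le> b * \<bar>t - s\<bar>" and inj: "\<psi> t = \<psi> s \<Longrightarrow> t = s" if "t \<in> U" "s \<in> U" for t s :: real
  proof -
    have p: "(q + q' * t) * (q + q' * s) > 0" using den0 that by simp
    have eq: "\<bar>\<psi> t - \<psi> s\<bar> = c * (\<bar>t - s\<bar> / ((q + q' * t) * (q + q' * s)))"
      using cf_tail_diff[OF w, of t s] that c0
      by (simp add: \<psi>_def q_def q'_def abs_mult flip: right_diff_distrib)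
    have "q * q \<le> (q + q' * t) * (q + q' * s)" using q0 that by (intro mult_mono) auto
    hence "\<bar>t - s\<bar> / ((q + q' * t) * (q + q' * s)) \<le> \<bar>t - s\<bar> / (q * q)" using q0 by (intro divide_left_mono) (use p in auto)
    hence "\<bar>\<psi> t - \<psi> s\<bar> \<le> c * (\<bar>t - s\<bar> / (q * q))" unfolding eq using c0 by (intro mult_left_mono) auto
    also have "\<dots> \<le> (real b * q\<^sup>2) * (\<bar>t - s\<bar> / (q * q))" using c(2) by (intro mult_right_mono) (auto simp: q_def)
    also have "\<dots> = b * \<bar>t - s\<bar>" using q0 by (simp add: power2_eq_square)
    finally show "\<bar>\<psi> t - \<psi> s\<bar> \<le> b * \<bar>t - s\<bar>" .
    assume "\<psi> t = \<psi> s"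
    thus "t = s" using eq c0 p by (auto simp: zero_less_mult_iff)
  qed
  have lS: "S \<in> lmeasurable"
    by (rule bounded_set_imp_lmeasurable) (use Sb SU in \<open>auto intro: bounded_subset[of U]\<close>)
  have int1: "(\<lambda>t. \<bar>D' t\<bar> * 1) absolutely_integrable_on S"
  proof -
    have "D \<in> borel_measurable borel" unfolding D_def[abs_def] by measurable
    hence m: "(\<lambda>t. indicator S t * D t) \<in> borel_measurable borel" using Sb by measurable
    have "integrable lborel (\<lambda>t. indicator S t * D t)"
    proof (rule Bochner_Integration.integrable_bound[of _ "\<lambda>x. indicator U x * real b"])
      show "AE t in lborel. norm (indicator S t * D t) \<le> norm (indicator U t * real b)"
      proof (intro AE_I2)
        fix t show "norm (indicator S t * D t) \<le> norm (indicator U t * real b)"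
          using D_bounds[of t] SU by (auto simp: indicator_def)
      qed
    qed (use m in auto)
    hence "integrable lebesgue (\<lambda>t. indicator S t * D t)" using m by (simp add: integrable_completion)
    moreover have "(\<lambda>t. indicator S t * D t) = (\<lambda>t. indicator S t *\<^sub>R (\<bar>D' t\<bar> * 1))"
    proof
      fix t show "indicator S t * D t = indicator S t *\<^sub>R (\<bar>D' t\<bar> * 1)"
        using D'(2)[of t] SU by (cases "t \<in> S") auto
    qed
    ultimately show ?thesis by (simp add: set_integrable_def)
  qed
  have der: "(\<psi> has_field_derivative D' t) (at t within S)" if "t \<in> S" for t
    using D'(1)[of t] SU that by (blast intro: has_field_derivative_at_within)
  have injS: "inj_on \<psi> S" using inj SU by (intro inj_onI) blast
  have "S \<in> sets lebesgue" using Sb by simp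
  from has_absolute_integral_change_of_variables_1'[OF this der injS, of "\<lambda>_. 1" "integral S (\<lambda>t. \<bar>D' t\<bar> * 1)"] int1
  have im: "(\<lambda>_. 1::real) absolutely_integrable_on (\<psi> ` S)" "integral (\<psi> ` S) (\<lambda>_. 1) = integral S (\<lambda>t. \<bar>D' t\<bar> * 1)" by auto
  have lim: "\<psi> ` S \<in> lmeasurable" using im(1) by (simp add: lmeasurable_iff_integrable_on set_lebesgue_integral_eq_integral(1))
  have "1 / 4 * measure lebesgue S = integral S (\<lambda>_. 1 / 4)" using lS by (simp add: lmeasure_integral)
  also have "\<dots> \<le> integral S (\<lambda>t. \<bar>D' t\<bar> * 1)"
  proof (rule integral_le)
    show "(\<lambda>_. 1 / 4 :: real) integrable_on S" using lS by (simp add: integrable_on_const)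
    show "(\<lambda>t. \<bar>D' t\<bar> * 1) integrable_on S" using int1 by (rule set_lebesgue_integral_eq_integral(1))
    show "1 / 4 \<le> \<bar>D' t\<bar> * 1" if "t \<in> S" for t using D_bounds[of t] D'(2)[of t] SU that by auto
  qed
  also have "\<dots> = measure lebesgue (\<psi> ` S)" using im lim by (simp add: lmeasure_integral)
  also have "\<dots> \<le> (real b + 2) * measure lebesgue A"
  proof -
    have lA: "A \<in> lmeasurable" by (rule bounded_set_imp_lmeasurable) (use A in \<open>auto intro: bounded_subset[of U]\<close>)
    \<comment> \<open>The image stays within b/2 of its value at the midpoint; \<open>R\<close>
      lists the integer parts it can have.\<close>
    define R where "R = {\<lfloor>\<psi> (1/2) - b / 2\<rfloor>..\<lfloor>\<psi> (1/2) + b / 2\<rfloor>}"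
    have sub: "\<psi> ` S \<subseteq> (\<Union>k\<in>R. (+) (of_int k) ` A)"
    proof
      fix v assume "v \<in> \<psi> ` S"
      then obtain t where t: "t \<in> S" "v = \<psi> t" by blast
      have tU: "t \<in> U" using t SU by auto
      have "\<bar>\<psi> t - \<psi> (1/2)\<bar> \<le> b * \<bar>t - 1/2\<bar>" using tU by (intro diff) auto
      also have "\<dots> \<le> b * (1/2)"
      proof (rule mult_left_mono)
        show "\<bar>t - 1/2\<bar> \<le> 1/2" using tU unfolding greaterThanLessThan_iff by linarith
      qed simp
      finally have "\<bar>\<psi> t - \<psi> (1/2)\<bar> \<le> b * (1/2)" .
      hence "\<psi> (1/2) - b / 2 \<le> \<psi> t" "\<psi> t \<le> \<psi> (1/2) + b / 2" by linarith+
      hence "\<lfloor>\<psi> t\<rfloor> \<in> R" unfolding R_def by (simp add: floor_mono)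
      moreover have "v \<in> (+) (of_int \<lfloor>\<psi> t\<rfloor>) ` A"
        using t by (intro image_eqI[of _ _ "frac (\<psi> t)"]) (auto simp: S_def frac_def)
      ultimately show "v \<in> (\<Union>k\<in>R. (+) (of_int k) ` A)" by blast
    qed
    have lk: "(+) (of_int k) ` A \<in> lmeasurable" for k :: int using lA by (rule measurable_translation)
    have "measure lebesgue (\<psi> ` S) \<le> measure lebesgue (\<Union>k\<in>R. (+) (of_int k) ` A)"
      by (rule measure_mono_fmeasurable[OF sub]) (use lim lk in \<open>auto simp: R_def intro!: fmeasurable.finite_UN\<close>)
    also have "\<dots> \<le> (\<Sum>k\<in>R. measure lebesgue ((+) (of_int k) ` A))"
      by (rule measure_UNION_le) (use lk in \<open>auto simp: R_def\<close>)
    also have "\<dots> = real (card R) * measure lebesgue A" by (simp add: measure_translation)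
    also have "real (card R) \<le> real b + 2"
    proof -
      have "real (card R) \<le> real_of_int (\<lfloor>\<psi> (1/2) + b / 2\<rfloor> - \<lfloor>\<psi> (1/2) - b / 2\<rfloor> + 1)"
      proof -
        have "\<lfloor>\<psi> (1/2) - b / 2\<rfloor> \<le> \<lfloor>\<psi> (1/2) + b / 2\<rfloor>" by (rule floor_mono) simp
        thus ?thesis unfolding R_def by simp
      qed
      also have "\<dots> \<le> real b + 2" by linarith
      finally show ?thesis .
    qed
    finally show ?thesis by (simp add: mult_right_mono)
  qed
  finally have "measure lebesgue S \<le> 4 * (real b + 2) * measure lebesgue A" by (simp add: algebra_simps)
  moreover have em: "emeasure lborel X = ennreal (measure lebesgue X)" if "X \<in> sets borel" "X \<subseteq> U" for X
  proof -
    have "emeasure lborel X \<le> emeasure lborel U" using that by (intro emeasure_mono) auto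
    hence "emeasure lborel X \<noteq> top" by (auto simp: top_unique)
    thus ?thesis using that by (simp add: emeasure_eq_ennreal_measure)
  qed
  ultimately have "emeasure lborel S \<le> ennreal (4 * (real b + 2) * measure lebesgue A)"
    using Sb SU by (simp add: ennreal_leI)
  also have "\<dots> = ennreal (4 * (real b + 2)) * emeasure lborel A"
    using em[of A] A by (simp add: ennreal_mult)
  finally show "emeasure lborel {t\<in>U. frac (c * cf_tail w t) \<in> A} \<le> ennreal (4 * (real b + 2)) * emeasure lborel A"
    by (simp add: S_def \<psi>_def)
qed

section \<open>Existence of good blocks, uniformly in the word before them\<close>

lemma gauss_iter_meas [measurable]: "(gauss_map ^^ i) \<in> borel_measurable borel"
  by (induction i) (auto intro: measurable_comp)

lemma cf_digit_meas [measurable]: "(\<lambda>t. cf_digit t i) \<in> measurable borel (count_space UNIV)"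
  unfolding cf_digit_def by measurable

lemma large_digits_meas: "{t\<in>U. \<not> (\<forall>i<L. cf_digit t i \<le> D)} \<in> sets lborel"
proof -
  have "{t\<in>U. \<not> (\<forall>i<L. cf_digit t i \<le> D)} = U \<inter> {t\<in>space borel. \<not> (\<forall>i\<in>{..<L}. cf_digit t i \<le> D)}" by auto
  also have "\<dots> \<in> sets lborel" by (intro sets.Int) (auto, measurable)
  finally show ?thesis .
qed

text \<open>A point has only \<open>L\<close> digits to bound, so some \<open>D\<close> works for
  it; measure continuity makes \<open>D\<close> common to most points.\<close>

lemma large_digits_small:
  assumes "\<epsilon> > 0"
  shows "\<exists>D. emeasure lborel {t\<in>U. \<not> (\<forall>i<L. cf_digit t i \<le> D)} < ennreal \<epsilon>"
proof (rule eventually_small_measure[OF large_digits_meas _ _ _ assms])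
  show "AE x in lebesgue. x \<in> U \<longrightarrow> (\<exists>n. x \<notin> {t \<in> U. \<not> (\<forall>i<L. cf_digit t i \<le> n)})"
  proof (intro AE_I2 impI)
    fix x
    show "\<exists>n. x \<notin> {t \<in> U. \<not> (\<forall>i<L. cf_digit t i \<le> n)}"
      by (intro exI[of _ "\<Sum>i<L. cf_digit x i"]) (auto intro: member_le_sum)
  qed
qed (auto intro: le_SucI)

lemma gauss_coord_unit: "0 < t \<Longrightarrow> t < 1 \<Longrightarrow> 0 \<le> gauss_coord t \<and> gauss_coord t < 1"
  by (simp add: gauss_coord_def)

text \<open>\<open>t\<close> plays the tail after \<open>ws\<close>. Its Gauss orbit, and for each
  base the orbit of \<open>cf_tail ws t\<close> from position \<open>digit_pos b (den ws)\<close>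
  on, have the right frequencies in fine cells. The tests look at the same positions with the tail
  after \<open>w\<close> cut to 0. This moves points by at most \<open>4 / 2 ^ s\<close>, except
  near the end of the window, and \<open>even_cells_transfer\<close> absorbs the difference.\<close>

lemma good_point_extends:
  assumes K: "0 < K" "K \<le> Kmax" and \<epsilon>: "\<epsilon> = 1 / (real Kmax)\<^sup>2" "Q \<ge> 16 / \<epsilon>" "\<delta> = \<epsilon> / (8 * Q)" "4 / 2 ^ s \<le> \<epsilon> / 16"
    and t: "t \<notin> \<rat>" "t \<in> U" and ws: "pos_word ws"
    and L: "\<Lambda> \<le> L" "real s \<le> \<epsilon> / 4 * L"
    and tg: "typical Q \<delta> \<Lambda> (\<lambda>j. gauss_coord ((gauss_map ^^ j) t))"
    and tb: "\<And>b. b \<in> {2..Kmax} \<Longrightarrow> typical Q \<delta> \<Lambda> (\<lambda>j. frac (real b ^ j * frac (real b ^ digit_pos b (den ws) * cf_tail ws t)))"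
    and w: "w = map (cf_digit t) [0..<L]"
    and len: "\<And>b. b \<in> {2..Kmax} \<Longrightarrow> \<Lambda> \<le> digit_pos b (den (ws @ w)) - digit_pos b (den ws) \<and>
       real s \<le> \<epsilon> / 4 * real (digit_pos b (den (ws @ w)) - digit_pos b (den ws))"
  shows "passes K ws w"
  unfolding passes_def
proof (intro conjI ballI)
  have Kmax: "Kmax > 0" using K by simp
  have e0: "\<epsilon> > 0" using Kmax by (simp add: \<epsilon>)
  have Q0: "Q > 0"
  proof -
    have "16 / \<epsilon> > 0" using e0 by simp
    hence "real Q > 0" using \<epsilon>(2) by linarith
    thus ?thesis by simp
  qed
  have d0: "0 \<le> \<delta>" "\<delta> \<le> \<epsilon> / (8 * Q)" using e0 by (auto simp: \<epsilon>(3))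
  have lw: "length w = L" by (simp add: w)
  have pw: "pos_word w" unfolding w by (rule pos_word_map) (use cf_digit_step(1) t in auto)
  have tU: "(gauss_map ^^ j) t \<notin> \<rat> \<and> 0 < (gauss_map ^^ j) t \<and> (gauss_map ^^ j) t < 1" for j
    using gauss_iter_unit[of t j] t by auto
  have s4: "0 \<le> 4 / (2::real) ^ s" by simp
  have cardE: "card {j \<in> {a..<c}. c < j + s} \<le> s" for a c :: nat
  proof -
    have "{j \<in> {a..<c}. c < j + s} \<subseteq> {c - s..<c}" by auto
    hence "card {j \<in> {a..<c}. c < j + s} \<le> card {c - s..<c}" by (rule card_mono[rotated]) simp
    thus ?thesis by simp
  qed
  show "even_cells K (\<lambda>j. gauss_coord (cf_tail (drop j (ws @ w)) 0)) {length ws..<length (ws @ w)}"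
  proof (rule even_cells_transfer[where Q = Q and \<delta> = \<delta> and \<eta> = "4 / 2 ^ s" and Kmax = Kmax and \<epsilon> = \<epsilon> and
        E = "{j \<in> {length ws..<length (ws @ w)}. length (ws @ w) < j + s}" and
        z = "\<lambda>j. gauss_coord ((gauss_map ^^ (j - length ws)) t)", OF _ _ Q0 K _ _ \<epsilon>(1) s4 \<epsilon>(4,2) d0])
    fix j assume j: "j \<in> {length ws..<length (ws @ w)} - {j \<in> {length ws..<length (ws @ w)}. length (ws @ w) < j + s}"
    define i where "i = j - length ws"
    have i: "i < L" "i + s \<le> L" using j by (auto simp: i_def lw)
    have dr: "drop j (ws @ w) = map (cf_digit t) [i..<i + (L - i)]"
      using j i by (simp add: i_def w drop_map)
    have T: "(gauss_map ^^ i) t = cf_tail (drop j (ws @ w)) ((gauss_map ^^ L) t)"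
      unfolding dr using cf_tail_digits[of t i "L - i"] t i by simp
    have "pos_word (drop j (ws @ w))" unfolding dr by (rule pos_word_map) (use cf_digit_step(1) t in auto)
    hence "\<bar>gauss_coord (cf_tail (drop j (ws @ w)) ((gauss_map ^^ L) t)) - gauss_coord (cf_tail (drop j (ws @ w)) 0)\<bar> \<le> 4 / 2 ^ s"
      using tU[of L] i j by (intro gauss_close) (auto simp: lw)
    hence "\<bar>gauss_coord (cf_tail (drop j (ws @ w)) 0) - gauss_coord ((gauss_map ^^ i) t) - of_int 0\<bar> \<le> 4 / 2 ^ s"
      unfolding T by linarith
    moreover have "0 \<le> gauss_coord ((gauss_map ^^ i) t) \<and> gauss_coord ((gauss_map ^^ i) t) < 1"
      using tU[of i] by (intro gauss_coord_unit) auto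
    ultimately show "0 \<le> gauss_coord ((gauss_map ^^ (j - length ws)) t) \<and> gauss_coord ((gauss_map ^^ (j - length ws)) t) < 1 \<and>
       (\<exists>k::int. \<bar>gauss_coord (cf_tail (drop j (ws @ w)) 0) - gauss_coord ((gauss_map ^^ (j - length ws)) t) - of_int k\<bar> \<le> 4 / 2 ^ s)"
      unfolding i_def by blast
  next
    fix a assume "a < Q"
    have "occ (\<lambda>j. gauss_coord ((gauss_map ^^ (j - length ws)) t)) {length ws..<length (ws @ w)} (cell Q a)
       = occ (\<lambda>j. gauss_coord ((gauss_map ^^ j) t)) {..<L} (cell Q a)"
      using occ_shift[of "\<lambda>j. gauss_coord ((gauss_map ^^ j) t)" "length ws" L] by (simp add: lw)
    also have "real \<dots> \<le> (1 / Q + \<delta>) * L" using tg L(1) \<open>a < Q\<close> by (auto simp: typical_def)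
    finally show "real (occ (\<lambda>j. gauss_coord ((gauss_map ^^ (j - length ws)) t)) {length ws..<length (ws @ w)} (cell Q a))
       \<le> (1 / Q + \<delta>) * card {length ws..<length (ws @ w)}" by (simp add: lw)
  next
    have "real (card {j \<in> {length ws..<length (ws @ w)}. length (ws @ w) < j + s}) \<le> real s"
      by (intro of_nat_mono cardE)
    thus "real (card {j \<in> {length ws..<length (ws @ w)}. length (ws @ w) < j + s}) \<le> \<epsilon> / 4 * card {length ws..<length (ws @ w)}"
      using L(2) by (simp add: lw)
  qed auto
  fix b assume b: "b \<in> {2..K}"
  hence b2: "b \<ge> 2" "b \<in> {2..Kmax}" using K by auto
  define m where "m = digit_pos b (den ws)"
  define m' where "m' = digit_pos b (den (ws @ w))"
  define x where "x = cf_tail ws t"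
  define u where "u = frac (real b ^ m * x)"
  define l where "l = m' - m"
  have l: "\<Lambda> \<le> l" "real s \<le> \<epsilon> / 4 * l" using len[OF b2(2)] by (auto simp: l_def m_def m'_def)
  have pww: "pos_word (ws @ w)" using ws pw by simp
  have "den ws \<le> den (ws @ w)"
    using den_append_ge[of ws w] den_pos[OF pw] by (metis dual_order.trans mult.right_neutral mult_le_mono2 Suc_leI One_nat_def)
  hence mm: "m \<le> m'" unfolding m_def m'_def by (rule mb_mono[OF b2(1)])
  hence m'l: "m' = m + l" by (simp add: l_def)
  have xJ: "x = cf_tail (ws @ w) ((gauss_map ^^ L) t)"
    using cf_tail_digits[of t 0 L] t by (simp add: x_def cf_tail_append w)
  have xy: "\<bar>cf_tail (ws @ w) 0 - x\<bar> \<le> 1 / (real (den (ws @ w)))\<^sup>2"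
    unfolding xJ using tU[of L] by (intro cf_tail_close(1)[OF pww]) auto
  have z: "frac (real b ^ (j - m) * u) = frac (real b ^ j * x)" if "j \<ge> m" for j
  proof -
    have "frac (real b ^ (j - m) * u) = frac (real (b ^ (j - m)) * (real b ^ m * x))"
      unfolding u_def of_nat_power[symmetric] by (rule frac_mult_frac)
    also have "real (b ^ (j - m)) * (real b ^ m * x) = real b ^ j * x"
      using that by (simp flip: power_add mult.assoc)
    finally show ?thesis .
  qed
  show "even_cells K (\<lambda>j. frac (real b ^ j * cf_tail (ws @ w) 0)) {digit_pos b (den ws)..<digit_pos b (den (ws @ w))}"
    unfolding m_def[symmetric] m'_def[symmetric]
  \<comment> \<open>\<open>Suc s\<close> makes the remaining positions satisfy
    \<open>j + s < m'\<close> strictly, as \<open>base_close\<close> demands; still at most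
    \<open>s\<close> positions are given up.\<close>
  proof (rule even_cells_transfer[where Q = Q and \<delta> = \<delta> and \<eta> = "4 / 2 ^ s" and Kmax = Kmax and \<epsilon> = \<epsilon> and
        E = "{j \<in> {m..<m'}. m' < j + Suc s}" and
        z = "\<lambda>j. frac (real b ^ (j - m) * u)", OF _ _ Q0 K _ _ \<epsilon>(1) s4 \<epsilon>(4,2) d0])
    fix j assume j: "j \<in> {m..<m'} - {j \<in> {m..<m'}. m' < j + Suc s}"
    hence j': "j + s < m'" "j \<ge> m" by auto
    obtain k :: int where "\<bar>frac (real b ^ j * cf_tail (ws @ w) 0) - frac (real b ^ j * x) - of_int k\<bar> \<le> 1 / 2 ^ s"
      using base_close[OF xy b2(1), of j s] j' unfolding m'_def by blast
    moreover have "1 / (2::real) ^ s \<le> 4 / 2 ^ s" by (simp add: divide_right_mono)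
    ultimately have "\<bar>frac (real b ^ j * cf_tail (ws @ w) 0) - frac (real b ^ j * x) - of_int k\<bar> \<le> 4 / 2 ^ s" by linarith
    thus "0 \<le> frac (real b ^ (j - m) * u) \<and> frac (real b ^ (j - m) * u) < 1 \<and>
       (\<exists>k::int. \<bar>frac (real b ^ j * cf_tail (ws @ w) 0) - frac (real b ^ (j - m) * u) - of_int k\<bar> \<le> 4 / 2 ^ s)"
      unfolding z[OF j'(2)] by (auto simp: frac_lt_1)
  next
    fix a assume "a < Q"
    have "occ (\<lambda>j. frac (real b ^ (j - m) * u)) {m..<m'} (cell Q a) = occ (\<lambda>j. frac (real b ^ j * u)) {..<l} (cell Q a)"
      using occ_shift[of "\<lambda>j. frac (real b ^ j * u)" m l] by (simp add: m'l)
    also have "real \<dots> \<le> (1 / Q + \<delta>) * l"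
      using tb[OF b2(2)] l(1) \<open>a < Q\<close> by (auto simp: typical_def u_def m_def x_def)
    finally show "real (occ (\<lambda>j. frac (real b ^ (j - m) * u)) {m..<m'} (cell Q a)) \<le> (1 / Q + \<delta>) * card {m..<m'}"
      by (simp add: l_def)
  next
    have "{j \<in> {m..<m'}. m' < j + Suc s} \<subseteq> {m' - s..<m'}" by auto
    hence "card {j \<in> {m..<m'}. m' < j + Suc s} \<le> card {m' - s..<m'}" by (rule card_mono[rotated]) simp
    hence "real (card {j \<in> {m..<m'}. m' < j + Suc s}) \<le> real s" by simp
    thus "real (card {j \<in> {m..<m'}. m' < j + Suc s}) \<le> \<epsilon> / 4 * card {m..<m'}"
      using l(2) by (simp add: l_def)
  qed auto
qed

text \<open>The digits of \<open>w\<close> multiply the squared denominator by at least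
  \<open>2 ^ length w / 2\<close>, and one digit to base b accounts for a factor b; rounding up in
  \<open>digit_pos b (den ws)\<close> costs at most one more such factor.\<close>

lemma window_long:
  assumes "pos_word ws" "pos_word w" "b \<ge> 2" and L: "2 * b ^ R < 2 ^ length w"
  shows "R \<le> digit_pos b (den (ws @ w)) - digit_pos b (den ws)"
proof (rule ccontr)
  assume "\<not> ?thesis"
  hence m: "digit_pos b (den (ws @ w)) \<le> digit_pos b (den ws) + (R - 1)" "R \<ge> 1" by auto
  define q where "q = den ws"
  have q0: "q > 0" using den_pos assms by (simp add: q_def)
  have "q\<^sup>2 * 2 ^ length w \<le> q\<^sup>2 * (2 * (den w)\<^sup>2)" using den_ge[OF assms(2)] by simp
  also have "\<dots> = 2 * (den ws * den w)\<^sup>2" by (simp add: q_def power_mult_distrib)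
  also have "\<dots> \<le> 2 * (den (ws @ w))\<^sup>2" using den_append_ge by (simp add: power_mono)
  also have "\<dots> \<le> 2 * b ^ digit_pos b (den (ws @ w))" using mb_ge[OF assms(3)] by simp
  also have "\<dots> \<le> 2 * b ^ (digit_pos b q + (R - 1))" using m assms(3) by (simp add: q_def power_increasing)
  also have "\<dots> = 2 * b ^ (R - 1) * b ^ digit_pos b q" by (simp add: power_add)
  also have "\<dots> \<le> 2 * b ^ (R - 1) * (b * q\<^sup>2)" using mb_upper[OF q0, of b] assms(3) by simp
  also have "\<dots> = q\<^sup>2 * (2 * b ^ R)" using m(2) by (cases R) auto
  finally show False using q0 L by simp
qed

text \<open>Union bound for a random tail: measure 1/4 is reserved for Gauss-atypical points, 1/4
  for points with large digits, and 1/4 for all bases together. The rest contains an irrational t,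
  whose first \<open>L\<close> digits form the block. Thanks to \<open>pushforward_bound\<close>,
  \<open>L\<close> and \<open>D\<close> can be chosen before \<open>ws\<close>.\<close>

theorem good_extension:
  "\<exists>L D. L \<ge> 1 \<and> (\<forall>ws. pos_word ws \<longrightarrow> (\<exists>w. length w = L \<and> (\<forall>d\<in>set w. 0 < d \<and> d \<le> D) \<and> (\<forall>K\<in>{1..K0}. passes K ws w)))"
proof (cases "K0 = 0")
  case True
  thus ?thesis by (intro exI[of _ 1] exI[of _ 1]) (auto intro!: exI[of _ "[1]"])
next
  case False
  define \<epsilon> where "\<epsilon> = 1 / (real K0)\<^sup>2"
  have e0: "\<epsilon> > 0" using False by (simp add: \<epsilon>_def)
  define Q where "Q = 16 * K0\<^sup>2"
  have Q: "Q > 0" "real Q \<ge> 16 / \<epsilon>" using False by (auto simp: Q_def \<epsilon>_def)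
  define \<delta> where "\<delta> = \<epsilon> / (8 * Q)"
  have d0: "\<delta> > 0" using e0 Q by (simp add: \<delta>_def)
  obtain s where s: "(1/2::real) ^ s < \<epsilon> / 64" using real_arch_pow_inv[of "\<epsilon> / 64" "1/2"] e0 by auto
  hence s: "4 / 2 ^ s \<le> \<epsilon> / 16" by (simp add: power_divide field_simps)
  obtain \<Lambda>g where Lg: "emeasure lborel {t\<in>U. \<not> typical Q \<delta> \<Lambda>g (\<lambda>j. gauss_coord ((gauss_map ^^ j) t))} < ennreal (1/4)"
    using gauss_atypical_small[OF Q(1) d0, of "1/4"] by auto
  \<comment> \<open>After the loss of the factor 4 (b + 2) in \<open>pushforward_bound\<close>,
    every base costs 1 / (4 K0).\<close>
  define \<epsilon>b where "\<epsilon>b b = 1 / (4 * (real b + 2) * (4 * real K0))" for b :: nat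
  have "\<exists>\<Lambda>. emeasure lborel {u\<in>U. \<not> typical Q \<delta> \<Lambda> (\<lambda>j. frac (real b ^ j * u))} < ennreal (\<epsilon>b b)" if "b \<ge> 2" for b
    using base_atypical_small[OF that Q(1) d0, of "\<epsilon>b b"] False by (simp add: \<epsilon>b_def add_pos_pos)
  hence "\<forall>b. \<exists>\<Lambda>. b \<ge> 2 \<longrightarrow> emeasure lborel {u\<in>U. \<not> typical Q \<delta> \<Lambda> (\<lambda>j. frac (real b ^ j * u))} < ennreal (\<epsilon>b b)"
    by blast
  from choice[OF this]
  obtain \<Lambda>b where Lb: "\<And>b. b \<ge> 2 \<Longrightarrow> emeasure lborel {u\<in>U. \<not> typical Q \<delta> (\<Lambda>b b) (\<lambda>j. frac (real b ^ j * u))} < ennreal (\<epsilon>b b)"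
    by blast
  define \<Lambda> where "\<Lambda> = \<Lambda>g + (\<Sum>b\<le>K0. \<Lambda>b b)"
  have \<Lambda>b_le: "\<Lambda>b b \<le> \<Lambda>" if "b \<le> K0" for b
    unfolding \<Lambda>_def using member_le_sum[of b "{..K0}" \<Lambda>b] that by auto
  \<comment> \<open>Required length of every window: beyond all thresholds of
    \<open>typical\<close>, and long enough to neglect s positions.\<close>
  define R where "R = max \<Lambda> (nat \<lceil>4 * s / \<epsilon>\<rceil>)"
  have R: "\<Lambda> \<le> R" "\<And>r. R \<le> r \<Longrightarrow> real s \<le> \<epsilon> / 4 * real r"
  proof -
    fix r assume "R \<le> r"
    hence "4 * s / \<epsilon> \<le> real r" unfolding R_def by linarith
    thus "real s \<le> \<epsilon> / 4 * r" using e0 by (simp add: field_simps)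
  qed (simp add: R_def)
  \<comment> \<open>Enough digits for every base window to reach \<open>R\<close>, by n <
    2^n.\<close>
  define L where "L = R + 1 + 2 * K0 ^ R"
  have L2: "2 * b ^ R < 2 ^ L" if "b \<le> K0" for b
  proof -
    have "2 * b ^ R \<le> 2 * K0 ^ R" using that by (simp add: power_mono)
    also have "\<dots> \<le> L" by (simp add: L_def)
    also have "\<dots> < 2 ^ L" by simp
    finally show ?thesis .
  qed
  have LR: "R \<le> L" "L \<ge> 1" by (auto simp: L_def)
  obtain D where D: "emeasure lborel {t\<in>U. \<not> (\<forall>i<L. cf_digit t i \<le> D)} < ennreal (1/4)"
    using large_digits_small[of "1/4" L] by auto
  show ?thesis
  proof (rule exI[of _ L], rule exI[of _ D], intro conjI allI impI LR(2))
    fix ws assume ws: "pos_word ws"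
    define G where "G = {t\<in>U. \<not> typical Q \<delta> \<Lambda>g (\<lambda>j. gauss_coord ((gauss_map ^^ j) t))}"
    define H where "H = {t\<in>U. \<not> (\<forall>i<L. cf_digit t i \<le> D)}"
    define A where "A b = {u\<in>U. \<not> typical Q \<delta> (\<Lambda>b b) (\<lambda>j. frac (real b ^ j * u))}" for b :: nat
    define B where "B b = {t\<in>U. frac (real b ^ digit_pos b (den ws) * cf_tail ws t) \<in> A b}" for b :: nat
    have Gs: "G \<in> sets lborel" unfolding G_def by (rule typical_meas) measurable
    have As: "A b \<in> sets lborel" for b unfolding A_def by (rule typical_meas) (simp add: frac_def)
    have Hs: "H \<in> sets lborel" unfolding H_def by (rule large_digits_meas)
    have B: "B b \<in> sets lborel" "emeasure lborel (B b) \<le> ennreal (1 / (4 * real K0))" if "b \<in> {2..K0}" for b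
    proof -
      have c1: "(real (den ws))\<^sup>2 \<le> real b ^ digit_pos b (den ws)"
        using mb_ge[of b "den ws"] that by (metis atLeastAtMost_iff of_nat_le_iff of_nat_power)
      have "b ^ digit_pos b (den ws) \<le> b * (den ws)\<^sup>2" using mb_upper[of "den ws" b] den_pos[OF ws] that by auto
      hence c2: "real b ^ digit_pos b (den ws) \<le> real b * (real (den ws))\<^sup>2"
        by (metis of_nat_le_iff of_nat_power of_nat_mult)
      have AU: "A b \<subseteq> U" by (auto simp: A_def)
      note pf = pushforward_bound[OF ws c1 c2 As AU]
      show "B b \<in> sets lborel" unfolding B_def by (rule pf(1))
      have "emeasure lborel (B b) \<le> ennreal (4 * (real b + 2)) * emeasure lborel (A b)"
        unfolding B_def by (rule pf(2))
      also have "\<dots> \<le> ennreal (4 * (real b + 2)) * ennreal (\<epsilon>b b)"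
        using Lb[of b] that by (intro mult_left_mono) (auto simp: A_def)
      also have "\<dots> = ennreal (4 * (real b + 2) * \<epsilon>b b)" by (rule ennreal_mult[symmetric]) (simp_all add: \<epsilon>b_def)
      also have "4 * (real b + 2) * \<epsilon>b b = 1 / (4 * real K0)"
      proof -
        have "X * (1 / (X * Y)) = 1 / Y" if "X > 0" for X Y :: real using that by simp
        from this[of "4 * (real b + 2)"] show ?thesis unfolding \<epsilon>b_def by (simp add: add_pos_pos)
      qed
      finally show "emeasure lborel (B b) \<le> ennreal (1 / (4 * real K0))" .
    qed
    define V where "V = G \<union> (H \<union> (\<Union>b\<in>{2..K0}. B b))"
    have Vs: "V \<in> sets lborel" unfolding V_def using Gs Hs B(1) by blast
    have "emeasure lborel V \<le> emeasure lborel G + (emeasure lborel H + (\<Sum>b\<in>{2..K0}. emeasure lborel (B b)))"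
      unfolding V_def
      by (intro order_trans[OF emeasure_subadditive] add_left_mono emeasure_subadditive_finite)
         (use Gs Hs B(1) in auto)
    also have "\<dots> \<le> ennreal (1/4) + (ennreal (1/4) + (\<Sum>b\<in>{2..K0}. ennreal (1 / (4 * real K0))))"
      by (intro add_mono sum_mono B(2)) (use Lg D in \<open>auto simp: G_def H_def\<close>)
    also have "(\<Sum>b\<in>{2..K0}. ennreal (1 / (4 * real K0))) = ennreal (real (card {2..K0}) * (1 / (4 * real K0)))"
      by (subst sum_ennreal) auto
    also have "\<dots> \<le> ennreal (1/4)" by (intro ennreal_leI) (use False in \<open>simp add: field_simps\<close>)
    also have "ennreal (1/4) + (ennreal (1/4) + ennreal (1/4)) = ennreal (3/4)"
    proof -
      have "ennreal (3/4) = ennreal (1/4 + (1/4 + 1/4))" by simp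
      also have "\<dots> = ennreal (1/4) + ennreal (1/4 + 1/4)" by (rule ennreal_plus) auto
      also have "ennreal (1/4 + 1/4) = ennreal (1/4) + ennreal (1/4)" by (rule ennreal_plus) auto
      finally show ?thesis by (rule sym)
    qed
    finally have V34: "emeasure lborel V \<le> ennreal (3/4)" by (simp add: add_left_mono)
    have "\<exists>t\<in>U. t \<notin> \<rat> \<and> t \<notin> V"
    proof (rule ccontr)
      assume "\<not> ?thesis"
      hence "U \<subseteq> V \<union> \<rat>" by blast
      hence "emeasure lborel U \<le> emeasure lborel (V \<union> \<rat>)"
        using Vs by (intro emeasure_mono) (auto intro: borel_closed countable_rat sets.countable)
      also have "\<dots> = emeasure lborel V"
        using countable_imp_null_set_lborel[OF countable_rat] Vs by (rule emeasure_Un_null_set[rotated])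
      also have "\<dots> \<le> ennreal (3/4)" by fact
      finally have "ennreal 1 \<le> ennreal (3/4)" by simp
      thus False by (subst (asm) ennreal_le_iff) auto
    qed
    then obtain t where t: "t \<in> U" "t \<notin> \<rat>" "t \<notin> V" by blast
    define w where "w = map (cf_digit t) [0..<L]"
    have pw: "pos_word w" unfolding w_def by (rule pos_word_map) (use cf_digit_step(1) t in auto)
    have lw: "length w = L" by (simp add: w_def)
    show "\<exists>w. length w = L \<and> (\<forall>d\<in>set w. 0 < d \<and> d \<le> D) \<and> (\<forall>K\<in>{1..K0}. passes K ws w)"
    proof (intro exI[of _ w] conjI lw ballI)
      fix d assume d: "d \<in> set w"
      show "0 < d" using pw d by (auto simp: pos_word_def)
      have "t \<notin> H" using t(3) unfolding V_def by blast
      thus "d \<le> D" using d t by (auto simp: w_def H_def)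
    next
      fix K assume K: "K \<in> {1..K0}"
      show "passes K ws w"
      proof (rule good_point_extends[where Kmax = K0 and \<epsilon> = \<epsilon> and Q = Q and \<delta> = \<delta> and s = s and t = t and \<Lambda> = \<Lambda> and L = L])
        show "typical Q \<delta> \<Lambda> (\<lambda>j. gauss_coord ((gauss_map ^^ j) t))"
        proof (rule typical_mono)
          have "t \<notin> G" using t(3) unfolding V_def by blast
          thus "typical Q \<delta> \<Lambda>g (\<lambda>j. gauss_coord ((gauss_map ^^ j) t))" using t(1) unfolding G_def by blast
        qed (simp add: \<Lambda>_def)
        show "typical Q \<delta> \<Lambda> (\<lambda>j. frac (real b ^ j * frac (real b ^ digit_pos b (den ws) * cf_tail ws t)))" if b: "b \<in> {2..K0}" for b
        proof (rule typical_mono)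
          let ?u = "frac (real b ^ digit_pos b (den ws) * cf_tail ws t)"
          \<comment> \<open>The exceptional sets for the bases live in the open interval;
            irrationality excludes its endpoint 0.\<close>
          have "?u \<noteq> 0"
          proof
            assume "?u = 0"
            hence "real b ^ digit_pos b (den ws) * cf_tail ws t \<in> \<int>" by (simp add: frac_eq_0_iff)
            hence "real b ^ digit_pos b (den ws) * cf_tail ws t \<in> \<rat>" using Ints_subset_Rats by blast
            hence "real b ^ digit_pos b (den ws) * cf_tail ws t / real b ^ digit_pos b (den ws) \<in> \<rat>" by (intro Rats_divide) auto
            thus False using cf_tail_irrational[OF t(2), of ws] b by simp
          qed
          hence "?u \<in> U" using frac_ge_0[of "real b ^ digit_pos b (den ws) * cf_tail ws t"] frac_lt_1[of "real b ^ digit_pos b (den ws) * cf_tail ws t"] by auto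
          moreover have "t \<notin> B b" using t(3) b unfolding V_def by blast
          ultimately show "typical Q \<delta> (\<Lambda>b b) (\<lambda>j. frac (real b ^ j * ?u))"
            using t(1) unfolding B_def A_def by blast
          show "\<Lambda>b b \<le> \<Lambda>" using \<Lambda>b_le b by simp
        qed
        show "\<Lambda> \<le> digit_pos b (den (ws @ w)) - digit_pos b (den ws) \<and> real s \<le> \<epsilon> / 4 * real (digit_pos b (den (ws @ w)) - digit_pos b (den ws))"
          if "b \<in> {2..K0}" for b
        proof -
          have "R \<le> digit_pos b (den (ws @ w)) - digit_pos b (den ws)"
            using that L2[of b] by (intro window_long ws pw) (auto simp: lw)
          moreover from this have "real s \<le> \<epsilon> / 4 * real (digit_pos b (den (ws @ w)) - digit_pos b (den ws))" by (rule R(2))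
          ultimately show ?thesis using R(1) by linarith
        qed
        show "0 < K" "K \<le> K0" using K by auto
        show "\<Lambda> \<le> L" using R(1) LR(1) by linarith
        show "real s \<le> \<epsilon> / 4 * L" using LR(1) by (rule R(2))
        show "\<epsilon> = 1 / (real K0)\<^sup>2" by (fact \<epsilon>_def)
        show "16 / \<epsilon> \<le> real Q" by (fact Q(2))
        show "\<delta> = \<epsilon> / (8 * Q)" by (fact \<delta>_def)
        show "4 / 2 ^ s \<le> \<epsilon> / 16" by (fact s)
        show "t \<notin> \<rat>" "t \<in> U" by (fact t)+
        show "pos_word ws" by (fact ws)
        show "w = map (cf_digit t) [0..<L]" by (fact w_def)
      qed
    qed
  qed
qed

section \<open>The greedy construction\<close>

text \<open>Bijective base-\<open>c\<close> numeration: \<open>dec c\<close> maps the naturals onto the words over \<open>{1..c}\<close>.\<close>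

function dec :: "nat \<Rightarrow> nat \<Rightarrow> nat list" where
  "dec c m = (if m = 0 then [] else Suc ((m - 1) mod c) # dec c ((m - 1) div c))"
  by auto
termination by (relation "Wellfounded.measure snd") (auto simp: le_less_trans[OF div_le_dividend])

declare dec.simps [simp del]

lemma dec_0 [simp]: "dec c 0 = []" by (simp add: dec.simps)

lemma dec_pos: "m > 0 \<Longrightarrow> dec c m = Suc ((m - 1) mod c) # dec c ((m - 1) div c)"
  by (subst dec.simps) simp

lemma dec_range: "c > 0 \<Longrightarrow> d \<in> set (dec c m) \<Longrightarrow> 0 < d \<and> d \<le> c"
proof (induction c m rule: dec.induct)
  case (1 c m)
  show ?case
  proof (cases "m = 0")
    case False
    thus ?thesis using 1 by (auto simp: dec_pos Suc_le_eq)
  qed (use 1 in simp)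
qed

text \<open>The point is the bound on the index: for fixed word length it is polynomial in c, so for
  large c the word is among the first \<open>2 ^ c\<close> candidates.\<close>

lemma dec_surj: "(\<forall>d\<in>set w. 0 < d \<and> d \<le> c) \<Longrightarrow> c > 0 \<Longrightarrow> \<exists>m. m + 1 \<le> (c + 1) ^ length w \<and> dec c m = w"
proof (induction w)
  case Nil
  thus ?case by (intro exI[of _ 0]) simp
next
  case (Cons d w)
  then obtain m where m: "m + 1 \<le> (c + 1) ^ length w" "dec c m = w" by auto
  have d: "0 < d" "d \<le> c" using Cons.prems by auto
  obtain e where e: "d = Suc e" using d by (cases d) auto
  have "(e + c * m) mod c = e" "(e + c * m) div c = m" using d e by auto
  hence "dec c (d + c * m) = Suc e # dec c m" unfolding e by (subst dec_pos) auto
  hence "dec c (d + c * m) = d # w" using e m by simp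
  moreover have "d + c * m + 1 \<le> c * (m + 1) + 1" using d by simp
  moreover have "c * (m + 1) + 1 \<le> c * (c + 1) ^ length w + (c + 1) ^ length w"
    using m by (intro add_mono mult_le_mono2) auto
  ultimately show ?case by (intro exI[of _ "d + c * m"]) simp
qed

text \<open>Removing a digit at least halves the index plus 1. Hence candidates up to
  \<open>2 ^ c\<close> have at most c digits.\<close>

lemma dec_length: "c \<ge> 2 \<Longrightarrow> 2 ^ length (dec c m) \<le> m + 1"
proof (induction c m rule: dec.induct)
  case (1 c m)
  show ?case
  proof (cases "m = 0")
    case False
    define k where "k = (m - 1) div c"
    have "2 * k \<le> c * k" using 1 by simp
    also have "\<dots> \<le> m - 1" unfolding k_def by simp
    finally have "2 * (k + 1) \<le> m + 1" using False by simp
    moreover have "2 ^ length (dec c k) \<le> k + 1" using 1 False unfolding k_def by simp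
    ultimately show ?thesis using False by (simp add: dec_pos k_def)
  qed simp
qed

lemma dec_nonempty: "m > 0 \<Longrightarrow> dec c m \<noteq> []"
  by (simp add: dec_pos)

text \<open>One sweep: m never moves back and the level K never drops, so that, starting from 1 and
  1, there are at most X + c calls of \<open>pass\<close> instead of X times c. A candidate that
  passes is tried at the next level at once; r is the last one that passed.\<close>

function search :: "(nat \<Rightarrow> nat \<Rightarrow> bool) \<Rightarrow> nat \<Rightarrow> nat \<Rightarrow> nat \<Rightarrow> nat \<Rightarrow> nat \<Rightarrow> nat" where
  "search pass X c K m r = (if m \<le> X \<and> K \<le> c then
     (if pass K m then search pass X c (Suc K) m m else search pass X c K (Suc m) r) else r)"
  by auto
termination by (relation "Wellfounded.measure (\<lambda>(pass, X, c, K, m, r). (Suc X - m) + (Suc c - K))") auto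

declare search.simps [simp del]

text \<open>Leaving a candidate takes a failure, so one that passes all levels up to
  \<open>K0\<close> cannot be left before the level exceeds \<open>K0\<close>. The result passes the
  level just below the final one, though not necessarily the lower ones; this is enough, as a single
  level controls all cells and bases.\<close>

lemma search_spec:
  assumes "1 \<le> K" "pass (K - 1) r"
  shows "\<exists>k\<ge>K. pass (k - 1) (search pass X c K m r) \<and>
     (\<forall>m0 K0. m \<le> m0 \<and> m0 \<le> X \<and> K0 \<le> c \<and> (\<forall>K'\<in>{K..K0}. pass K' m0) \<longrightarrow> K0 < k)"
  using assms
proof (induction pass X c K m r rule: search.induct)
  case (1 pass X c K m r)
  consider "m \<le> X \<and> K \<le> c" "pass K m" | "m \<le> X \<and> K \<le> c" "\<not> pass K m" | "\<not> (m \<le> X \<and> K \<le> c)" by blast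
  thus ?case
  proof cases
    case 1
    then obtain k where "k \<ge> Suc K" "pass (k - 1) (search pass X c (Suc K) m m)"
      "\<forall>m0 K0. m \<le> m0 \<and> m0 \<le> X \<and> K0 \<le> c \<and> (\<forall>K'\<in>{Suc K..K0}. pass K' m0) \<longrightarrow> K0 < k"
      using "1.IH"(1) by auto
    moreover from this have "K0 < k" if "m \<le> m0" "m0 \<le> X" "K0 \<le> c" "\<forall>K'\<in>{K..K0}. pass K' m0" for m0 K0
    proof -
      have "\<forall>K'\<in>{Suc K..K0}. pass K' m0" using that(4) by auto
      thus ?thesis using calculation(3) that by blast
    qed
    ultimately show ?thesis using 1 by (subst search.simps) (auto intro!: exI[of _ k])
  next
    case 2
    then obtain k where k: "k \<ge> K" "pass (k - 1) (search pass X c K (Suc m) r)"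
      "\<forall>m0 K0. Suc m \<le> m0 \<and> m0 \<le> X \<and> K0 \<le> c \<and> (\<forall>K'\<in>{K..K0}. pass K' m0) \<longrightarrow> K0 < k"
      using "1.IH"(2) "1.prems" by auto
    have "K0 < k" if "m \<le> m0" "m0 \<le> X" "K0 \<le> c" "\<forall>K'\<in>{K..K0}. pass K' m0" for m0 K0
    proof (cases "m0 = m")
      case True
      have "\<not> K \<le> K0" using that(4) 2(2) True by auto
      thus ?thesis using k(1) by simp
    next
      case False
      hence "Suc m \<le> m0" using that(1) by simp
      moreover have "\<forall>K'\<in>{K..K0}. pass K' m0" by (fact that(4))
      ultimately show ?thesis using k(3)[rule_format, of m0 K0] that(2,3) by blast
    qed
    thus ?thesis using 2 k by (subst search.simps) (auto intro!: exI[of _ k])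
  next
    case 3
    have "K0 < K" if "m \<le> m0" "m0 \<le> X" "K0 \<le> c" for m0 K0 using 3 that by auto
    moreover have "search pass X c K m r = r" using 3 by (subst search.simps) auto
    ultimately show ?thesis using "1.prems" by (intro exI[of _ K]) auto
  qed
qed

lemma search_bounds: "1 \<le> m \<Longrightarrow> 1 \<le> r \<Longrightarrow> r \<le> X \<Longrightarrow> 1 \<le> search pass X c K m r \<and> search pass X c K m r \<le> X"
proof (induction pass X c K m r rule: search.induct)
  case (1 pass X c K m r)
  thus ?case by (subst (1 2) search.simps) auto
qed

text \<open>Index 0, the empty word, is left out, so every block has a digit. Candidate 1 is the
  default: it passes level 0 trivially.\<close>

definition best :: "nat list \<Rightarrow> nat \<Rightarrow> nat" where
  "best ws c = search (\<lambda>K m. passes K ws (dec c m)) (2 ^ c) c 1 1 1"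

text \<open>c is raised by at most 1 per step, and only when \<open>2 ^ c\<close> has fallen behind
  the length. This keeps the number of candidates linear in the length, for the cost, and still lets
  c tend to infinity, for the levels.\<close>

definition greedy_step :: "nat list \<times> nat \<Rightarrow> nat list \<times> nat" where
  "greedy_step s = (case s of (ws, c) \<Rightarrow> let ws' = ws @ dec c (best ws c) in (ws', if 2 ^ c < length ws' then Suc c else c))"

definition greedy :: "nat \<Rightarrow> nat list \<times> nat" where "greedy i = (greedy_step ^^ i) ([], 2)"

definition greedy_word :: "nat \<Rightarrow> nat list" where "greedy_word i = fst (greedy i)"
definition greedy_par :: "nat \<Rightarrow> nat" where "greedy_par i = snd (greedy i)"
definition greedy_block :: "nat \<Rightarrow> nat list" where "greedy_block i = dec (greedy_par i) (best (greedy_word i) (greedy_par i))"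
definition greedy_len :: "nat \<Rightarrow> nat" where "greedy_len i = length (greedy_word i)"

lemma greedy_0: "greedy_word 0 = []" "greedy_par 0 = 2" "greedy_len 0 = 0" by (simp_all add: greedy_word_def greedy_par_def greedy_def greedy_len_def)

lemma greedy_Suc: "greedy_word (Suc i) = greedy_word i @ greedy_block i" "greedy_par (Suc i) = (if 2 ^ greedy_par i < greedy_len (Suc i) then Suc (greedy_par i) else greedy_par i)"
  "greedy_len (Suc i) = greedy_len i + length (greedy_block i)"
  by (simp_all add: greedy_word_def greedy_par_def greedy_def greedy_len_def greedy_block_def greedy_step_def Let_def split: prod.splits)

lemma best_bounds: "1 \<le> best ws c \<and> best ws c \<le> 2 ^ c"
  unfolding best_def by (rule search_bounds) auto

lemma par_ge: "greedy_par i \<ge> 2"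
  by (induction i) (auto simp: greedy_0 greedy_Suc)

lemma par_mono: "i \<le> j \<Longrightarrow> greedy_par i \<le> greedy_par j"
  by (rule lift_Suc_mono_le) (auto simp: greedy_Suc)

lemma blk_nonempty: "greedy_block i \<noteq> []"
  unfolding greedy_block_def using best_bounds[of "greedy_word i" "greedy_par i"] by (intro dec_nonempty) auto

lemma blk_length: "length (greedy_block i) \<le> greedy_par i"
proof (rule ccontr)
  assume "\<not> ?thesis"
  hence "2 ^ Suc (greedy_par i) \<le> (2::nat) ^ length (greedy_block i)" by (intro power_increasing) auto
  also have "\<dots> \<le> best (greedy_word i) (greedy_par i) + 1" unfolding greedy_block_def by (intro dec_length par_ge)
  also have "\<dots> \<le> 2 ^ greedy_par i + 1" using best_bounds by simp
  finally have "(2::nat) ^ greedy_par i \<le> 1" by simp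
  moreover have "(2::nat) ^ 2 \<le> 2 ^ greedy_par i" by (intro power_increasing par_ge) simp
  ultimately show False by simp
qed

lemma blk_digits: "d \<in> set (greedy_block i) \<Longrightarrow> 0 < d \<and> d \<le> greedy_par i"
  unfolding greedy_block_def using par_ge[of i] by (intro dec_range[of _ d]) auto

lemma pos_blk: "pos_word (greedy_block i)"
  using blk_digits by (auto simp: pos_word_def)

lemma pos_wd: "pos_word (greedy_word i)"
  by (induction i) (auto simp: greedy_0 greedy_Suc pos_blk)

lemma wd_digits: "d \<in> set (greedy_word i) \<Longrightarrow> d \<le> greedy_par i"
proof (induction i)
  case (Suc i)
  have "greedy_par i \<le> greedy_par (Suc i)" by (rule par_mono) simp
  thus ?case using Suc blk_digits[of d i] by (auto simp: greedy_Suc(1))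
qed (simp add: greedy_0)

lemma len_mono: "i \<le> j \<Longrightarrow> greedy_len i \<le> greedy_len j"
  by (rule lift_Suc_mono_le) (auto simp: greedy_Suc)

lemma len_ge: "i \<le> greedy_len i"
proof (induction i)
  case (Suc i)
  have "length (greedy_block i) \<ge> 1" using blk_nonempty[of i] by (simp add: Suc_le_eq)
  thus ?case using Suc by (simp add: greedy_Suc)
qed simp

text \<open>The power is doubled only after the length has passed it; 4 is its initial
  value.\<close>

lemma par_bound: "2 ^ greedy_par i \<le> 2 * greedy_len i + 4"
proof (induction i)
  case (Suc i)
  thus ?case using len_mono[of i "Suc i"] by (auto simp: greedy_Suc(2))
qed (simp add: greedy_0)

lemma filterlim_len: "filterlim greedy_len at_top sequentially"
  unfolding filterlim_at_top eventually_sequentially using len_ge order_trans by blast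

text \<open>The length is at least the number of steps, so it overtakes any fixed
  \<open>2 ^ c\<close>.\<close>

lemma par_unbounded: "\<exists>i. greedy_par i \<ge> c"
proof (induction c)
  case (Suc c)
  then obtain i where i: "greedy_par i \<ge> c" by blast
  show ?case
  proof (rule ccontr)
    assume "\<not> ?thesis"
    hence *: "greedy_par j \<le> c" for j by (meson not_less_eq_eq)
    define j where "j = max i (2 ^ c)"
    have "greedy_par i \<le> greedy_par j" by (rule par_mono) (simp add: j_def)
    hence "greedy_par j = c" using *[of j] i by linarith
    moreover have "2 ^ c < greedy_len (Suc j)" using len_ge[of "Suc j"] by (simp add: j_def)
    ultimately have "greedy_par (Suc j) = Suc c" by (simp add: greedy_Suc(2))
    thus False using *[of "Suc j"] by simp
  qed
qed simp

lemma filterlim_par: "filterlim greedy_par at_top sequentially"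
  unfolding filterlim_at_top eventually_sequentially
proof
  fix c
  obtain i where "greedy_par i \<ge> c" using par_unbounded by blast
  thus "\<exists>N. \<forall>n\<ge>N. c \<le> greedy_par n" by (intro exI[of _ i] allI impI) (rule order_trans[OF _ par_mono])
qed

lemma passes_0: "passes 0 ws w"
  by (simp add: passes_def even_cells_def)

lemma stage_exists:
  "\<exists>k. passes k (greedy_word i) (greedy_block i) \<and> (\<forall>m0 K0. 1 \<le> m0 \<and> m0 \<le> 2 ^ greedy_par i \<and> K0 \<le> greedy_par i \<and>
      (\<forall>K'\<in>{1..K0}. passes K' (greedy_word i) (dec (greedy_par i) m0)) \<longrightarrow> K0 \<le> k)"
proof -
  obtain k where "k \<ge> 1" "passes (k - 1) (greedy_word i) (greedy_block i)" "\<forall>m0 K0. 1 \<le> m0 \<and> m0 \<le> 2 ^ greedy_par i \<and> K0 \<le> greedy_par i \<and>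
      (\<forall>K'\<in>{1..K0}. passes K' (greedy_word i) (dec (greedy_par i) m0)) \<longrightarrow> K0 < k"
    using search_spec[of 1 "\<lambda>K m. passes K (greedy_word i) (dec (greedy_par i) m)" 1 "2 ^ greedy_par i" "greedy_par i" 1]
    unfolding greedy_block_def best_def by (auto simp: passes_0)
  thus ?thesis by (intro exI[of _ "k - 1"]) (auto simp: less_eq_iff_succ_less le_diff_conv2 Suc_le_eq)
qed

text \<open>The level reached is not kept in the state of the construction; it is recovered by
  choice from what \<open>search_spec\<close> guarantees.\<close>

definition stage :: "nat \<Rightarrow> nat" where
  "stage i = (SOME k. passes k (greedy_word i) (greedy_block i) \<and> (\<forall>m0 K0. 1 \<le> m0 \<and> m0 \<le> 2 ^ greedy_par i \<and> K0 \<le> greedy_par i \<and>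
      (\<forall>K'\<in>{1..K0}. passes K' (greedy_word i) (dec (greedy_par i) m0)) \<longrightarrow> K0 \<le> k))"

lemma stage: "passes (stage i) (greedy_word i) (greedy_block i)"
  "1 \<le> m0 \<Longrightarrow> m0 \<le> 2 ^ greedy_par i \<Longrightarrow> K0 \<le> greedy_par i \<Longrightarrow> (\<And>K'. K'\<in>{1..K0} \<Longrightarrow> passes K' (greedy_word i) (dec (greedy_par i) m0)) \<Longrightarrow> K0 \<le> stage i"
  using someI_ex[OF stage_exists[of i]] unfolding stage_def[symmetric] by blast+

text \<open>For a level \<open>K0\<close> take L and D from \<open>good_extension\<close>. Once c >=
  D, c >= K0 and (c + 1)^L <= 2^c, a block that passes all levels up to \<open>K0\<close> is among
  the candidates, whatever the word is.\<close>

lemma filterlim_stage: "filterlim stage at_top sequentially"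
  unfolding filterlim_at_top
proof
  fix K0
  obtain L D where LD: "L \<ge> 1" "\<And>ws. pos_word ws \<Longrightarrow> \<exists>w. length w = L \<and> (\<forall>d\<in>set w. 0 < d \<and> d \<le> D) \<and> (\<forall>K\<in>{1..K0}. passes K ws w)"
    using good_extension[of K0] by blast
  have "\<forall>\<^sub>F c :: nat in sequentially. (real c + 1) ^ L \<le> 2 ^ c" by real_asymp
  hence ev: "\<forall>\<^sub>F c :: nat in sequentially. (c + 1) ^ L \<le> 2 ^ c"
  proof eventually_elim
    case (elim c)
    hence "real ((c + 1) ^ L) \<le> real (2 ^ c)" by (simp add: add.commute)
    thus ?case by (simp only: of_nat_le_iff)
  qed
  have "\<forall>\<^sub>F c in sequentially. (c + 1) ^ L \<le> 2 ^ c \<and> c \<ge> D \<and> c \<ge> K0"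
    using ev eventually_ge_at_top[of D] eventually_ge_at_top[of K0] by eventually_elim auto
  from eventually_compose_filterlim[OF this filterlim_par]
  show "\<forall>\<^sub>F i in sequentially. K0 \<le> stage i"
  proof eventually_elim
    case (elim i)
    obtain w where w: "length w = L" "\<forall>d\<in>set w. 0 < d \<and> d \<le> D" "\<forall>K\<in>{1..K0}. passes K (greedy_word i) w"
      using LD(2)[OF pos_wd] by blast
    have "\<forall>d\<in>set w. 0 < d \<and> d \<le> greedy_par i" using w(2) elim by auto
    then obtain m where m: "m + 1 \<le> (greedy_par i + 1) ^ L" "dec (greedy_par i) m = w"
      using dec_surj[of w "greedy_par i"] par_ge[of i] w(1) by auto
    have "m \<noteq> 0" using m(2) w(1) LD(1) by (intro notI) simp
    thus ?case using m w(3) elim by (intro stage(2)[of m]) auto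
  qed
qed

section \<open>The limit is normal\<close>

text \<open>Word number j + 1 has more than j digits because no block is empty.\<close>

definition greedy_digit :: "nat \<Rightarrow> nat" where "greedy_digit j = greedy_word (Suc j) ! j"
definition greedy_limit :: real where "greedy_limit = cf_lim greedy_digit 0"

lemma wd_prefix: "i \<le> j \<Longrightarrow> n < greedy_len i \<Longrightarrow> greedy_word j ! n = greedy_word i ! n"
proof (induction j rule: dec_induct)
  case (step j)
  have "n < length (greedy_word j)" using step len_mono[of i j] by (simp add: greedy_len_def)
  thus ?case using step by (simp add: greedy_Suc(1) nth_append)
qed simp

lemma wd_eq: "greedy_word i = map greedy_digit [0..<greedy_len i]"
proof (rule nth_equalityI)
  fix n assume n: "n < length (greedy_word i)"
  hence n': "n < greedy_len i" by (simp add: greedy_len_def)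
  have n'': "n < greedy_len (Suc n)" using len_ge[of "Suc n"] by simp
  have "greedy_word i ! n = greedy_word (Suc n) ! n"
    using wd_prefix[of i "Suc n" n] wd_prefix[of "Suc n" i n] n' n'' by (cases "i \<le> Suc n") auto
  thus "greedy_word i ! n = map greedy_digit [0..<greedy_len i] ! n" using n' by (simp add: greedy_digit_def)
qed (simp add: greedy_len_def)

lemma dig_pos: "greedy_digit j > 0"
proof -
  have "j < length (greedy_word (Suc j))" using len_ge[of "Suc j"] by (simp add: greedy_len_def)
  thus ?thesis using pos_wd[of "Suc j"] by (auto simp: greedy_digit_def pos_word_def)
qed

lemma lim_unit: "0 < cf_lim greedy_digit j" "cf_lim greedy_digit j < 1"
  using cf_lim_unit[of greedy_digit j, OF dig_pos] by auto

lemma lim_tail: "j \<le> greedy_len i \<Longrightarrow> cf_lim greedy_digit j = cf_tail (drop j (greedy_word i)) (cf_lim greedy_digit (greedy_len i))"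
  using cf_lim_tail[of greedy_digit j "greedy_len i - j", OF dig_pos] by (simp add: wd_eq drop_map)

lemma lim_iter: "(gauss_map ^^ j) greedy_limit = cf_lim greedy_digit j"
  unfolding greedy_limit_def by (rule gauss_map_iter_cf_lim[OF dig_pos])

text \<open>\<open>par_bound\<close> read backwards: the length is at least (2^c - 4)/2. Anything
  polynomial in c is thereby negligible against the length.\<close>

lemma growth:
  assumes "\<forall>\<^sub>F c :: nat in sequentially. g c \<le> \<epsilon> * ((2 ^ c - 4) / 2)"
    and "\<epsilon> > 0"
  shows "\<forall>\<^sub>F i in sequentially. g (greedy_par i) \<le> \<epsilon> * real (greedy_len i)"
  using eventually_compose_filterlim[OF assms(1) filterlim_par]
proof eventually_elim
  case (elim i)
  have "real (2 ^ greedy_par i) \<le> real (2 * greedy_len i + 4)" using par_bound by (rule of_nat_mono)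
  hence "(2 ^ greedy_par i - 4) / 2 \<le> real (greedy_len i)" by simp
  hence "\<epsilon> * ((2 ^ greedy_par i - 4) / 2) \<le> \<epsilon> * real (greedy_len i)" using assms(2) by (intro mult_left_mono) auto
  thus ?case using elim by linarith
qed

lemma cf_tail_0_less_1: "pos_word v \<Longrightarrow> length v \<ge> 2 \<Longrightarrow> cf_tail v 0 < 1"
proof -
  assume v: "pos_word v" "length v \<ge> 2"
  then obtain a b u where u: "v = a # b # u" by (metis One_nat_def Suc_1 Suc_le_length_iff)
  have "real a \<ge> 1" "real b \<ge> 1" using v u by auto
  moreover have "cf_tail u 0 \<ge> 0" by (rule cf_tail_nonneg) simp
  ultimately have "1 / (real b + cf_tail u 0) > 0" by simp
  hence "real a + 1 / (real b + cf_tail u 0) > 1" using \<open>real a \<ge> 1\<close> by linarith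
  thus ?thesis unfolding u by simp
qed

lemma pos_drop: "pos_word v \<Longrightarrow> pos_word (drop j v)"
  by (auto simp: pos_word_def dest: in_set_dropD)

lemma power_small: "\<epsilon> > 0 \<Longrightarrow> \<exists>s::nat. s \<ge> 1 \<and> 4 / 2 ^ s \<le> (\<epsilon>::real)"
proof -
  assume "\<epsilon> > 0"
  then obtain s where s: "(1/2::real) ^ s < \<epsilon> / 4" using real_arch_pow_inv[of "\<epsilon> / 4" "1/2"] by auto
  have "(1/2::real) ^ Suc s \<le> (1/2) ^ s" by (rule power_decreasing) auto
  hence "(1/2::real) ^ Suc s < \<epsilon> / 4" using s by linarith
  hence "4 / 2 ^ Suc s \<le> \<epsilon>" by (simp add: power_divide field_simps)
  thus ?thesis by (intro exI[of _ "Suc s"]) auto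
qed

lemma gauss_equidistributed: "equidistributed (\<lambda>j. gauss_coord (cf_lim greedy_digit j))"
proof (rule equidistributed_from_blocks[where M = greedy_len and K = stage and y = "\<lambda>i j. gauss_coord (cf_tail (drop j (greedy_word (Suc i))) 0)"])
  show "mono greedy_len" using len_mono by (auto simp: mono_def)
  show "\<forall>\<^sub>F i in sequentially. real (greedy_len (Suc i)) - real (greedy_len i) \<le> \<epsilon> * real (greedy_len i)" if "\<epsilon> > 0" for \<epsilon> :: real
  proof -
    have "\<forall>\<^sub>F c :: nat in sequentially. real c \<le> \<epsilon> * ((2 ^ c - 4) / 2)" using that by real_asymp
    from growth[OF this that] show ?thesis
    proof eventually_elim
      case (elim i)
      thus ?case using blk_length[of i] by (simp add: greedy_Suc(3))
    qed
  qed
  show "\<forall>\<^sub>F i in sequentially. even_cells (stage i) (\<lambda>j. gauss_coord (cf_tail (drop j (greedy_word (Suc i))) 0)) {greedy_len i..<greedy_len (Suc i)}"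
    using stage(1) by (auto simp: passes_def greedy_len_def greedy_Suc(1))
  show "0 \<le> gauss_coord (cf_tail (drop j (greedy_word (Suc i))) 0)" for i j
    using cf_tail_nonneg[of 0 "drop j (greedy_word (Suc i))"] by (simp add: gauss_coord_def)
  fix \<eta> :: real assume "\<eta> > 0"
  \<comment> \<open>s >= 1 leaves at least two digits; the single digit 1 would have value 1 and a
    coordinate that is not below 1.\<close>
  then obtain s where s: "s \<ge> 1" "4 / 2 ^ s \<le> \<eta>" using power_small by blast
  show "\<exists>s. \<forall>i j. greedy_len i \<le> j \<longrightarrow> j + s < greedy_len (Suc i) \<longrightarrow> gauss_coord (cf_tail (drop j (greedy_word (Suc i))) 0) < 1 \<and>
      (\<exists>k::int. \<bar>gauss_coord (cf_lim greedy_digit j) - gauss_coord (cf_tail (drop j (greedy_word (Suc i))) 0) - of_int k\<bar> \<le> \<eta>)"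
  proof (intro exI[of _ s] allI impI)
    fix i j assume j: "greedy_len i \<le> j" "j + s < greedy_len (Suc i)"
    let ?v = "drop j (greedy_word (Suc i))"
    have v: "pos_word ?v" "length ?v \<ge> s" "length ?v \<ge> 2" using j s pos_drop[OF pos_wd] by (auto simp: greedy_len_def)
    have "\<bar>gauss_coord (cf_tail ?v (cf_lim greedy_digit (greedy_len (Suc i)))) - gauss_coord (cf_tail ?v 0)\<bar> \<le> 4 / 2 ^ s"
      using v lim_unit[of "greedy_len (Suc i)"] by (intro gauss_close) auto
    hence "\<bar>gauss_coord (cf_lim greedy_digit j) - gauss_coord (cf_tail ?v 0) - of_int 0\<bar> \<le> \<eta>"
      using lim_tail[of j "Suc i"] j s by simp
    moreover have "gauss_coord (cf_tail ?v 0) < 1"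
      using cf_tail_0_less_1[OF v(1,3)] cf_tail_nonneg[of 0 ?v] by (simp add: gauss_coord_def)
    ultimately show "gauss_coord (cf_tail ?v 0) < 1 \<and> (\<exists>k::int. \<bar>gauss_coord (cf_lim greedy_digit j) - gauss_coord (cf_tail ?v 0) - of_int k\<bar> \<le> \<eta>)"
      by blast
  qed
qed (fact filterlim_len filterlim_stage)+

text \<open>Via \<open>b \<le> 2 ^ b\<close>; all that matters is that positions to base b grow at
  least linearly in the length.\<close>

lemma len_le_mb: "b \<ge> 2 \<Longrightarrow> greedy_len i \<le> 1 + b * digit_pos b (den (greedy_word i))"
proof -
  assume b: "b \<ge> 2"
  have "2 ^ greedy_len i \<le> 2 * (den (greedy_word i))\<^sup>2" using den_ge[OF pos_wd[of i]] by (simp add: greedy_len_def)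
  also have "\<dots> \<le> 2 * b ^ digit_pos b (den (greedy_word i))" using mb_ge[OF b] by simp
  also have "\<dots> \<le> 2 * (2 ^ b) ^ digit_pos b (den (greedy_word i))" by (simp add: power_mono less_imp_le)
  also have "\<dots> = 2 ^ (1 + b * digit_pos b (den (greedy_word i)))" by (simp add: power_mult)
  finally show ?thesis by (rule power_le_imp_le_exp[rotated]) simp
qed

text \<open>At most c digits of size at most c give a denominator of at most 2^(c^2), hence O(c^2)
  new digits to any base.\<close>

lemma mb_window: 
  assumes b: "b \<ge> 2"
  shows "digit_pos b (den (greedy_word (Suc i))) \<le> digit_pos b (den (greedy_word i)) + (3 + 2 * (greedy_par i * greedy_par i))"
proof (rule mb_le)
  have "den (greedy_block i) \<le> (greedy_par i + 1) ^ length (greedy_block i)" using blk_digits by (intro den_le pos_blk) auto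
  also have "\<dots> \<le> (greedy_par i + 1) ^ greedy_par i" by (intro power_increasing blk_length) auto
  also have "\<dots> \<le> (2 ^ greedy_par i) ^ greedy_par i"
    by (intro power_mono) (auto simp: Suc_le_eq)
  also have "\<dots> = 2 ^ (greedy_par i * greedy_par i)" by (simp add: power_mult)
  finally have q: "den (greedy_block i) \<le> 2 ^ (greedy_par i * greedy_par i)" .
  have "den (greedy_word (Suc i)) \<le> 2 * (den (greedy_word i) * den (greedy_block i))"
    unfolding greedy_Suc(1) by (intro den_append_le pos_wd pos_blk)
  hence "(den (greedy_word (Suc i)))\<^sup>2 \<le> (2 * (den (greedy_word i) * den (greedy_block i)))\<^sup>2" by (rule power_mono) simp
  also have "\<dots> = 4 * ((den (greedy_word i))\<^sup>2 * (den (greedy_block i))\<^sup>2)" by (simp add: power_mult_distrib)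
  also have "\<dots> \<le> 4 * (b ^ digit_pos b (den (greedy_word i)) * (2 ^ (greedy_par i * greedy_par i))\<^sup>2)"
    using mb_ge[OF b] power_mono[OF q, of 2] by (intro mult_le_mono) auto
  also have "\<dots> = b ^ digit_pos b (den (greedy_word i)) * 2 ^ (2 + 2 * (greedy_par i * greedy_par i))"
    by (simp add: power_add power_mult[symmetric] mult.commute)
  also have "\<dots> \<le> b ^ digit_pos b (den (greedy_word i)) * b ^ (2 + 2 * (greedy_par i * greedy_par i))"
    using b by (intro mult_le_mono power_mono) auto
  also have "\<dots> \<le> b ^ digit_pos b (den (greedy_word i)) * b ^ (3 + 2 * (greedy_par i * greedy_par i))"
    using b by (intro mult_le_mono power_increasing) auto
  finally show "(den (greedy_word (Suc i)))\<^sup>2 \<le> b ^ (digit_pos b (den (greedy_word i)) + (3 + 2 * (greedy_par i * greedy_par i)))"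
    by (simp only: power_add)
qed

lemma den_wd_mono: "i \<le> j \<Longrightarrow> den (greedy_word i) \<le> den (greedy_word j)"
proof (rule lift_Suc_mono_le[of "\<lambda>i. den (greedy_word i)"])
  fix i
  have "den (greedy_word i) * 1 \<le> den (greedy_word i) * den (greedy_block i)" using den_pos[OF pos_blk[of i]] by (intro mult_le_mono) auto
  also have "\<dots> \<le> den (greedy_word (Suc i))" unfolding greedy_Suc(1) by (rule den_append_ge)
  finally show "den (greedy_word i) \<le> den (greedy_word (Suc i))" by simp
qed

lemma base_equidistributed:
  assumes b: "b \<ge> 2"
  shows "equidistributed (\<lambda>j. frac (real b ^ j * greedy_limit))"
proof (rule equidistributed_from_blocks[where M = "\<lambda>i. digit_pos b (den (greedy_word i))" and K = stage and y = "\<lambda>i j. frac (real b ^ j * cf_tail (greedy_word (Suc i)) 0)"])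
  show "mono (\<lambda>i. digit_pos b (den (greedy_word i)))" using mb_mono[OF b den_wd_mono] by (auto simp: mono_def)
  have b0: "real b > 0" using b by simp
  have M_ge: "(real (greedy_len i) - 1) / real b \<le> real (digit_pos b (den (greedy_word i)))" for i
  proof -
    have "real (greedy_len i) \<le> real (1 + b * digit_pos b (den (greedy_word i)))" using len_le_mb[OF b] by (rule of_nat_mono)
    thus ?thesis using b0 by (simp add: divide_le_eq mult.commute)
  qed
  show "filterlim (\<lambda>i. digit_pos b (den (greedy_word i))) at_top sequentially"
    unfolding filterlim_at_top
  proof
    fix Z
    have "\<forall>\<^sub>F i in sequentially. greedy_len i \<ge> b * Z + 1" using filterlim_len by (simp add: filterlim_at_top)
    thus "\<forall>\<^sub>F i in sequentially. Z \<le> digit_pos b (den (greedy_word i))"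
    proof eventually_elim
      case (elim i)
      hence "b * Z \<le> b * digit_pos b (den (greedy_word i))" using len_le_mb[OF b, of i] by linarith
      thus ?case using b by simp
    qed
  qed
  show "\<forall>\<^sub>F i in sequentially. real (digit_pos b (den (greedy_word (Suc i)))) - real (digit_pos b (den (greedy_word i))) \<le> \<epsilon> * real (digit_pos b (den (greedy_word i)))" if "\<epsilon> > 0" for \<epsilon> :: real
  proof -
    \<comment> \<open>By \<open>M_ge\<close> the position to base b is at least about 1/b times the
      length, so the smallness has to be scaled by 1/b.\<close>
    define \<delta> where "\<delta> = \<epsilon> / real b"
    have d: "\<delta> > 0" using that b0 by (simp add: \<delta>_def)
    have "\<forall>\<^sub>F c :: nat in sequentially. 3 + 2 * (real c * real c) + \<delta> \<le> \<delta> * ((2 ^ c - 4) / 2)" using d by real_asymp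
    from growth[OF this d] show ?thesis
    proof eventually_elim
      case (elim i)
      have "real (digit_pos b (den (greedy_word (Suc i)))) \<le> real (digit_pos b (den (greedy_word i)) + (3 + 2 * (greedy_par i * greedy_par i)))"
        using mb_window[OF b] by (rule of_nat_mono)
      hence "real (digit_pos b (den (greedy_word (Suc i)))) - real (digit_pos b (den (greedy_word i))) \<le> 3 + 2 * (real (greedy_par i) * real (greedy_par i))" by simp
      also have "\<dots> \<le> \<delta> * (real (greedy_len i) - 1)" using elim by (simp add: algebra_simps)
      also have "\<dots> = \<epsilon> * ((real (greedy_len i) - 1) / real b)" by (simp add: \<delta>_def)
      also have "\<dots> \<le> \<epsilon> * real (digit_pos b (den (greedy_word i)))" using M_ge[of i] that by (intro mult_left_mono) auto
      finally show ?case .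
    qed
  qed
  have "\<forall>\<^sub>F i in sequentially. stage i \<ge> b" using filterlim_stage by (simp add: filterlim_at_top)
  thus "\<forall>\<^sub>F i in sequentially. even_cells (stage i) (\<lambda>j. frac (real b ^ j * cf_tail (greedy_word (Suc i)) 0)) {digit_pos b (den (greedy_word i))..<digit_pos b (den (greedy_word (Suc i)))}"
  proof eventually_elim
    case (elim i)
    thus ?case using stage(1)[of i] b by (auto simp: passes_def greedy_Suc(1))
  qed
  fix \<eta> :: real assume "\<eta> > 0"
  then obtain s where s: "s \<ge> 1" "4 / 2 ^ s \<le> \<eta>" using power_small by blast
  show "\<exists>s. \<forall>i j. digit_pos b (den (greedy_word i)) \<le> j \<longrightarrow> j + s < digit_pos b (den (greedy_word (Suc i))) \<longrightarrow> frac (real b ^ j * cf_tail (greedy_word (Suc i)) 0) < 1 \<and>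
      (\<exists>k::int. \<bar>frac (real b ^ j * greedy_limit) - frac (real b ^ j * cf_tail (greedy_word (Suc i)) 0) - of_int k\<bar> \<le> \<eta>)"
  proof (intro exI[of _ s] allI impI conjI frac_lt_1)
    fix i j assume j: "digit_pos b (den (greedy_word i)) \<le> j" "j + s < digit_pos b (den (greedy_word (Suc i)))"
    have "greedy_limit = cf_tail (greedy_word (Suc i)) (cf_lim greedy_digit (greedy_len (Suc i)))" unfolding greedy_limit_def using lim_tail[of 0 "Suc i"] by simp
    moreover have "\<bar>cf_tail (greedy_word (Suc i)) (cf_lim greedy_digit (greedy_len (Suc i))) - cf_tail (greedy_word (Suc i)) 0\<bar> \<le> 1 / (real (den (greedy_word (Suc i))))\<^sup>2"
      using lim_unit[of "greedy_len (Suc i)"] by (intro cf_tail_close(1) pos_wd) auto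
    ultimately have "\<bar>greedy_limit - cf_tail (greedy_word (Suc i)) 0\<bar> \<le> 1 / (real (den (greedy_word (Suc i))))\<^sup>2" by simp
    then obtain k :: int where "\<bar>frac (real b ^ j * greedy_limit) - frac (real b ^ j * cf_tail (greedy_word (Suc i)) 0) - of_int k\<bar> \<le> 1 / 2 ^ s"
      using base_close[OF _ b j(2)] by blast
    moreover have "1 / (2::real) ^ s \<le> 4 / 2 ^ s" by (simp add: divide_right_mono)
    ultimately show "\<exists>k::int. \<bar>frac (real b ^ j * greedy_limit) - frac (real b ^ j * cf_tail (greedy_word (Suc i)) 0) - of_int k\<bar> \<le> \<eta>"
      using s(2) by (intro exI[of _ k]) linarith
  qed
qed (auto simp: filterlim_stage)

section \<open>From equidistribution to both kinds of normality\<close>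

lemma base_digits:
  assumes b: "b \<ge> 2" and x: "0 \<le> x" "x < 1" and eq: "equidistributed (\<lambda>j. frac (real b ^ j * x))"
  shows "simply_normal b x"
proof -
  define a where "a j = nat \<lfloor>real b * frac (real b ^ j * x)\<rfloor>" for j
  have b0: "real b > 0" using b by simp
  have ra: "real (a j) = of_int \<lfloor>real b * frac (real b ^ j * x)\<rfloor>" for j
    unfolding a_def using b0 by simp
  have dig_eq: "a j = d \<longleftrightarrow> frac (real b ^ j * x) \<in> {real d / real b..<(real d + 1) / real b}" for j d
  proof -
    have "a j = d \<longleftrightarrow> \<lfloor>real b * frac (real b ^ j * x)\<rfloor> = int d" using b0 by (auto simp: a_def)
    thus ?thesis using b0 by (simp add: floor_eq_iff pos_divide_le_eq pos_less_divide_eq mult.commute)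
  qed
  have a_less: "a j < b" for j
  proof -
    have "real b * frac (real b ^ j * x) < real b * 1" using b0 by (intro mult_strict_left_mono frac_lt_1)
    hence "real (a j) < real b" unfolding ra by linarith
    thus ?thesis by simp
  qed
  have freq: "(\<lambda>n. real (card {i. i < n \<and> a i = d}) / real n) \<longlonglongrightarrow> 1 / real b" if d: "d < b" for d
  proof -
    have "(\<lambda>n. real (occ (\<lambda>j. frac (real b ^ j * x)) {..<n} {real d / real b..<(real d + 1) / real b}) / real n) \<longlonglongrightarrow> (real d + 1) / real b - real d / real b"
    proof (rule equidistributed_frequency[OF eq])
      show "0 \<le> frac (real b ^ j * x) \<and> frac (real b ^ j * x) \<le> 1" for j
        by (simp add: less_imp_le[OF frac_lt_1])
      show "0 \<le> real d / real b" "real d / real b \<le> (real d + 1) / real b" by (simp_all add: divide_right_mono)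
      have "real d + 1 \<le> real b" using d by simp
      thus "(real d + 1) / real b \<le> 1" using b0 by (simp add: divide_le_eq)
    qed auto
    moreover have "(real d + 1) / real b - real d / real b = 1 / real b" by (simp add: diff_divide_distrib[symmetric])
    moreover have "occ (\<lambda>j. frac (real b ^ j * x)) {..<n} {real d / real b..<(real d + 1) / real b} = card {i. i < n \<and> a i = d}" for n
      unfolding occ_def dig_eq by simp
    ultimately show ?thesis by simp
  qed
  \<comment> \<open>A tail of digits b - 1 would give the digit 0 frequency 0.\<close>
  have inf: "\<exists>\<^sub>\<infinity>i. a i < b - 1"
  proof (rule ccontr)
    assume "\<not> ?thesis"
    then obtain n0 where n0: "\<And>i. i \<ge> n0 \<Longrightarrow> \<not> a i < b - 1" by (auto simp: INFM_nat_le)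
    have all: "a i = b - 1" if "i \<ge> n0" for i using n0[OF that] a_less[of i] by linarith
    have "{i. i < n \<and> a i = 0} \<subseteq> {..<n0}" for n
    proof
      fix i assume "i \<in> {i. i < n \<and> a i = 0}"
      thus "i \<in> {..<n0}" using all[of i] b by (cases "i \<ge> n0") auto
    qed
    hence "card {i. i < n \<and> a i = 0} \<le> n0" for n
      using card_mono[of "{..<n0}" "{i. i < n \<and> a i = 0}"] by simp
    hence le: "real (card {i. i < n \<and> a i = 0}) / real n \<le> real n0 / real n" for n
      by (intro divide_right_mono) auto
    have "(\<lambda>n. real n0 / real n) \<longlonglongrightarrow> 0" by (rule lim_const_over_n)
    hence "1 / real b \<le> 0" using freq[of 0] b by (intro LIMSEQ_le[OF freq[of 0]]) (auto intro: le)
    thus False using b0 by simp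
  qed
  have part: "(\<Sum>i<n. real (a i) / real b ^ (i + 1)) = x - frac (real b ^ n * x) / real b ^ n" for n
  proof (induction n)
    case (Suc n)
    have "frac (real b * frac (real b ^ n * x)) = frac (real b ^ Suc n * x)"
      using frac_mult_frac[of b "real b ^ n * x"] by (simp add: mult.assoc)
    moreover have "v = of_int \<lfloor>v\<rfloor> + frac v" for v :: real by (simp add: frac_def)
    ultimately have "real b * frac (real b ^ n * x) = real (a n) + frac (real b ^ Suc n * x)"
      unfolding ra by metis
    hence "frac (real b ^ n * x) = (real (a n) + frac (real b ^ Suc n * x)) / real b"
      using b0 by (simp add: field_simps)
    hence "frac (real b ^ n * x) / real b ^ n = real (a n) / real b ^ (n + 1) + frac (real b ^ Suc n * x) / real b ^ Suc n"
      using b0 by (simp add: add_divide_distrib)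
    thus ?case using Suc by simp
  next
    case 0
    have "frac x = x" using x by (simp add: frac_eq)
    thus ?case by simp
  qed
  have "(\<lambda>n. x - frac (real b ^ n * x) / real b ^ n) \<longlonglongrightarrow> x - 0"
  proof (intro tendsto_diff tendsto_const)
    show "(\<lambda>n. frac (real b ^ n * x) / real b ^ n) \<longlonglongrightarrow> 0"
    proof (rule Lim_null_comparison)
      show "\<forall>\<^sub>F n in sequentially. norm (frac (real b ^ n * x) / real b ^ n) \<le> inverse (real b ^ n)"
      proof (intro always_eventually allI)
        fix n
        have "frac (real b ^ n * x) / real b ^ n \<le> 1 / real b ^ n"
          using b0 by (intro divide_right_mono less_imp_le[OF frac_lt_1]) auto
        thus "norm (frac (real b ^ n * x) / real b ^ n) \<le> inverse (real b ^ n)" using b0 by (simp add: divide_inverse)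
      qed
      show "(\<lambda>n. inverse (real b ^ n)) \<longlonglongrightarrow> 0" using b by (intro LIMSEQ_inverse_realpow_zero) auto
    qed
  qed
  hence "(\<lambda>i. real (a i) / real b ^ (i + 1)) sums x" unfolding sums_def part by simp
  thus ?thesis unfolding simply_normal_def base_expansion_def using a_less inf freq by blast
qed

text \<open>Each digit acts by a decreasing map, which swaps the endpoints. Explicit endpoints are
  not wanted: \<open>gauss_measure_interval\<close> expresses the measure of any such interval by
  \<open>gauss_coord\<close>.\<close>

lemma cf_interval_eq:
  assumes "pos_word v"
  shows "\<exists>l r. 0 \<le> l \<and> l \<le> r \<and> r \<le> 1 \<and> cf_interval v = {l<..<r}"
  using assms
proof (induction v)
  case Nil
  have "cf_interval [] = {0<..<1}" by (simp add: cf_interval_def)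
  thus ?case by (intro exI[of _ 0] exI[of _ 1]) auto
next
  case (Cons a v)
  then obtain l r where lr: "0 \<le> l" "l \<le> r" "r \<le> 1" "cf_interval v = {l<..<r}" by auto
  have a: "real a \<ge> 1" using Cons.prems by auto
  have "cf_interval (a # v) = (\<lambda>s. 1 / (real a + s)) ` cf_interval v"
    unfolding cf_interval_def by (simp add: image_image)
  also have "\<dots> = {1 / (real a + r)<..<1 / (real a + l)}"
    unfolding lr(4)
  proof (intro set_eqI iffI)
    fix y assume "y \<in> (\<lambda>s. 1 / (real a + s)) ` {l<..<r}"
    then obtain s where s: "l < s" "s < r" "y = 1 / (real a + s)" by auto
    have "real a + s > 0" "real a + l > 0" "real a + r > 0" using s a lr by auto
    thus "y \<in> {1 / (real a + r)<..<1 / (real a + l)}"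
      using s by (auto intro!: divide_strict_left_mono mult_pos_pos)
  next
    fix y assume y: "y \<in> {1 / (real a + r)<..<1 / (real a + l)}"
    have p: "real a + l > 0" "real a + r > 0" using a lr by auto
    have "0 < 1 / (real a + r)" using p by simp
    hence y0: "y > 0" using y unfolding greaterThanLessThan_iff by linarith
    have "y * (real a + l) < 1" "1 < y * (real a + r)"
      using y p by (auto simp: pos_less_divide_eq pos_divide_less_eq)
    hence "real a + l < 1 / y" "1 / y < real a + r" using y0 by (auto simp: pos_less_divide_eq pos_divide_less_eq mult.commute)
    thus "y \<in> (\<lambda>s. 1 / (real a + s)) ` {l<..<r}"
      using y0 by (intro image_eqI[of _ _ "1 / y - real a"]) auto
  qed
  finally have eq: "cf_interval (a # v) = {1 / (real a + r)<..<1 / (real a + l)}" .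
  have "0 \<le> 1 / (real a + r)" "1 / (real a + l) \<le> 1" "1 / (real a + r) \<le> 1 / (real a + l)"
    using a lr by (auto intro!: divide_left_mono)
  thus ?case using eq by blast
qed

lemma gauss_measure_interval:
  assumes "0 \<le> l" "l \<le> r" "r \<le> 1"
  shows "measure gauss_measure {l<..<r} = gauss_coord r - gauss_coord l"
proof -
  have "emeasure gauss_measure {l<..<r} = (\<integral>\<^sup>+x. ennreal (indicator {0<..<1} x / ((1 + x) * ln 2)) * indicator {l<..<r} x \<partial>lborel)"
    unfolding gauss_measure_def by (rule emeasure_density) auto
  also have "\<dots> = (\<integral>\<^sup>+x. ennreal (gauss_dens x * indicator {l..r} x) \<partial>lborel)"
  proof (rule nn_integral_cong_AE)
    have "AE x in lborel. (x::real) \<notin> {l, r}" by (intro AE_not_in countable_imp_null_set_lborel) auto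
    thus "AE x in lborel. ennreal (indicat_real U x / ((1 + x) * ln 2)) * indicator {l<..<r} x = ennreal (gauss_dens x * indicator {l..r} x)"
      by eventually_elim (use assms in \<open>auto simp: indicator_def gauss_dens_def\<close>)
  qed
  also have "\<dots> = ennreal (gauss_coord r - gauss_coord l)"
  proof (rule nn_integral_eq_integral[THEN trans])
    have hb: "has_bochner_integral lborel (\<lambda>x. gauss_dens x * indicator {l..r} x) (gauss_coord r - gauss_coord l)"
      by (rule gauss_dens_integral) (use assms in auto)
    show "integrable lborel (\<lambda>x. gauss_dens x * indicator {l..r} x)" using hb by (simp add: has_bochner_integral_iff)
    show "ennreal (integral\<^sup>L lborel (\<lambda>x. gauss_dens x * indicator {l..r} x)) = ennreal (gauss_coord r - gauss_coord l)"
      using hb by (simp add: has_bochner_integral_iff)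
    show "AE x in lborel. 0 \<le> gauss_dens x * indicator {l..r} x"
      using assms by (auto simp: gauss_dens_def indicator_def)
  qed
  finally have "emeasure gauss_measure {l<..<r} = ennreal (gauss_coord r - gauss_coord l)" .
  moreover have "gauss_coord l \<le> gauss_coord r" using assms by (simp add: gauss_coord_def)
  ultimately show ?thesis by (simp add: measure_def)
qed

text \<open>\<open>gauss_coord\<close> is strictly increasing, so a visit of the Gauss orbit to
  \<open>cf_interval v\<close> is a visit of its coordinate to an interval whose length is the Gauss
  measure.\<close>

lemma cf_normal_lim: "cf_normal greedy_limit"
  unfolding cf_normal_def
proof (intro allI impI)
  fix v :: "nat list" assume "v \<noteq> [] \<and> (\<forall>d\<in>set v. d > 0)"
  hence "pos_word v" by (simp add: pos_word_def)
  then obtain l r where lr: "0 \<le> l" "l \<le> r" "r \<le> 1" "cf_interval v = {l<..<r}" using cf_interval_eq by blast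
  have mono: "gauss_coord x < gauss_coord y \<longleftrightarrow> x < y" if "0 \<le> x" "0 \<le> y" for x y
    using that by (simp add: gauss_coord_def)
  have g1: "gauss_coord r \<le> 1" "0 \<le> gauss_coord l" "gauss_coord l \<le> gauss_coord r"
    using lr by (auto simp: gauss_coord_def)
  have lim: "(\<lambda>n. real (occ (\<lambda>j. gauss_coord (cf_lim greedy_digit j)) {..<n} {gauss_coord l<..<gauss_coord r}) / real n) \<longlonglongrightarrow> gauss_coord r - gauss_coord l"
  proof (rule equidistributed_frequency[OF gauss_equidistributed])
    show "0 \<le> gauss_coord (cf_lim greedy_digit j) \<and> gauss_coord (cf_lim greedy_digit j) \<le> 1" for j
      using gauss_coord_unit[OF lim_unit[of j]] by simp
  qed (use g1 in auto)
  have "real (occ (\<lambda>j. gauss_coord (cf_lim greedy_digit j)) {..<n} {gauss_coord l<..<gauss_coord r}) = (\<Sum>j<n. indicator (cf_interval v) ((gauss_map ^^ j) greedy_limit))" for n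
  proof -
    have "gauss_coord (cf_lim greedy_digit j) \<in> {gauss_coord l<..<gauss_coord r} \<longleftrightarrow> cf_lim greedy_digit j \<in> cf_interval v" for j
      using mono[of l "cf_lim greedy_digit j"] mono[of "cf_lim greedy_digit j" r] lr lim_unit[of j] by auto
    thus ?thesis unfolding lim_iter by (subst occ_sum) (auto simp: indicator_def)
  qed
  thus "(\<lambda>n. (\<Sum>j<n. indicator (cf_interval v) ((gauss_map ^^ j) greedy_limit)) / real n) \<longlonglongrightarrow> measure gauss_measure (cf_interval v)"
    using lim gauss_measure_interval[OF lr(1-3)] lr(4) by simp
qed

lemma absolutely_normal_lim: "absolutely_normal greedy_limit"
  unfolding absolutely_normal_def
proof (intro allI impI)
  fix b :: nat assume "b \<ge> 2"
  thus "simply_normal b greedy_limit" using lim_unit[of 0] base_equidistributed unfolding greedy_limit_def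
    by (intro base_digits) (auto simp: less_imp_le)
qed

lemma cf_expansion_lim: "cf_expansion greedy_digit greedy_limit"
  using cf_lim[of greedy_digit 0, OF dig_pos] dig_pos by (simp add: cf_expansion_def greedy_limit_def)

section \<open>Weakest preconditions with running time\<close>

text \<open>Existence of a run, so termination is included. The number of operations is an argument
  of the postcondition; \<open>W_Seq\<close> adds the costs up.\<close>

definition W :: "com \<Rightarrow> (nat \<Rightarrow> state \<Rightarrow> bool) \<Rightarrow> state \<Rightarrow> bool" where
  "W P Q s \<longleftrightarrow> (\<exists>t s'. exec P s t s' \<and> Q t s')"

lemma W_Skip: "W Skip Q s \<longleftrightarrow> Q 0 s"
  unfolding W_def by (auto elim!: SkipE intro: exec.intros)

lemma W_Assign: "W (Assign y e e') Q s \<longleftrightarrow> Q (acost e + acost e' + 1) (s(y := (s y)(aval e s := aval e' s)))"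
  unfolding W_def by (rule iffI) (elim exE conjE AssignE, simp, blast intro: exec.Assign)

lemma W_Seq: "W (Seq A B) Q s \<longleftrightarrow> W A (\<lambda>t s'. W B (\<lambda>t'. Q (t + t')) s') s"
  unfolding W_def by (auto elim!: SeqE intro: exec.intros)

lemma W_Cond: "W (Cond c A B) Q s \<longleftrightarrow>
    (if bval c s then W A (\<lambda>t. Q (bcost c + t)) s else W B (\<lambda>t. Q (bcost c + t)) s)"
  unfolding W_def by (auto elim!: CondE intro: exec.intros)

lemmas W_simps = W_Skip W_Assign W_Seq W_Cond

lemma W_mono: "W A Q s \<Longrightarrow> (\<And>t s'. Q t s' \<Longrightarrow> Q' t s') \<Longrightarrow> W A Q' s"
  unfolding W_def by blast

text \<open>\<open>f\<close> bounds the number of iterations, since each one lowers it. The last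
  summand \<open>bcost c\<close> pays for the final, failing test.\<close>

lemma W_While:
  assumes body: "\<And>s. I s \<Longrightarrow> bval c s \<Longrightarrow> W A (\<lambda>t s'. t \<le> k \<and> I s' \<and> f s' < f s) s"
    and "I s" and post: "\<And>t s'. I s' \<Longrightarrow> \<not> bval c s' \<Longrightarrow> t \<le> f s * (k + bcost c) + bcost c \<Longrightarrow> Q t s'"
  shows "W (While c A) Q s"
proof -
  have "\<exists>t s'. exec (While c A) s t s' \<and> I s' \<and> \<not> bval c s' \<and> t \<le> f s * (k + bcost c) + bcost c"
    using \<open>I s\<close>
  proof (induction "f s" arbitrary: s rule: less_induct)
    case less
    show ?case
    proof (cases "bval c s")
      case True
      obtain t s' where 1: "exec A s t s'" "t \<le> k" "I s'" "f s' < f s"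
        using body[OF less.prems True] unfolding W_def by blast
      obtain t' s'' where 2: "exec (While c A) s' t' s''" "I s''" "\<not> bval c s''" "t' \<le> f s' * (k + bcost c) + bcost c"
        using less.hyps[OF 1(4,3)] by blast
      have "exec (While c A) s (bcost c + t + t') s''" using True 1(1) 2(1) by (rule exec.WhileTrue)
      moreover have "Suc (f s') * (k + bcost c) \<le> f s * (k + bcost c)" using 1(4) by (intro mult_le_mono1) simp
      hence "bcost c + t + t' \<le> f s * (k + bcost c) + bcost c" using 1(2) 2(4) by simp
      ultimately show ?thesis using 2 by blast
    next
      case False
      thus ?thesis using less.prems exec.WhileFalse by fastforce
    qed
  qed
  thus ?thesis unfolding W_def using post by blast
qed

definition frame :: "string set \<Rightarrow> state \<Rightarrow> state \<Rightarrow> bool" where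
  "frame A s s' \<longleftrightarrow> (\<forall>y. y \<notin> A \<longrightarrow> s' y = s y)"

lemma frame_refl: "frame A s s"
  by (simp add: frame_def)

lemma frame_trans: "frame A s s' \<Longrightarrow> frame B s' s'' \<Longrightarrow> A \<subseteq> C \<Longrightarrow> B \<subseteq> C \<Longrightarrow> frame C s s''"
  unfolding frame_def by (metis subsetD)

lemma frameD: "frame A s s' \<Longrightarrow> y \<notin> A \<Longrightarrow> s' y = s y"
  by (simp add: frame_def)

lemma frame_upd: "frame A s s' \<Longrightarrow> y \<in> A \<Longrightarrow> frame A s (s'(y := g))"
  by (auto simp: frame_def)

section \<open>The program\<close>

abbreviation V :: "string \<Rightarrow> aexp" where "V y \<equiv> Get y (Const 0)"
abbreviation setv :: "string \<Rightarrow> aexp \<Rightarrow> com" where "setv y e \<equiv> Assign y (Const 0) e"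
abbreviation seq2 :: "com \<Rightarrow> com \<Rightarrow> com" (infixr ";;" 60) where "A ;; B \<equiv> Seq A B"

text \<open>
  The digits found so far are \<open>out[0], \<dots>, out[N - 1]\<close>, with denominator \<open>Q\<close>; a candidate block is
  written behind them up to position \<open>e\<close>. In a test at level \<open>K\<close>, \<open>C[o + a]\<close> counts the visits to cell
  \<open>a\<close>, \<open>x\<close> is the largest of these counts and \<open>l\<close> their sum. Afterwards \<open>o\<close> moves on to cells that are still
  0, so that the counters need not be cleared. The flag \<open>g\<close> records whether all tests were passed,
  \<open>r\<close> is the best candidate, and \<open>X = 2\<^sup>c\<close>.
\<close>

definition decode_prog :: com where "decode_prog =
  setv ''e'' (V ''N'') ;;
  While (Less (Const 0) (V ''k''))
   (setv ''k'' (Sub (V ''k'') (Const 1)) ;;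
    setv ''t'' (Div (V ''k'') (V ''c'')) ;;
    Assign ''out'' (V ''e'') (Add (Sub (V ''k'') (Mul (V ''c'') (V ''t''))) (Const 1)) ;;
    setv ''e'' (Add (V ''e'') (Const 1)) ;;
    setv ''k'' (V ''t''))"

text \<open>In continuation form, like all correctness lemmas for parts of the program: what is
  known of the final state appears as premises of \<open>post\<close>, so that the lemmas chain by
  \<open>rule\<close>. The constants in the time bounds are generous.\<close>

lemma decode_correct:
  fixes c m L :: nat
  assumes s: "s ''N'' 0 = int L" "s ''k'' 0 = int m" "s ''c'' 0 = int c" and c: "c > 0"
    and post: "\<And>t s'. t \<le> 50 * (length (dec c m) + 1) \<Longrightarrow> s' ''e'' 0 = int (L + length (dec c m)) \<Longrightarrow>
      (\<And>i. i < length (dec c m) \<Longrightarrow> s' ''out'' (int (L + i)) = int (dec c m ! i)) \<Longrightarrow>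
      (\<And>i. i < int L \<Longrightarrow> s' ''out'' i = s ''out'' i) \<Longrightarrow>
      frame {''e'', ''k'', ''t'', ''out''} s s' \<Longrightarrow> Q t s'"
  shows "W decode_prog Q s"
proof -
  \<comment> \<open>\<open>us\<close> is the part already written, \<open>m'\<close> the index of
    the part still to be decoded.\<close>
  define I where "I s' \<longleftrightarrow> (\<exists>us m'. dec c m = us @ dec c m' \<and> s' ''k'' 0 = int m' \<and> s' ''e'' 0 = int (L + length us) \<and>
      (\<forall>i<length us. s' ''out'' (int (L + i)) = int (us ! i)) \<and> (\<forall>i<int L. s' ''out'' i = s ''out'' i) \<and>
      frame {''e'', ''k'', ''t'', ''out''} s s')" for s'
  define f where "f s' = length (dec c (nat (s' ''k'' 0)))" for s' :: state
  show ?thesis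
    unfolding decode_prog_def W_simps
  proof (rule W_While[where I = I and f = f and k = 38])
    show "I (s(''e'' := (s ''e'')(aval (Const 0) s := aval (V ''N'') s)))"
      unfolding I_def by (intro exI[of _ "[]"] exI[of _ m]) (auto simp: s frame_def)
  next
    fix s1 assume "I s1" and b: "bval (Less (Const 0) (V ''k'')) s1"
    then obtain us m' where I: "dec c m = us @ dec c m'" "s1 ''k'' 0 = int m'" "s1 ''e'' 0 = int (L + length us)"
      "\<forall>i<length us. s1 ''out'' (int (L + i)) = int (us ! i)" "\<forall>i<int L. s1 ''out'' i = s ''out'' i"
      "frame {''e'', ''k'', ''t'', ''out''} s s1" unfolding I_def by blast
    have m': "m' > 0" using b I by simp
    have k: "int m' - 1 = int (m' - 1)" using m' by simp
    have c1: "s1 ''c'' 0 = int c" using frameD[OF I(6), of "''c''"] s(3) by simp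
    have d: "dec c m' = Suc ((m' - 1) mod c) # dec c ((m' - 1) div c)" using m' by (rule dec_pos)
    have md: "int (m' - 1) - int c * (int (m' - 1) div int c) + 1 = int (Suc ((m' - 1) mod c))"
      by (simp add: minus_mult_div_eq_mod zmod_int)
    let ?us = "us @ [Suc ((m' - 1) mod c)]"
    show "W (setv ''k'' (Sub (V ''k'') (Const 1)) ;; setv ''t'' (Div (V ''k'') (V ''c'')) ;;
        Assign ''out'' (V ''e'') (Add (Sub (V ''k'') (Mul (V ''c'') (V ''t''))) (Const 1)) ;;
        setv ''e'' (Add (V ''e'') (Const 1)) ;; setv ''k'' (V ''t'')) (\<lambda>t s'. t \<le> 38 \<and> I s' \<and> f s' < f s1) s1"
      apply (simp add: W_simps I(2,3) k c1)
      unfolding I_def f_def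
      apply (intro conjI)
       apply (rule exI[of _ ?us], rule exI[of _ "(m' - 1) div c"])
      subgoal
        using I d md by (auto simp: nth_append less_Suc_eq frame_def zdiv_int)
      subgoal 
        using I d md by (simp add: zdiv_int nat_div_distrib)
      done
  next
    fix t s' assume "I s'" "\<not> bval (Less (Const 0) (V ''k'')) s'" and t: "t \<le> f (s(''e'' := (s ''e'')(aval (Const 0) s := aval (V ''N'') s))) * (38 + bcost (Less (Const 0) (V ''k''))) + bcost (Less (Const 0) (V ''k''))"
    then obtain us where I: "dec c m = us" "s' ''e'' 0 = int (L + length us)"
      "\<forall>i<length us. s' ''out'' (int (L + i)) = int (us ! i)" "\<forall>i<int L. s' ''out'' i = s ''out'' i"
      "frame {''e'', ''k'', ''t'', ''out''} s s'" unfolding I_def by auto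
    show "Q (acost (Const 0) + acost (V ''N'') + 1 + t) s'"
      using t I s by (intro post) (auto simp: f_def)
  qed
qed


text \<open>Quantified over all naturals \<open>a\<close>: cells without visits must hold 0. The
  last clause prevents \<open>x\<close> from exceeding the true maximum, so the single comparison in
  \<open>check_prog\<close> is equivalent to the condition on all cells.\<close>

definition tally :: "nat \<Rightarrow> (nat \<Rightarrow> real) \<Rightarrow> nat set \<Rightarrow> state \<Rightarrow> bool" where
  "tally K z S s \<longleftrightarrow> (\<forall>a::nat. s ''C'' (s ''o'' 0 + int a) = int (occ z S (cell K a))) \<and> s ''l'' 0 = int (card S) \<and>
     (\<forall>a. int (occ z S (cell K a)) \<le> s ''x'' 0) \<and> (s ''x'' 0 = 0 \<or> (\<exists>a. s ''x'' 0 = int (occ z S (cell K a))))"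

lemma tally_frame: "tally K z S s \<Longrightarrow> frame A s s' \<Longrightarrow> A \<inter> {''C'', ''o'', ''l'', ''x''} = {} \<Longrightarrow> tally K z S s'"
  unfolding tally_def frame_def by auto

lemma occ_insert:
  assumes "finite S" "j \<notin> S"
  shows "occ z (insert j S) A = (if z j \<in> A then Suc (occ z S A) else occ z S A)"
proof -
  have "{i \<in> insert j S. z i \<in> A} = (if z j \<in> A then insert j {i\<in>S. z i \<in> A} else {i\<in>S. z i \<in> A})" by auto
  thus ?thesis using assms by (simp add: occ_def)
qed

definition bump_prog :: com where "bump_prog =
  Assign ''C'' (Add (V ''o'') (V ''a'')) (Add (Get ''C'' (Add (V ''o'') (V ''a''))) (Const 1)) ;;
  Cond (Less (V ''x'') (Get ''C'' (Add (V ''o'') (V ''a'')))) (setv ''x'' (Get ''C'' (Add (V ''o'') (V ''a'')))) Skip ;;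
  setv ''l'' (Add (V ''l'') (Const 1))"

lemma bump_correct:
  assumes s: "tally K z S s" "s ''a'' 0 = int a" and S: "finite S" "j \<notin> S" "z j \<in> cell K a"
    and post: "\<And>t s'. t \<le> 60 \<Longrightarrow> tally K z (insert j S) s' \<Longrightarrow> frame {''C'', ''x'', ''l''} s s' \<Longrightarrow> Q t s'"
  shows "W bump_prog Q s"
proof -
  have cell: "z j \<in> cell K a' \<longleftrightarrow> a' = a" for a' using S(3) by (auto simp: cell_def)
  have occ: "occ z (insert j S) (cell K a') = (if a' = a then Suc (occ z S (cell K a')) else occ z S (cell K a'))" for a'
    using occ_insert[OF S(1,2), of z] cell by simp
  note T = s(1)[unfolded tally_def]
  have C: "s ''C'' (s ''o'' 0 + int a) = int (occ z S (cell K a))" using T by blast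
  have card: "card (insert j S) = Suc (card S)" using S by simp
  have ex: "P a \<Longrightarrow> \<exists>a. P a" for P :: "nat \<Rightarrow> bool" by blast
  have le: "\<And>a'. int (occ z S (cell K a')) \<le> s ''x'' 0" using T by blast
  show ?thesis
  proof (cases "s ''x'' 0 < int (occ z S (cell K a)) + 1")
    case True
    hence xa: "s ''x'' 0 = int (occ z S (cell K a))" using le[of a] by simp
    have c: "s ''x'' 0 < int (occ z S (cell K a)) + 1" "s ''x'' 0 \<le> int (occ z S (cell K a))" using True by auto
    show ?thesis
      unfolding bump_prog_def
      apply (simp add: W_simps s(2) C c)
      apply (rule post)
        apply simp
       apply (simp add: tally_def occ card T)
       apply (intro conjI allI impI)
      subgoal for a' using le[of a'] xa by simp
      subgoal by (rule exI[of _ a]) simp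
      apply (simp add: frame_def)
      done
  next
    case False
    have "\<exists>a'. s ''x'' 0 = int (occ z (insert j S) (cell K a'))"
    proof -
      have "s ''x'' 0 \<noteq> 0" using False by linarith
      then obtain a' where a': "s ''x'' 0 = int (occ z S (cell K a'))" using T by blast
      hence "a' \<noteq> a" using False by auto
      thus ?thesis using a' by (intro exI[of _ a']) (simp add: occ)
    qed
    have c: "\<not> s ''x'' 0 < int (occ z S (cell K a)) + 1" "\<not> s ''x'' 0 \<le> int (occ z S (cell K a))" using False by auto
    have ex: "s ''x'' 0 = 0 \<or> (\<exists>a'. s ''x'' 0 = int (occ z (insert j S) (cell K a')))" using \<open>\<exists>a'. _\<close> by blast
    show ?thesis
      unfolding bump_prog_def
      apply (simp add: W_simps s(2) C c)
      apply (rule post)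
        apply simp
      subgoal using ex False le T by (simp add: tally_def occ card)
      apply (simp add: frame_def)
      done
  qed
qed

definition cell_prog :: com where "cell_prog =
  setv ''Y'' (Const 1) ;; setv ''Z'' (Const 1) ;; setv ''j'' (Const 0) ;;
  While (Less (V ''j'') (V ''K''))
   (setv ''Y'' (Mul (V ''Y'') (Add (V ''u'') (V ''v''))) ;; setv ''Z'' (Mul (V ''Z'') (V ''v'')) ;;
    setv ''j'' (Add (V ''j'') (Const 1))) ;;
  setv ''a'' (Const 0) ;;
  While (Neg (Less (V ''Y'') (Add (V ''Z'') (V ''Z''))))
   (setv ''Z'' (Add (V ''Z'') (V ''Z'')) ;; setv ''a'' (Add (V ''a'') (Const 1)))"

text \<open>K times the coordinate of p/q is the binary logarithm of ((p + q)/q)^K; its integer part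
  is found by comparing integers, without logarithms.\<close>

lemma gauss_cell:
  fixes p q K a :: nat
  assumes q: "q > 0" and lo: "q ^ K * 2 ^ a \<le> (p + q) ^ K" and hi: "(p + q) ^ K < 2 * (q ^ K * 2 ^ a)"
  shows "gauss_coord (real p / real q) \<in> cell K a"
proof -
  define x where "x = 1 + real p / real q"
  have x: "x = real (p + q) / real q" "x > 0" using q by (auto simp: x_def field_simps add_pos_nonneg)
  have xK: "x ^ K = real ((p + q) ^ K) / real (q ^ K)" by (simp add: x power_divide)
  have qK: "real (q ^ K) > 0" using q by simp
  have "real (q ^ K * 2 ^ a) \<le> real ((p + q) ^ K)" using lo by (rule of_nat_mono)
  hence l: "2 ^ a \<le> x ^ K" unfolding xK using qK by (simp add: le_divide_eq mult.commute)
  have "real ((p + q) ^ K) < real (2 * (q ^ K * 2 ^ a))" using hi by (simp only: of_nat_less_iff)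
  hence h: "x ^ K < 2 ^ (a + 1)" unfolding xK using qK by (simp add: divide_less_eq mult_ac)
  have lg: "real K * gauss_coord (real p / real q) = log 2 (x ^ K)"
    using x by (simp add: gauss_coord_def log_nat_power x_def)
  have "log 2 (2 ^ a) \<le> log 2 (x ^ K)" using l x by (subst log_le_cancel_iff) auto
  moreover have "log 2 (x ^ K) < log 2 (2 ^ (a + 1))" using h x by (subst log_less_cancel_iff) auto
  ultimately have "real a \<le> log 2 (x ^ K)" "log 2 (x ^ K) < real a + 1"
    by (simp_all add: log_nat_power del: power_Suc)
  thus ?thesis by (simp add: cell_def lg floor_eq_iff)
qed

lemma cell_correct:
  fixes p q K :: nat
  assumes s: "s ''u'' 0 = int p" "s ''v'' 0 = int q" "s ''K'' 0 = int K" and pq: "p \<le> q" "q > 0"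
    and post: "\<And>t s' a. t \<le> 80 * (K + 1) \<Longrightarrow> s' ''a'' 0 = int a \<Longrightarrow> gauss_coord (real p / real q) \<in> cell K a \<Longrightarrow>
       frame {''Y'', ''Z'', ''j'', ''a''} s s' \<Longrightarrow> Q t s'"
  shows "W cell_prog Q s"
proof -
  define F where "F = {''Y'', ''Z'', ''j'', ''a''}"
  define I where "I s' \<longleftrightarrow> (\<exists>j\<le>K. s' ''j'' 0 = int j \<and> s' ''Y'' 0 = int ((p + q) ^ j) \<and> s' ''Z'' 0 = int (q ^ j) \<and> frame F s s')" for s'
  define f where "f s' = K - nat (s' ''j'' 0)" for s' :: state
  define J where "J s' \<longleftrightarrow> (\<exists>a. s' ''a'' 0 = int a \<and> s' ''Y'' 0 = int ((p + q) ^ K) \<and> s' ''Z'' 0 = int (q ^ K * 2 ^ a) \<and> 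
     q ^ K * 2 ^ a \<le> (p + q) ^ K \<and> frame F s s')" for s'
  define g where "g s' = K - nat (s' ''a'' 0)" for s' :: state
  show ?thesis
    unfolding cell_prog_def W_simps
  proof (rule W_While[where I = I and f = f and k = 24], goal_cases)
    case (1 s1)
    then obtain j where I: "j \<le> K" "s1 ''j'' 0 = int j" "s1 ''Y'' 0 = int ((p + q) ^ j)" "s1 ''Z'' 0 = int (q ^ j)" "frame F s s1"
      unfolding I_def by blast
    have v: "s1 ''u'' 0 = int p" "s1 ''v'' 0 = int q" "s1 ''K'' 0 = int K" using I(5) s by (auto simp: frame_def F_def)
    have jK: "j < K" using 1(2) I v by simp
    show ?case
      apply (simp add: W_simps I(2-4) v)
      unfolding I_def f_def
      apply (intro conjI)
       apply (rule exI[of _ "Suc j"])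
      subgoal using jK I(5) by (simp add: frame_def F_def)
      subgoal using jK I(2) by simp
      done
  next
    case 2
    show ?case unfolding I_def by (intro exI[of _ 0]) (simp add: frame_def F_def)
  next
    case (3 t1 s1)
    then obtain j where I: "j \<le> K" "s1 ''j'' 0 = int j" "s1 ''Y'' 0 = int ((p + q) ^ j)" "s1 ''Z'' 0 = int (q ^ j)" "frame F s s1"
      unfolding I_def by blast
    have v: "s1 ''u'' 0 = int p" "s1 ''v'' 0 = int q" "s1 ''K'' 0 = int K" using I(5) s by (auto simp: frame_def F_def)
    have jK: "j = K" using 3(2) I v by simp
    have t1: "t1 \<le> K * 29 + 5" using 3(3) by (simp add: f_def)
    show ?case
    proof (rule W_While[where I = J and f = g and k = 16], goal_cases)
      case (1 s2)
      then obtain a where J: "s2 ''a'' 0 = int a" "s2 ''Y'' 0 = int ((p + q) ^ K)" "s2 ''Z'' 0 = int (q ^ K * 2 ^ a)"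
         "q ^ K * 2 ^ a \<le> (p + q) ^ K" "frame F s s2" unfolding J_def by blast
      have "\<not> int ((p + q) ^ K) < int (q ^ K * 2 ^ a) + int (q ^ K * 2 ^ a)" using 1(2) J(2,3) by simp
      hence le: "q ^ K * 2 ^ Suc a \<le> (p + q) ^ K" by (simp flip: of_nat_add of_nat_mult of_nat_power)
      \<comment> \<open>As p <= q, the cell number never exceeds K; this bounds the second
        loop.\<close>
      also have "\<dots> \<le> (2 * q) ^ K" using pq by (intro power_mono) auto
      also have "\<dots> = q ^ K * 2 ^ K" by (simp add: power_mult_distrib)
      finally have "2 ^ Suc a \<le> (2::nat) ^ K" using pq by simp
      hence aK: "Suc a \<le> K" by (rule power_le_imp_le_exp[rotated]) simp
      show ?case
        apply (simp add: W_simps J(1-3))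
        unfolding J_def g_def
        apply (intro conjI)
         apply (rule exI[of _ "Suc a"])
        subgoal using le J(2,5) by (simp add: frame_def F_def)
        subgoal using aK J(1) by simp
        done
    next
      case 2
      show ?case unfolding J_def using I jK pq by (intro exI[of _ 0]) (simp add: frame_def F_def power_mono)
    next
      case (3 t2 s2)
      then obtain a where J: "s2 ''a'' 0 = int a" "s2 ''Y'' 0 = int ((p + q) ^ K)" "s2 ''Z'' 0 = int (q ^ K * 2 ^ a)"
         "q ^ K * 2 ^ a \<le> (p + q) ^ K" "frame F s s2" unfolding J_def by blast
      have "int ((p + q) ^ K) < int (q ^ K * 2 ^ a) + int (q ^ K * 2 ^ a)" using 3(2) J(2,3) by simp
      hence hi: "(p + q) ^ K < 2 * (q ^ K * 2 ^ a)" by (simp flip: of_nat_add of_nat_mult of_nat_power)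
      have t2: "t2 \<le> K * 26 + 10" using 3(3) by (simp add: g_def)
      show ?case
      proof (rule post)
        show "gauss_coord (real p / real q) \<in> cell K a" by (rule gauss_cell[OF pq(2) J(4) hi])
        show "frame {''Y'', ''Z'', ''j'', ''a''} s s2" using J(5) by (simp add: F_def)
      qed (use t1 t2 J(1) in auto)
    qed
  qed
qed


section \<open>Evaluating the word and counting visits\<close>

definition init_prog :: com where "init_prog =
  setv ''i'' (V ''e'') ;; setv ''u'' (Const 0) ;; setv ''v'' (Const 1)"

text \<open>One step of evaluation from the right. It runs through the suffixes
  \<open>drop i v\<close>, whose values are just the Gauss orbit points that the test needs, at
  constant cost per point.\<close>

definition back_prog :: com where "back_prog =
  setv ''i'' (Sub (V ''i'') (Const 1)) ;; setv ''t'' (V ''u'') ;; setv ''u'' (V ''v'') ;;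
  setv ''v'' (Add (Mul (Get ''out'' (V ''i'')) (V ''v'')) (V ''t''))"

definition holds :: "nat list \<Rightarrow> state \<Rightarrow> bool" where
  "holds v s \<longleftrightarrow> s ''e'' 0 = int (length v) \<and> (\<forall>i<length v. s ''out'' (int i) = int (v ! i))"

lemma holds_frame: "holds v s \<Longrightarrow> frame A s s' \<Longrightarrow> A \<inter> {''e'', ''out''} = {} \<Longrightarrow> holds v s'"
  unfolding holds_def frame_def by auto

definition cvg_state :: "nat list \<Rightarrow> nat \<Rightarrow> state \<Rightarrow> bool" where
  "cvg_state v i s \<longleftrightarrow> s ''i'' 0 = int i \<and> s ''u'' 0 = int (num (drop i v)) \<and> s ''v'' 0 = int (den (drop i v))"

lemma init_correct:
  assumes "holds v s" and post: "\<And>t s'. t \<le> 20 \<Longrightarrow> cvg_state v (length v) s' \<Longrightarrow> frame {''i'', ''u'', ''v''} s s' \<Longrightarrow> Q t s'"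
  shows "W init_prog Q s"
  unfolding init_prog_def
  apply (simp add: W_simps)
  apply (rule post)
    apply simp
  using assms(1) by (auto simp: cvg_state_def holds_def frame_def)

lemma back_correct:
  assumes h: "holds v s" and c: "cvg_state v (Suc i) s" and i: "i < length v"
    and post: "\<And>t s'. t \<le> 40 \<Longrightarrow> cvg_state v i s' \<Longrightarrow> frame {''i'', ''u'', ''v'', ''t''} s s' \<Longrightarrow> Q t s'"
  shows "W back_prog Q s"
proof -
  have d: "drop i v = v ! i # drop (Suc i) v" using i by (simp add: Cons_nth_drop_Suc)
  have o: "s ''out'' (int i) = int (v ! i)" using h i by (simp add: holds_def)
  have c': "s ''i'' 0 = int i + 1" "s ''u'' 0 = int (num (drop (Suc i) v))" "s ''v'' 0 = int (den (drop (Suc i) v))"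
    using c by (simp_all add: cvg_state_def)
  show ?thesis
    unfolding back_prog_def
    apply (simp add: W_simps c' o)
    apply (rule post)
      apply simp
    by (auto simp: cvg_state_def frame_def d)
qed

definition eval_prog :: com where "eval_prog =
  init_prog ;; While (Less (Const 0) (V ''i'')) back_prog"

lemma eval_correct:
  assumes h: "holds v s"
    and post: "\<And>t s'. t \<le> 50 * (length v + 1) \<Longrightarrow> s' ''u'' 0 = int (num v) \<Longrightarrow> s' ''v'' 0 = int (den v) \<Longrightarrow>
      frame {''i'', ''u'', ''v'', ''t''} s s' \<Longrightarrow> Q t s'"
  shows "W eval_prog Q s"
proof -
  define F where "F = {''i'', ''u'', ''v'', ''t''}"
  define I where "I s' \<longleftrightarrow> (\<exists>i\<le>length v. cvg_state v i s' \<and> frame F s s')" for s'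
  define f where "f s' = nat (s' ''i'' 0)" for s' :: state
  show ?thesis
    unfolding eval_prog_def W_simps
  proof (rule init_correct[OF h], rule W_While[where I = I and f = f and k = 40], goal_cases)
    case (1 t s0 s1)
    then obtain i where I: "i \<le> length v" "cvg_state v i s1" "frame F s s1" unfolding I_def by blast
    have "i > 0" using 1(5) I(2) by (simp add: cvg_state_def)
    then obtain j where j: "i = Suc j" by (cases i) auto
    have h1: "holds v s1" using h I(3) by (rule holds_frame) (simp add: F_def)
    show ?case
    proof (rule back_correct[OF h1 I(2)[unfolded j]], goal_cases)
      case 1
      show ?case using I j by simp
    next
      case (2 t' s2)
      have "I s2" unfolding I_def using 2 I j frame_trans[OF I(3) 2(3), of F] by (intro exI[of _ j]) (simp add: F_def)
      moreover have "f s2 < f s1" using 2(2) I(2) j by (simp add: f_def cvg_state_def)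
      ultimately show ?case using 2(1) by simp
    qed
  next
    case (2 t s0)
    show ?case unfolding I_def using 2 by (intro exI[of _ "length v"]) (auto simp: frame_def F_def)
  next
    case (3 t s0 t1 s1)
    then obtain i where I: "i \<le> length v" "cvg_state v i s1" "frame F s s1" unfolding I_def by blast
    have i: "i = 0" using 3(5) I(2) by (simp add: cvg_state_def)
    have "f s0 = length v" using 3(2) by (simp add: f_def cvg_state_def)
    hence "t + t1 \<le> 50 * (length v + 1)" using 3(1,6) by simp
    thus ?case using I i by (intro post) (auto simp: cvg_state_def F_def)
  qed
qed

definition cf_count_prog :: com where "cf_count_prog =
  init_prog ;; While (Less (V ''N'') (V ''i'')) (back_prog ;; cell_prog ;; bump_prog)"

abbreviation gauss_orbit :: "nat list \<Rightarrow> nat \<Rightarrow> real" where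
  "gauss_orbit v j \<equiv> gauss_coord (cf_tail (drop j v) 0)"

lemma tally_empty:
  assumes "\<And>a::nat. s ''C'' (s ''o'' 0 + int a) = 0" "s ''l'' 0 = 0" "s ''x'' 0 = 0"
  shows "tally K z {} s"
  using assms by (simp add: tally_def occ_def)

lemma cf_count_correct:
  assumes h: "holds v s" "pos_word v" and s: "s ''N'' 0 = int L" "s ''K'' 0 = int K" "L \<le> length v"
    and z: "\<And>a::nat. s ''C'' (s ''o'' 0 + int a) = 0" "s ''l'' 0 = 0" "s ''x'' 0 = 0"
    and post: "\<And>t s'. t \<le> 200 * ((length v + 1) * (K + 1)) \<Longrightarrow> tally K (gauss_orbit v) {L..<length v} s' \<Longrightarrow>
      frame {''i'', ''u'', ''v'', ''t'', ''Y'', ''Z'', ''j'', ''a'', ''C'', ''x'', ''l''} s s' \<Longrightarrow> Q t s'"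
  shows "W cf_count_prog Q s"
proof -
  define F where "F = {''i'', ''u'', ''v'', ''t'', ''Y'', ''Z'', ''j'', ''a'', ''C'', ''x'', ''l''}"
  define I where "I s' \<longleftrightarrow> (\<exists>i. L \<le> i \<and> i \<le> length v \<and> cvg_state v i s' \<and> tally K (gauss_orbit v) {i..<length v} s' \<and> frame F s s')" for s'
  define f where "f s' = nat (s' ''i'' 0)" for s' :: state
  show ?thesis
    unfolding cf_count_prog_def W_simps
  proof (rule init_correct[OF h(1)], rule W_While[where I = I and f = f and k = "40 + 80 * (K + 1) + 60"], goal_cases)
    case (1 t s0 s1)
    then obtain i where I: "L \<le> i" "i \<le> length v" "cvg_state v i s1" "tally K (gauss_orbit v) {i..<length v} s1" "frame F s s1"
      unfolding I_def by blast
    have N1: "s1 ''N'' 0 = int L" "s1 ''K'' 0 = int K" using I(5) s by (auto simp: frame_def F_def)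
    have "i > L" using 1(5) I(3) N1 by (simp add: cvg_state_def)
    then obtain j where j: "i = Suc j" by (cases i) auto
    have jl: "j < length v" "L \<le> j" using I j \<open>i > L\<close> by auto
    have h1: "holds v s1" using h(1) I(5) by (rule holds_frame) (simp add: F_def)
    have pd: "pos_word (drop j v)" using h(2) by (rule pos_drop)
    show ?case unfolding W_simps
    proof (rule back_correct[OF h1 I(3)[unfolded j] jl(1)], goal_cases)
      case (1 t2 s2)
      have F2: "frame F s s2" using frame_trans[OF I(5) 1(3), of F] by (simp add: F_def)
      have c2: "s2 ''u'' 0 = int (num (drop j v))" "s2 ''v'' 0 = int (den (drop j v))" using 1(2) by (auto simp: cvg_state_def)
      have K2: "s2 ''K'' 0 = int K" using F2 s by (auto simp: frame_def F_def)
      have T2: "tally K (gauss_orbit v) {i..<length v} s2" using I(4) 1(3) by (rule tally_frame) simp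
      note 1 = 1
      show ?case
      proof (rule cell_correct[where s = s2 and p = "num (drop j v)" and q = "den (drop j v)" and K = K, OF c2 K2 num_le_den[OF pd] den_pos[OF pd]], goal_cases)
        case (1 t3 s3 a)
        have T3: "tally K (gauss_orbit v) {i..<length v} s3" using T2 1(4) by (rule tally_frame) simp
        have F3: "frame F s s3" using frame_trans[OF F2 1(4), of F] by (simp add: F_def)
        have za: "gauss_orbit v j \<in> cell K a" using 1(3) cf_tail_0[OF pd] by simp
        note 1 = 1
        show ?case
        proof (rule bump_correct[where j = j, OF T3 1(2) _ _ za], goal_cases)
          case (3 t4 s4)
          have F4: "frame F s s4" using frame_trans[OF F3 3(3), of F] by (simp add: F_def)
          have eq: "insert j {i..<length v} = {j..<length v}" using jl j by auto
          have i4: "s4 y = s2 y" if "y \<in> {''i'', ''u'', ''v''}" for y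
            using that frameD[OF 1(4), of y] frameD[OF 3(3), of y] by auto
          have "cvg_state v j s4" using \<open>cvg_state v j s2\<close> i4 by (simp add: cvg_state_def)
          hence "I s4" unfolding I_def using jl F4 3(2) eq by (intro exI[of _ j]) simp
          moreover have "f s4 < f s1" using \<open>cvg_state v j s4\<close> I(3) j by (simp add: f_def cvg_state_def)
          moreover have "t2 + (t3 + t4) \<le> 40 + 80 * (K + 1) + 60" using \<open>t2 \<le> 40\<close> 1(1) 3(1) by linarith
          ultimately show ?case by simp
        qed (use j in auto)
      qed
    qed
  next
    case (2 t s0)
    have "tally K (gauss_orbit v) {} s0" 
      using z frameD[OF 2(3)] by (intro tally_empty) auto
    thus ?case unfolding I_def using 2 s(3) by (intro exI[of _ "length v"]) (auto simp: frame_def F_def)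
  next
    case (3 t s0 t1 s1)
    then obtain i where I: "L \<le> i" "i \<le> length v" "cvg_state v i s1" "tally K (gauss_orbit v) {i..<length v} s1" "frame F s s1"
      unfolding I_def by blast
    have N1: "s1 ''N'' 0 = int L" using I(5) s by (auto simp: frame_def F_def)
    have i: "i = L" using 3(5) I N1 by (simp add: cvg_state_def)
    have "f s0 = length v" using 3(2) by (simp add: f_def cvg_state_def)
    hence "t + t1 \<le> 20 + (length v * (40 + 80 * (K + 1) + 60 + 5) + 5)" using 3(1,6) by simp
    also have "\<dots> \<le> 200 * ((length v + 1) * (K + 1))" by (simp add: algebra_simps)
    finally show ?case using I i by (intro post) (auto simp: F_def)
  qed
qed

text \<open>\<open>R\<close> runs through the powers of b. The first loop stops at the first power
  not below the square of the old denominator \<open>Q\<close>, so the left end of the window is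
  found again without being stored; the second loop walks on to the square of the new denominator.
  The cell number is computed exactly, from the remainder of R u modulo v.\<close>

definition base_count_prog :: com where "base_count_prog =
  eval_prog ;; setv ''R'' (Const 1) ;;
  While (Less (V ''R'') (Mul (V ''Q'') (V ''Q''))) (setv ''R'' (Mul (V ''R'') (V ''b''))) ;;
  While (Less (V ''R'') (Mul (V ''v'') (V ''v'')))
   (setv ''a'' (Div (Mul (V ''K'') (Sub (Mul (V ''R'') (V ''u'')) (Mul (V ''v'') (Div (Mul (V ''R'') (V ''u'')) (V ''v''))))) (V ''v'')) ;;
    bump_prog ;; setv ''R'' (Mul (V ''R'') (V ''b'')))"

lemma base_cell:
  fixes p q r K :: nat
  assumes q: "q > 0"
  shows "frac (real r * (real p / real q)) \<in> cell K ((K * (r * p mod q)) div q)"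
proof -
  have "frac (real r * (real p / real q)) = real (r * p mod q) / real q"
  proof -
    have "real (r * p) / real q = real (r * p div q) + real (r * p mod q) / real q"
    proof -
      have "real (r * p) = real q * real (r * p div q) + real (r * p mod q)"
        unfolding of_nat_mult[symmetric] of_nat_add[symmetric] by (simp only: mult_div_mod_eq)
      thus ?thesis using q by (simp add: add_divide_distrib)
    qed
    moreover have "0 \<le> real (r * p mod q) / real q" "real (r * p mod q) / real q < 1" using q by (auto simp: divide_less_eq)
    ultimately have "\<lfloor>real (r * p) / real q\<rfloor> = int (r * p div q)" by (simp add: floor_eq_iff)
    thus ?thesis using \<open>real (r * p) / real q = _\<close> by (simp add: frac_def)
  qed
  hence "real K * frac (real r * (real p / real q)) = real (K * (r * p mod q)) / real q" by simp
  thus ?thesis unfolding cell_def by (simp only: mem_Collect_eq floor_divide_of_nat_eq)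
qed

abbreviation base_orbit :: "nat \<Rightarrow> nat list \<Rightarrow> nat \<Rightarrow> real" where
  "base_orbit b v j \<equiv> frac (real b ^ j * cf_tail v 0)"

text \<open>Makes the guards of both loops in \<open>base_count_prog\<close> stop exactly at the
  ends of the window.\<close>

lemma mb_step: "b \<ge> 2 \<Longrightarrow> (b ^ j < q\<^sup>2) = (j < digit_pos b q)"
proof
  assume b: "b \<ge> 2" and "b ^ j < q\<^sup>2"
  show "j < digit_pos b q"
  proof (rule ccontr)
    assume "\<not> ?thesis"
    hence "b ^ digit_pos b q \<le> b ^ j" using b by (intro power_increasing) auto
    thus False using mb_ge[OF b, of q] \<open>b ^ j < q\<^sup>2\<close> by simp
  qed
qed (rule mb_less)

lemma base_count_correct:
  assumes h: "holds v s" "pos_word v" and s: "s ''Q'' 0 = int q0" "s ''K'' 0 = int K" "s ''b'' 0 = int b" and b: "b \<ge> 2"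
    and q0: "q0 \<le> den v"
    and z: "\<And>a::nat. s ''C'' (s ''o'' 0 + int a) = 0" "s ''l'' 0 = 0" "s ''x'' 0 = 0"
    and post: "\<And>t s'. t \<le> 200 * (length v + 1) + 200 * (digit_pos b (den v) + 1) \<Longrightarrow> tally K (base_orbit b v) {digit_pos b q0..<digit_pos b (den v)} s' \<Longrightarrow>
      frame {''i'', ''u'', ''v'', ''t'', ''R'', ''a'', ''C'', ''x'', ''l''} s s' \<Longrightarrow> Q t s'"
  shows "W base_count_prog Q s"
proof -
  define F where "F = {''i'', ''u'', ''v'', ''t'', ''R'', ''a'', ''C'', ''x'', ''l''}"
  define m m' where "m = digit_pos b q0" and "m' = digit_pos b (den v)"
  have mm: "m \<le> m'" unfolding m_def m'_def by (rule mb_mono[OF b q0])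
  have dv: "den v > 0" by (rule den_pos[OF h(2)])
  have sq: "int (b ^ j) < int q * int q \<longleftrightarrow> j < digit_pos b q" for j q
    using mb_step[OF b, of j q] by (simp add: power2_eq_square flip: of_nat_mult of_nat_power)
  show ?thesis
    unfolding base_count_prog_def W_simps
  proof (rule eval_correct[OF h(1)], goal_cases)
    case (1 t1 s1)
    have F1: "frame F s s1" using frame_trans[OF frame_refl 1(4), of F F] by (simp add: F_def)
    define I where "I s' \<longleftrightarrow> (\<exists>j\<le>m. s' ''R'' 0 = int (b ^ j) \<and> frame {''R''} s1 s')" for s'
    \<comment> \<open>The exponent is recovered from the value of \<open>R\<close>; powers of b >= 2
      are distinct.\<close>
    define f where "f s' = m - (THE j. s' ''R'' 0 = int (b ^ j))" for s' :: state
    have the: "(THE j. int (b ^ i) = int (b ^ j)) = i" for i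
      using b by (intro the_equality) (auto simp: power_inject_exp)
    define J where "J s' \<longleftrightarrow> (\<exists>j\<ge>m. j \<le> m' \<and> s' ''R'' 0 = int (b ^ j) \<and> tally K (base_orbit b v) {m..<j} s' \<and> frame {''R'', ''a'', ''C'', ''x'', ''l''} s1 s')" for s'
    define g where "g s' = m' - (THE j. s' ''R'' 0 = int (b ^ j))" for s' :: state
    have v1: "s1 ''Q'' 0 = int q0" "s1 ''K'' 0 = int K" "s1 ''b'' 0 = int b" "s1 ''u'' 0 = int (num v)" "s1 ''v'' 0 = int (den v)"
      using F1 s 1(2,3) by (auto simp: frame_def F_def)
    note 1 = 1
    show ?case
    proof (rule W_While[where I = I and f = f and k = 10], goal_cases)
      case (1 s2)
      then obtain j where I: "j \<le> m" "s2 ''R'' 0 = int (b ^ j)" "frame {''R''} s1 s2" unfolding I_def by blast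
      have v2: "s2 ''Q'' 0 = int q0" "s2 ''b'' 0 = int b" using v1 frameD[OF I(3)] by auto
      have "j < m" using 1(2) I(2) v2 sq[of j q0] by (simp add: m_def)
      show ?case
        apply (simp add: W_simps I(2) v2)
        unfolding I_def f_def
        apply (intro conjI)
         apply (rule exI[of _ "Suc j"])
        subgoal using \<open>j < m\<close> I(3) by (simp add: frame_def)
        subgoal using \<open>j < m\<close> I(2) the[of j] the[of "Suc j"] by (simp add: mult.commute)
        done
    next
      case 2
      show ?case unfolding I_def by (intro exI[of _ 0]) (simp add: frame_def)
    next
      case (3 t2 s2)
      then obtain j where I: "j \<le> m" "s2 ''R'' 0 = int (b ^ j)" "frame {''R''} s1 s2" unfolding I_def by blast
      have v2: "s2 ''Q'' 0 = int q0" "s2 ''b'' 0 = int b" using v1 frameD[OF I(3)] by auto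
      have jm: "j = m" using 3(2) I v2 sq[of j q0] by (simp add: m_def)
      have t2: "t2 \<le> 18 * m + 8"
      proof -
        have "(THE j. (1::int) = int (b ^ j)) = 0" using the[of 0] by simp
        thus ?thesis using 3(3) by (simp add: f_def)
      qed
      have T2: "tally K (base_orbit b v) {} s2"
        using z frameD[OF I(3)] frameD[OF \<open>frame {''i'', ''u'', ''v'', ''t''} s s1\<close>] by (intro tally_empty) auto
      show ?case
      proof (rule W_While[where I = J and f = g and k = 100], goal_cases)
        case (1 s3)
        then obtain j where J: "m \<le> j" "j \<le> m'" "s3 ''R'' 0 = int (b ^ j)" "tally K (base_orbit b v) {m..<j} s3" 
          "frame {''R'', ''a'', ''C'', ''x'', ''l''} s1 s3" unfolding J_def by blast
        have v3: "s3 ''K'' 0 = int K" "s3 ''b'' 0 = int b" "s3 ''u'' 0 = int (num v)" "s3 ''v'' 0 = int (den v)"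
          using v1 frameD[OF J(5)] by auto
        have jm': "j < m'" using 1(2) J(3) v3 sq[of j "den v"] by (simp add: m'_def)
        define a where "a = (K * (b ^ j * num v mod den v)) div den v"
        have za: "base_orbit b v j \<in> cell K a" using base_cell[OF dv, of "b ^ j" "num v" K] cf_tail_0[OF h(2)] by (simp add: a_def)
        have aeq: "int K * (int (b ^ j) * int (num v) - int (den v) * (int (b ^ j) * int (num v) div int (den v))) div int (den v) = int a"
          unfolding a_def by (simp add: minus_mult_div_eq_mod zmod_int zdiv_int)
        define s4 where "s4 = s3(''a'' := (s3 ''a'')(0 := int a))"
        have F4: "frame {''a''} s3 s4" by (simp add: s4_def frame_def)
        have T4: "tally K (base_orbit b v) {m..<j} s4" using J(4) F4 by (rule tally_frame) simp
        have a4: "s4 ''a'' 0 = int a" by (simp add: s4_def)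
        have "W bump_prog (\<lambda>t s'. t \<le> 60 \<and> tally K (base_orbit b v) (insert j {m..<j}) s' \<and> frame {''C'', ''x'', ''l''} s4 s') s4"
          by (rule bump_correct[OF T4 a4 _ _ za]) auto
        hence bump: "W bump_prog (\<lambda>t s'. t \<le> 60 \<and> tally K (base_orbit b v) {m..<Suc j} s' \<and> frame {''C'', ''x'', ''l''} s4 s') s4"
          using J(1) by (simp add: atLeastLessThanSuc)
        show ?case
          unfolding W_Seq
          apply (subst W_Assign)
          apply (simp add: J(3) v3 aeq s4_def[symmetric] del: of_nat_power)
          apply (rule W_mono[OF bump])
          subgoal premises p for t5 s5
          proof -
            have p3: "frame {''C'', ''x'', ''l''} s4 s5" using p by blast
            have R5: "s5 ''R'' 0 = int (b ^ j)" "s5 ''b'' 0 = int b"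
              using frameD[OF p3, of "''R''"] frameD[OF p3, of "''b''"] J(3) v3(2) by (simp_all add: s4_def del: of_nat_power)
            have "frame {''R'', ''a'', ''C'', ''x'', ''l''} s1 s4" by (rule frame_trans[OF J(5) F4]) auto
            hence F5: "frame {''R'', ''a'', ''C'', ''x'', ''l''} s1 s5" by (rule frame_trans[OF _ p3]) auto
            have T5: "tally K (base_orbit b v) {m..<Suc j} s5" using p by blast
            show ?thesis
              apply (simp add: W_simps R5 del: of_nat_power)
              unfolding J_def g_def
              apply (intro conjI)
              subgoal using p by simp
               apply (rule exI[of _ "Suc j"])
              subgoal using jm' J(1) F5 tally_frame[OF T5, of "{''R''}"] by (simp add: frame_def mult.commute)
              subgoal using jm' J(3) the[of j] the[of "Suc j"] by (simp add: mult.commute)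
              done
          qed
          done
      next
        case 2
        show ?case unfolding J_def using I jm mm T2 by (intro exI[of _ m]) (auto simp: frame_def)
      next
        case (3 t3 s3)
        then obtain j where J: "m \<le> j" "j \<le> m'" "s3 ''R'' 0 = int (b ^ j)" "tally K (base_orbit b v) {m..<j} s3" 
          "frame {''R'', ''a'', ''C'', ''x'', ''l''} s1 s3" unfolding J_def by blast
        have v3: "s3 ''v'' 0 = int (den v)" using v1 frameD[OF J(5)] by auto
        have jm': "j = m'" using 3(2) J v3 sq[of j "den v"] by (simp add: m'_def)
        have t3: "t3 \<le> 108 * m' + 8"
        proof -
          have "g s2 \<le> m'" by (simp add: g_def)
          hence "g s2 * 108 \<le> m' * 108" by simp
          thus ?thesis using 3(3) by simp
        qed
        show ?case
        proof (rule post)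
          show "tally K (base_orbit b v) {digit_pos b q0..<digit_pos b (den v)} s3" using J(4) jm' by (simp add: m_def m'_def)
          show "frame {''i'', ''u'', ''v'', ''t'', ''R'', ''a'', ''C'', ''x'', ''l''} s s3"
            using frame_trans[OF F1 J(5), of F] by (simp add: F_def)
        qed (use t2 t3 mm \<open>t1 \<le> _\<close> in \<open>simp add: m'_def[symmetric]\<close>)
      qed
    qed
  qed
qed

section \<open>Deciding the tests of one level for one candidate\<close>

definition zero :: "state \<Rightarrow> bool" where
  "zero s \<longleftrightarrow> (\<forall>a::nat. s ''C'' (s ''o'' 0 + int a) = 0)"

text \<open>The shift by K + 1 passes over the cells 0, ..., K, all that values up to 1 can reach;
  the value 1 itself lies in cell K.\<close>

definition check_prog :: com where "check_prog =
  setv ''o'' (Add (V ''o'') (Add (V ''K'') (Const 1))) ;;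
  Cond (Less (Mul (Add (V ''K'') (Const 1)) (V ''l'')) (Mul (Mul (V ''K'') (V ''K'')) (V ''x'')))
    (setv ''g'' (Const 0)) Skip"

lemma check_correct:
  assumes T: "tally K z S s" and z: "\<And>j. j \<in> S \<Longrightarrow> z j \<le> 1" and K: "s ''K'' 0 = int K"
    and post: "\<And>t s'. t \<le> 60 \<Longrightarrow> s' ''g'' 0 = (if even_cells K z S then s ''g'' 0 else 0) \<Longrightarrow> zero s' \<Longrightarrow>
      frame {''o'', ''g''} s s' \<Longrightarrow> Q t s'"
  shows "W check_prog Q s"
proof -
  note T' = T[unfolded tally_def]
  have l: "s ''l'' 0 = int (card S)" using T' by blast
  have even: "even_cells K z S \<longleftrightarrow> \<not> (int K + 1) * int (card S) < int K * int K * s ''x'' 0"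
  proof -
    have "even_cells K z S \<longleftrightarrow> (\<forall>a. int K * int K * int (occ z S (cell K a)) \<le> (int K + 1) * int (card S))"
      unfolding even_cells_def power2_eq_square
      by (intro all_cong1) (simp flip: of_nat_mult of_nat_Suc of_nat_add add: add.commute)
    also have "\<dots> \<longleftrightarrow> int K * int K * s ''x'' 0 \<le> (int K + 1) * int (card S)"
    proof
      assume a: "\<forall>a. int K * int K * int (occ z S (cell K a)) \<le> (int K + 1) * int (card S)"
      show "int K * int K * s ''x'' 0 \<le> (int K + 1) * int (card S)"
        using T' a by (cases "s ''x'' 0 = 0") auto
    next
      assume a: "int K * int K * s ''x'' 0 \<le> (int K + 1) * int (card S)"
      show "\<forall>a. int K * int K * int (occ z S (cell K a)) \<le> (int K + 1) * int (card S)"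
      proof
        fix b
        have "int K * int K * int (occ z S (cell K b)) \<le> int K * int K * s ''x'' 0"
          using T' by (intro mult_left_mono) auto
        thus "int K * int K * int (occ z S (cell K b)) \<le> (int K + 1) * int (card S)" using a by linarith
      qed
    qed
    finally show ?thesis by (simp add: not_less)
  qed
  have zero: "s ''C'' (s ''o'' 0 + (int K + 1) + int a) = 0" for a
  proof -
    have "{j \<in> S. z j \<in> cell K (K + 1 + a)} = {}"
    proof -
      have "z j \<notin> cell K (K + 1 + a)" if "j \<in> S" for j
      proof
        assume "z j \<in> cell K (K + 1 + a)"
        hence "real (K + 1 + a) \<le> real K * z j" by (simp add: cell_def floor_eq_iff)
        also have "\<dots> \<le> real K * 1" using z[OF that] by (intro mult_left_mono) auto
        finally show False by simp
      qed
      thus ?thesis by blast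
    qed
    hence "occ z S (cell K (K + 1 + a)) = 0" by (simp only: occ_def card.empty)
    moreover have "s ''C'' (s ''o'' 0 + int (K + 1 + a)) = int (occ z S (cell K (K + 1 + a)))" using T' by blast
    ultimately show ?thesis by (simp add: ac_simps)
  qed
  show ?thesis
  proof (cases "even_cells K z S")
    case True
    hence c: "\<not> (int K + 1) * int (card S) < int K * int K * s ''x'' 0" using even by simp
    show ?thesis unfolding check_prog_def
      apply (simp add: W_simps K l c)
      apply (rule post)
      using True zero by (auto simp: zero_def frame_def add.assoc)
  next
    case False
    hence c: "(int K + 1) * int (card S) < int K * int K * s ''x'' 0" using even by simp
    show ?thesis unfolding check_prog_def
      apply (simp add: W_simps K l c)
      apply (rule post)
      using False zero by (auto simp: zero_def frame_def add.assoc)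
  qed
qed

definition test_prog :: com where "test_prog =
  setv ''x'' (Const 0) ;; setv ''l'' (Const 0) ;;
  Cond (Less (V ''b'') (Const 2)) cf_count_prog base_count_prog ;; check_prog"

text \<open>The number 1 stands for the continued fraction test and b >= 2 for base b, so that one
  loop from 1 to K runs all tests of a level.\<close>

definition test_ok :: "nat \<Rightarrow> nat \<Rightarrow> nat \<Rightarrow> nat list \<Rightarrow> nat \<Rightarrow> bool" where
  "test_ok K L q0 v b \<longleftrightarrow> (if b < 2 then even_cells K (gauss_orbit v) {L..<length v}
     else even_cells K (base_orbit b v) {digit_pos b q0..<digit_pos b (den v)})"

abbreviation test_vars :: "string set" where
  "test_vars \<equiv> {''i'', ''u'', ''v'', ''t'', ''Y'', ''Z'', ''j'', ''a'', ''C'', ''x'', ''l'', ''R'', ''o'', ''g''}"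

lemma zcf_le_1: "pos_word v \<Longrightarrow> gauss_orbit v j \<le> 1"
proof -
  assume "pos_word v"
  hence "0 \<le> cf_tail (drop j v) 0" "cf_tail (drop j v) 0 \<le> 1" using cf_tail_nonneg cf_tail_le_1[OF pos_drop] by auto
  thus ?thesis by (simp add: gauss_coord_def)
qed

lemma test_correct:
  assumes h: "holds v s" "pos_word v" and s: "s ''N'' 0 = int L" "s ''Q'' 0 = int q0" "s ''K'' 0 = int K" "s ''b'' 0 = int b"
    and L: "L \<le> length v" "q0 \<le> den v" and z: "zero s" and M: "b \<ge> 2 \<Longrightarrow> digit_pos b (den v) \<le> M"
    and post: "\<And>t s'. t \<le> 200 * ((length v + 1) * (K + 1)) + 200 * (M + 1) + 100 \<Longrightarrow>
      s' ''g'' 0 = (if test_ok K L q0 v b then s ''g'' 0 else 0) \<Longrightarrow> zero s' \<Longrightarrow> frame test_vars s s' \<Longrightarrow> Q t s'"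
  shows "W test_prog Q s"
proof -
  define s0 where "s0 = s(''x'' := (s ''x'')(0 := 0), ''l'' := (s ''l'')(0 := 0))"
  have F0: "frame {''x'', ''l''} s s0" by (simp add: s0_def frame_def)
  have h0: "holds v s0" using h(1) F0 by (rule holds_frame) simp
  have v0: "s0 ''N'' 0 = int L" "s0 ''Q'' 0 = int q0" "s0 ''K'' 0 = int K" "s0 ''b'' 0 = int b" "s0 ''g'' 0 = s ''g'' 0"
    "s0 ''l'' 0 = 0" "s0 ''x'' 0 = 0"
    using s by (simp_all add: s0_def)
  have z0: "s0 ''C'' (s0 ''o'' 0 + int a) = 0" for a using z by (simp add: s0_def zero_def)
  show ?thesis
  proof (cases "b < 2")
    case True
    have b: "s ''b'' 0 < 2" using True s by simp
    show ?thesis unfolding test_prog_def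
      apply (simp add: W_simps b s0_def[symmetric])
    proof (rule cf_count_correct[OF h0 h(2) v0(1,3) L(1) z0 v0(6,7)], goal_cases)
      case (1 t1 s1)
      have K1: "s1 ''K'' 0 = int K" using frameD[OF 1(3), of "''K''"] v0 by simp
      have g1: "s1 ''g'' 0 = s ''g'' 0" using frameD[OF 1(3), of "''g''"] v0 by simp
      have F1: "frame test_vars s s1" using frame_trans[OF F0 1(3), of test_vars] by simp
      note 1 = 1
      show ?case
      proof (rule check_correct[OF 1(2) _ K1], goal_cases)
        case (2 t2 s2)
        show ?case
          using 1(1) 2(1) 2(2,3) g1 True frame_trans[OF F1 2(4), of test_vars]
          by (intro post) (auto simp: test_ok_def)
      qed (rule zcf_le_1[OF h(2)])
    qed
  next
    case False
    have b: "\<not> s ''b'' 0 < 2" "b \<ge> 2" using False s by simp_all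
    show ?thesis unfolding test_prog_def
      apply (simp add: W_simps b(1) s0_def[symmetric])
    proof (rule base_count_correct[OF h0 h(2) v0(2,3,4) b(2) L(2) z0 v0(6,7)], goal_cases)
      case (1 t1 s1)
      have K1: "s1 ''K'' 0 = int K" using frameD[OF 1(3), of "''K''"] v0 by simp
      have g1: "s1 ''g'' 0 = s ''g'' 0" using frameD[OF 1(3), of "''g''"] v0 by simp
      have F1: "frame test_vars s s1" using frame_trans[OF F0 1(3), of test_vars] by simp
      have t1: "t1 \<le> 200 * ((length v + 1) * (K + 1)) + 200 * (M + 1)"
        using 1(1) M[OF b(2)] by (simp add: algebra_simps)
      note 1 = 1
      show ?case
      proof (rule check_correct[OF 1(2) _ K1], goal_cases)
        case (2 t2 s2)
        show ?case
          using t1 2(1) 2(2,3) g1 False frame_trans[OF F1 2(4), of test_vars]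
          by (intro post) (auto simp: test_ok_def)
      qed (simp add: less_imp_le[OF frac_lt_1])
    qed
  qed
qed

definition pass_prog :: com where "pass_prog =
  setv ''k'' (V ''m'') ;; decode_prog ;; setv ''g'' (Const 1) ;; setv ''b'' (Const 1) ;;
  While (Neg (Less (V ''K'') (V ''b''))) (test_prog ;; setv ''b'' (Add (V ''b'') (Const 1)))"

text \<open>The invariant between candidates. Cells of \<open>out\<close> behind the word are
  scratch space and left unspecified.\<close>

definition base_rel :: "nat list \<Rightarrow> nat \<Rightarrow> state \<Rightarrow> bool" where
  "base_rel ws c s \<longleftrightarrow> s ''N'' 0 = int (length ws) \<and> (\<forall>i<length ws. s ''out'' (int i) = int (ws ! i)) \<and>
     s ''Q'' 0 = int (den ws) \<and> s ''c'' 0 = int c \<and> zero s"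

abbreviation pass_vars :: "string set" where
  "pass_vars \<equiv> {''e'', ''k'', ''out'', ''b''} \<union> test_vars"

lemma den_le_append: "pos_word w \<Longrightarrow> den ws \<le> den (ws @ w)"
  using den_append_ge[of ws w] den_pos[of w] by (metis Suc_leI dual_order.trans mult.right_neutral mult_le_mono2 One_nat_def)

lemma passes_iff: "K \<ge> 1 \<Longrightarrow> passes K ws w \<longleftrightarrow> (\<forall>b\<in>{1..K}. test_ok K (length ws) (den ws) (ws @ w) b)"
proof -
  assume "K \<ge> 1"
  hence "{1..K} = insert 1 {2..K}" by auto
  thus ?thesis by (auto simp: passes_def test_ok_def)
qed

lemma holds_decoded:
  assumes "base_rel ws c s" "s' ''e'' 0 = int (length ws + length w)"
    "\<And>i. i < length w \<Longrightarrow> s' ''out'' (int (length ws + i)) = int (w ! i)"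
    "\<And>i. i < int (length ws) \<Longrightarrow> s' ''out'' i = s ''out'' i"
  shows "holds (ws @ w) s'"
  unfolding holds_def
proof (intro conjI allI impI)
  fix i assume i: "i < length (ws @ w)"
  show "s' ''out'' (int i) = int ((ws @ w) ! i)"
  proof (cases "i < length ws")
    case True
    thus ?thesis using assms(1,4) by (simp add: base_rel_def nth_append)
  next
    case False
    thus ?thesis using assms(3)[of "i - length ws"] i by (simp add: nth_append)
  qed
qed (use assms(2) in simp)

lemma base_rel_frame:
  assumes "base_rel ws c s" "frame A s s'" "A \<inter> {''N'', ''Q'', ''c''} = {}" "zero s'"
    "\<And>i. i < int (length ws) \<Longrightarrow> s' ''out'' i = s ''out'' i"
  shows "base_rel ws c s'"
proof -
  have "s' y = s y" if "y \<in> {''N'', ''Q'', ''c''}" for y using frameD[OF assms(2)] assms(3) that by blast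
  thus ?thesis using assms(1,4,5) by (simp add: base_rel_def)
qed

lemma pass_correct:
  assumes r: "base_rel ws c s" "pos_word ws" "c > 0" and s: "s ''K'' 0 = int K" "s ''m'' 0 = int m" and K: "K \<ge> 1"
    and M: "\<And>b. b \<ge> 2 \<Longrightarrow> digit_pos b (den (ws @ dec c m)) \<le> M" and E: "length (ws @ dec c m) \<le> E"
    and post: "\<And>t s'. t \<le> 50 * (E + 1) + K * (200 * ((E + 1) * (K + 1)) + 200 * (M + 1) + 120) + 50 \<Longrightarrow>
      (s' ''g'' 0 > 0) = passes K ws (dec c m) \<Longrightarrow> base_rel ws c s' \<Longrightarrow> frame pass_vars s s' \<Longrightarrow> Q t s'"
  shows "W pass_prog Q s"
proof -
  define w where "w = dec c m"
  define s0 where "s0 = s(''k'' := (s ''k'')(0 := int m))"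
  have F0: "frame {''k''} s s0" by (simp add: s0_def frame_def)
  have v0: "s0 ''N'' 0 = int (length ws)" "s0 ''k'' 0 = int m" "s0 ''c'' 0 = int c"
    using r(1) by (auto simp: s0_def base_rel_def)
  have pw: "pos_word (ws @ w)" using r(2) dec_range[OF r(3)] by (auto simp: w_def pos_word_def)
  have qle: "den ws \<le> den (ws @ w)" using pw by (intro den_le_append) simp
  show ?thesis unfolding pass_prog_def
    apply (simp add: W_simps s(2) s0_def[symmetric])
  proof (rule decode_correct[where s = s0 and L = "length ws" and m = m and c = c, OF v0 r(3)], goal_cases)
    case (1 t1 s1)
    have h1: "holds (ws @ w) s1"
    proof (rule holds_decoded[OF r(1)])
      show "s1 ''out'' i = s ''out'' i" if "i < int (length ws)" for i using 1(4)[OF that] by (simp add: s0_def)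
    qed (use 1 in \<open>auto simp: w_def\<close>)
    have F1: "frame {''e'', ''k'', ''t'', ''out''} s s1" using frame_trans[OF F0 1(5)] by simp
    have out1: "s1 ''out'' i = s ''out'' i" if "i < int (length ws)" for i using 1(4)[OF that] by (simp add: s0_def)
    have z1: "zero s1" using r(1) frameD[OF F1] by (simp add: base_rel_def zero_def)
    define s2 where "s2 = s1(''g'' := (s1 ''g'')(0 := 1), ''b'' := (s1 ''b'')(0 := 1))"
    define I where "I s' \<longleftrightarrow> (\<exists>b\<ge>1. b \<le> K + 1 \<and> s' ''b'' 0 = int b \<and> 
        s' ''g'' 0 = (if \<forall>b'\<in>{1..<b}. test_ok K (length ws) (den ws) (ws @ w) b' then 1 else 0) \<and>
        zero s' \<and> frame (insert ''b'' test_vars) s1 s')" for s'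
    define f where "f s' = K + 1 - nat (s' ''b'' 0)" for s' :: state
    define kk where "kk = 200 * ((E + 1) * (K + 1)) + 200 * (M + 1) + 110"
    note 1 = 1
    show ?case
      unfolding W_simps
      apply (simp add: s2_def[symmetric])
    proof (rule W_While[where I = I and f = f and k = kk], goal_cases)
      case (1 s3)
      then obtain b where I: "b \<ge> 1" "b \<le> K + 1" "s3 ''b'' 0 = int b"
        "s3 ''g'' 0 = (if \<forall>b'\<in>{1..<b}. test_ok K (length ws) (den ws) (ws @ w) b' then 1 else 0)"
        "zero s3" "frame (insert ''b'' test_vars) s1 s3" unfolding I_def by blast
      have v3: "s3 ''N'' 0 = int (length ws)" "s3 ''Q'' 0 = int (den ws)" "s3 ''K'' 0 = int K"
        using frameD[OF I(6)] frameD[OF F1] r(1) s(1) by (simp_all add: base_rel_def)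
      have bK: "b \<le> K" using 1(2) I(3) v3 by simp
      have h3: "holds (ws @ w) s3" using h1 I(6) by (rule holds_frame) simp
      show ?case unfolding W_simps
      proof (rule test_correct[where M = M, OF h3 pw v3 I(3) _ qle I(5)], goal_cases)
        case 2
        thus ?case using M by (simp add: w_def)
      next
        case (3 t4 s4)
        have b4: "s4 ''b'' 0 = int b" using frameD[OF 3(4), of "''b''"] I(3) by simp
        have F4: "frame (insert ''b'' test_vars) s1 s4" by (rule frame_trans[OF I(6) 3(4)]) auto
        have rng: "{1..<Suc b} = insert b {1..<b}" using I(1) by auto
        have g4: "s4 ''g'' 0 = (if \<forall>b'\<in>{1..<Suc b}. test_ok K (length ws) (den ws) (ws @ w) b' then 1 else 0)"
          unfolding 3(2) I(4) rng by simp
        have t4: "t4 \<le> 200 * ((E + 1) * (K + 1)) + 200 * (M + 1) + 100"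
        proof -
          have "(length (ws @ w) + 1) * (K + 1) \<le> (E + 1) * (K + 1)" using E by (intro mult_le_mono1) (simp add: w_def)
          thus ?thesis using 3(1) by linarith
        qed
        have z4: "zero (s4(''b'' := h))" for h using 3(3) by (simp add: zero_def)
        have F5: "frame (insert ''b'' test_vars) s1 (s4(''b'' := h))" for h using F4 by (rule frame_upd) simp
        show ?case
          apply (intro conjI)
          subgoal using t4 by (simp add: kk_def)
          subgoal unfolding I_def using bK b4 g4 z4 F5 by (intro exI[of _ "Suc b"]) (simp add: atLeastLessThanSuc)
          subgoal unfolding f_def using bK I(3) b4 by simp
          done
      qed simp
    next
      case 2
      have "frame (insert ''b'' test_vars) s1 s2" by (simp add: s2_def frame_def)
      moreover have "zero s2" using z1 by (simp add: s2_def zero_def)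
      ultimately show ?case unfolding I_def by (intro exI[of _ 1]) (simp add: s2_def)
    next
      case (3 t3 s3)
      then obtain b where I: "b \<ge> 1" "b \<le> K + 1" "s3 ''b'' 0 = int b"
        "s3 ''g'' 0 = (if \<forall>b'\<in>{1..<b}. test_ok K (length ws) (den ws) (ws @ w) b' then 1 else 0)"
        "zero s3" "frame (insert ''b'' test_vars) s1 s3" unfolding I_def by blast
      have "s3 ''K'' 0 = int K" using frameD[OF I(6)] frameD[OF F1] s(1) by simp
      hence b: "b = K + 1" using 3(2) I(2,3) by simp
      have F3: "frame pass_vars s s3" by (rule frame_trans[OF F1 I(6)]) auto
      show ?case
      proof (rule post, goal_cases)
        case 1
        have "f s2 = K" by (simp add: f_def s2_def)
        hence t3: "t3 \<le> K * (kk + 9) + 9" using 3(3) by (simp add: algebra_simps)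
        have "length (dec c m) \<le> E" using E by simp
        hence t1: "t1 \<le> 50 * (E + 1)" using \<open>t1 \<le> 50 * (length (dec c m) + 1)\<close> by simp
        have "K * (kk + 9) \<le> K * (200 * ((E + 1) * (K + 1)) + 200 * (M + 1) + 120)" by (simp add: kk_def)
        with t1 t3 show ?case by linarith
      next
        case 2
        show ?case
          unfolding I(4) b passes_iff[OF K] w_def by (simp add: atLeastLessThanSuc_atLeastAtMost)
      next
        case 3
        show ?case
          by (rule base_rel_frame[OF r(1) F3 _ I(5)]) (use frameD[OF I(6), of "''out''"] out1 in auto)
      qed (rule F3)
    qed
  qed
qed

section \<open>The search, the main loop and their cost\<close>

definition search_prog :: com where "search_prog =
  setv ''r'' (Const 1) ;; setv ''K'' (Const 1) ;; setv ''m'' (Const 1) ;;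
  While (Conj (Neg (Less (V ''X'') (V ''m''))) (Neg (Less (V ''c'') (V ''K''))))
    (pass_prog ;;
     Cond (Less (Const 0) (V ''g''))
       (setv ''r'' (V ''m'') ;; setv ''K'' (Add (V ''K'') (Const 1)))
       (setv ''m'' (Add (V ''m'') (Const 1))))"

abbreviation search_vars :: "string set" where
  "search_vars \<equiv> {''r'', ''K'', ''m''} \<union> pass_vars"

text \<open>Each digit multiplies the denominator by at most c + 1, which is at most 2^c. The bound
  limits the time of a base test.\<close>

lemma mb_bound:
  assumes "pos_word v" "\<And>d. d \<in> set v \<Longrightarrow> d \<le> c" "b \<ge> 2"
  shows "digit_pos b (den v) \<le> 2 * (c * length v)"
proof (rule mb_le)
  have "den v \<le> (c + 1) ^ length v" by (rule den_le[OF assms(1,2)])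
  also have "\<dots> \<le> (2 ^ c) ^ length v" by (intro power_mono) (auto simp: Suc_le_eq)
  also have "\<dots> = 2 ^ (c * length v)" by (simp add: power_mult)
  finally have "(den v)\<^sup>2 \<le> (2 ^ (c * length v))\<^sup>2" by (rule power_mono) simp
  also have "\<dots> = 2 ^ (2 * (c * length v))" by (simp add: power_mult[symmetric] mult.commute)
  also have "\<dots> \<le> b ^ (2 * (c * length v))" using assms(3) by (intro power_mono) auto
  finally show "(den v)\<^sup>2 \<le> b ^ (2 * (c * length v))" .
qed

lemma dec_short: "c \<ge> 2 \<Longrightarrow> m \<le> 2 ^ c \<Longrightarrow> length (dec c m) \<le> c"
proof (rule ccontr)
  assume c: "c \<ge> 2" "m \<le> 2 ^ c" and "\<not> length (dec c m) \<le> c"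
  hence "2 ^ Suc c \<le> (2::nat) ^ length (dec c m)" by (intro power_increasing) auto
  also have "\<dots> \<le> m + 1" by (rule dec_length[OF c(1)])
  finally have "(2::nat) ^ c \<le> 1" using c(2) by simp
  moreover have "(2::nat) ^ 2 \<le> 2 ^ c" using c by (intro power_increasing) auto
  ultimately show False by simp
qed

text \<open>At most c tests, each of cost O(c (E + 1)): the Gauss test because a cell number takes
  O(c) operations, a base test because its window ends at 2 c E or earlier.\<close>

definition pass_cost :: "nat \<Rightarrow> nat \<Rightarrow> nat" where
  "pass_cost E c = 2000 * ((c + 1) * (c + 1) * (E + 1))"

lemma pass_cost_bound:
  assumes "K \<le> c"
  shows "50 * (E + 1) + K * (200 * ((E + 1) * (K + 1)) + 200 * (2 * (c * E) + 1) + 120) + 50 \<le> pass_cost E c"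
proof -
  have "K * (200 * ((E + 1) * (K + 1)) + 200 * (2 * (c * E) + 1) + 120) \<le> c * (200 * ((E + 1) * (c + 1)) + 200 * (2 * (c * E) + 1) + 120)"
    using assms by (intro mult_le_mono add_mono) auto
  moreover have "50 * (E + 1) + c * (200 * ((E + 1) * (c + 1)) + 200 * (2 * (c * E) + 1) + 120) + 50 \<le> pass_cost E c"
    unfolding pass_cost_def by (simp add: algebra_simps)
  ultimately show ?thesis by linarith
qed

lemma search_correct:
  assumes r: "base_rel ws c s" "pos_word ws" "c \<ge> 2" "\<And>d. d \<in> set ws \<Longrightarrow> d \<le> c" and X: "s ''X'' 0 = 2 ^ c"
    and post: "\<And>t s'. t \<le> (2 ^ c + c) * (pass_cost (length ws + c) c + 60) + 40 \<Longrightarrow>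
      s' ''r'' 0 = int (best ws c) \<Longrightarrow> base_rel ws c s' \<Longrightarrow> frame search_vars s s' \<Longrightarrow> Q t s'"
  shows "W search_prog Q s"
proof -
  define pr where "pr = (\<lambda>K m. passes K ws (dec c m))"
  define s0 where "s0 = s(''r'' := (s ''r'')(0 := 1), ''K'' := (s ''K'')(0 := 1), ''m'' := (s ''m'')(0 := 1))"
  define I where "I s' \<longleftrightarrow> (\<exists>K m r. s' ''K'' 0 = int K \<and> s' ''m'' 0 = int m \<and> s' ''r'' 0 = int r \<and> 1 \<le> K \<and> 
     search pr (2 ^ c) c K m r = best ws c \<and> base_rel ws c s' \<and> frame search_vars s s')" for s'
  \<comment> \<open>Each round raises \<open>m\<close> or \<open>K\<close>, hence at most 2^c + c
    rounds.\<close>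
  define f where "f s' = (Suc (2 ^ c) - nat (s' ''m'' 0)) + (Suc c - nat (s' ''K'' 0))" for s' :: state
  define E where "E = length ws + c"
  have c0: "c > 0" using r by simp
  show ?thesis unfolding search_prog_def
    apply (simp add: W_simps s0_def[symmetric])
  proof (rule W_While[where I = I and f = f and k = "pass_cost E c + 40"], goal_cases)
    case (1 s1)
    then obtain K m r' where I: "s1 ''K'' 0 = int K" "s1 ''m'' 0 = int m" "s1 ''r'' 0 = int r'" "1 \<le> K"
      "search pr (2 ^ c) c K m r' = best ws c" "base_rel ws c s1" "frame search_vars s s1" unfolding I_def by blast
    have X1: "s1 ''X'' 0 = 2 ^ c" using frameD[OF I(7), of "''X''"] X by simp
    have c1: "s1 ''c'' 0 = int c" using I(6) by (simp add: base_rel_def)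
    have "\<not> (2::int) ^ c < int m" "\<not> int c < int K" using 1(2) X1 c1 I by auto
    hence m: "m \<le> 2 ^ c" and K: "K \<le> c" by (auto simp flip: of_nat_power_less_of_nat_cancel_iff of_nat_le_numeral_power_cancel_iff)
    have sr: "search pr (2 ^ c) c K m r' = (if pr K m then search pr (2 ^ c) c (Suc K) m m else search pr (2 ^ c) c K (Suc m) r')"
      using m K by (subst search.simps) simp
    have lE: "length (ws @ dec c m) \<le> E" using dec_short[OF r(3) m] by (simp add: E_def)
    have M: "digit_pos b (den (ws @ dec c m)) \<le> 2 * (c * E)" if "b \<ge> 2" for b
    proof -
      have "digit_pos b (den (ws @ dec c m)) \<le> 2 * (c * length (ws @ dec c m))"
      proof (rule mb_bound[OF _ _ that])
        show "pos_word (ws @ dec c m)" using r(2) dec_range[OF c0] by (auto simp: pos_word_def)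
        show "d \<le> c" if "d \<in> set (ws @ dec c m)" for d using that r(4) dec_range[OF c0, of d m] by auto
      qed
      also have "\<dots> \<le> 2 * (c * E)" using lE by (intro mult_le_mono2)
      finally show ?thesis .
    qed
    show ?case unfolding W_simps
    proof (rule pass_correct[where ws = ws and c = c and s = s1 and K = K and m = m and M = "2 * (c * E)" and E = E,
          OF I(6) r(2) c0 I(1,2,4) M lE], goal_cases)
      case 1
      thus ?case .
    next
      case (2 t2 s2)
      have t2: "t2 \<le> pass_cost E c" using 2(1) pass_cost_bound[OF K, of E] by linarith
      have F2: "frame search_vars s s2" by (rule frame_trans[OF I(7) 2(4)]) auto
      have v2: "s2 ''K'' 0 = int K" "s2 ''m'' 0 = int m" "s2 ''r'' 0 = int r'" using frameD[OF 2(4)] I by simp_all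
      have br: "base_rel ws c (s2(''r'' := g1, ''K'' := g2))" "base_rel ws c (s2(''m'' := g1))" for g1 g2
        using 2(3) by (simp_all add: base_rel_def zero_def)
      have Fr: "frame search_vars s (s2(''r'' := g1, ''K'' := g2))" "frame search_vars s (s2(''m'' := g1))" for g1 g2
        using F2 by (simp_all add: frame_def)
      show ?case
      proof (cases "passes K ws (dec c m)")
        case True
        hence g: "0 < s2 ''g'' 0" using 2(2) by simp
        show ?thesis
          apply (simp add: g v2)
          apply (intro conjI)
          subgoal using t2 by simp
          subgoal unfolding I_def using True I(4,5) sr br Fr
            by - (rule exI[of _ "Suc K"], rule exI[of _ m], rule exI[of _ m], simp add: pr_def v2)
          subgoal unfolding f_def using I(1,2) v2 K m by simp
          done
      next
        case False
        hence g: "\<not> 0 < s2 ''g'' 0" using 2(2) by simp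
        show ?thesis
          apply (simp add: g v2)
          apply (intro conjI)
          subgoal using t2 by simp
          subgoal unfolding I_def using False I(4,5) sr br Fr v2
            by - (rule exI[of _ K], rule exI[of _ "Suc m"], rule exI[of _ r'], simp add: pr_def)
          subgoal unfolding f_def using I(1,2) v2 K m by simp
          done
      qed
    qed
  next
    case 2
    have "base_rel ws c s0" using r(1) by (simp add: s0_def base_rel_def zero_def)
    moreover have "frame search_vars s s0" by (simp add: s0_def frame_def)
    ultimately show ?case unfolding I_def
      by (intro exI[of _ 1]) (simp add: s0_def best_def pr_def)
  next
    case (3 t1 s1)
    then obtain K m r' where I: "s1 ''K'' 0 = int K" "s1 ''m'' 0 = int m" "s1 ''r'' 0 = int r'" "1 \<le> K"
      "search pr (2 ^ c) c K m r' = best ws c" "base_rel ws c s1" "frame search_vars s s1" unfolding I_def by blast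
    have X1: "s1 ''X'' 0 = int (2 ^ c)" using frameD[OF I(7), of "''X''"] X by simp
    have c1: "s1 ''c'' 0 = int c" using I(6) by (simp add: base_rel_def)
    have "int (2 ^ c) < int m \<or> int c < int K" using 3(2) X1 c1 I by auto
    hence "\<not> (m \<le> 2 ^ c \<and> K \<le> c)" by (simp only: of_nat_less_iff not_le de_Morgan_conj)
    hence rb: "r' = best ws c" using I(5) by (subst (asm) search.simps) auto
    have "f s0 = 2 ^ c + c" by (simp add: f_def s0_def)
    hence "9 + t1 \<le> (2 ^ c + c) * (pass_cost (length ws + c) c + 60) + 40"
      using 3(3) by (simp add: E_def algebra_simps)
    thus ?case using I rb by (intro post) auto
  qed
qed

text \<open>The winner is decoded once more because later candidates have overwritten it. Its
  denominator is recomputed from scratch, which is cheap compared with the search.\<close>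

definition step_prog :: com where "step_prog =
  search_prog ;; setv ''k'' (V ''r'') ;; decode_prog ;; eval_prog ;;
  setv ''Q'' (V ''v'') ;; setv ''N'' (V ''e'') ;;
  Cond (Less (V ''X'') (V ''N'')) (setv ''X'' (Add (V ''X'') (V ''X'')) ;; setv ''c'' (Add (V ''c'') (Const 1))) Skip"

definition full_rel :: "nat \<Rightarrow> state \<Rightarrow> bool" where
  "full_rel i s \<longleftrightarrow> base_rel (greedy_word i) (greedy_par i) s \<and> s ''X'' 0 = 2 ^ greedy_par i"

definition step_cost :: "nat \<Rightarrow> nat \<Rightarrow> nat" where
  "step_cost L c = (2 ^ c + c + 1) * (3000 * ((c + 1) * (c + 1) * (L + c + 1)))"

lemma step_correct:
  assumes r: "full_rel i s"
    and post: "\<And>t s'. t \<le> step_cost (greedy_len i) (greedy_par i) \<Longrightarrow> full_rel (Suc i) s' \<Longrightarrow> s' ''n'' = s ''n'' \<Longrightarrow> Q t s'"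
  shows "W step_prog Q s"
proof -
  define c L w where "c = greedy_par i" and "L = length (greedy_word i)" and "w = greedy_block i"
  have c2: "c \<ge> 2" "c > 0" using par_ge[of i] by (auto simp: c_def)
  have br: "base_rel (greedy_word i) c s" and X: "s ''X'' 0 = 2 ^ c" using r by (auto simp: full_rel_def c_def)
  have lw: "length w \<le> c" using blk_length by (simp add: w_def c_def)
  have dw: "dec c (best (greedy_word i) c) = w" by (simp add: w_def greedy_block_def c_def)
  show ?thesis
    unfolding step_prog_def W_simps
  proof (rule search_correct[OF br pos_wd c2(1) wd_digits[of _ i, folded c_def] X], goal_cases)
    case 1
    thus ?case .
  next
    case (2 t1 s1)
    define s2 where "s2 = s1(''k'' := (s1 ''k'')(0 := int (best (greedy_word i) c)))"
    have br2: "base_rel (greedy_word i) c s2" using 2(3) by (simp add: s2_def base_rel_def zero_def)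
    have v2: "s2 ''N'' 0 = int L" "s2 ''k'' 0 = int (best (greedy_word i) c)" "s2 ''c'' 0 = int c"
      using br2 by (auto simp: base_rel_def s2_def L_def)
    have F2: "frame search_vars s s2" using 2(4) by (simp add: s2_def frame_def)
    note 2 = 2
    show ?case
      apply (simp add: 2(2) s2_def[symmetric])
    proof (rule decode_correct[where s = s2 and L = L and m = "best (greedy_word i) c" and c = c, OF v2 c2(2)], goal_cases)
      case (1 t3 s3)
      have h3: "holds (greedy_word i @ w) s3"
        by (rule holds_decoded[OF br2]) (use 1 in \<open>auto simp: dw L_def\<close>)
      have F3: "frame search_vars s s3" by (rule frame_trans[OF F2 1(5)]) auto
      have z3: "zero s3" using br2 frameD[OF 1(5)] by (simp add: base_rel_def zero_def)
      have c3: "s3 ''c'' 0 = int c" using v2(3) frameD[OF 1(5), of "''c''"] by simp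
      have e3: "s3 ''e'' 0 = int (length (greedy_word (Suc i)))" using 1(2) by (simp add: dw greedy_Suc(1) w_def L_def)
      note 1 = 1
      show ?case unfolding W_simps
      proof (rule eval_correct[OF h3], goal_cases)
        case (1 t4 s4)
        have F4: "frame search_vars s s4" by (rule frame_trans[OF F3 1(4)]) auto
        have v4: "s4 ''v'' 0 = int (den (greedy_word (Suc i)))" using 1(3) by (simp add: greedy_Suc(1) w_def)
        have e4: "s4 ''e'' 0 = int (length (greedy_word (Suc i)))" using e3 frameD[OF 1(4), of "''e''"] by simp
        have out4: "s4 ''out'' (int k) = int (greedy_word (Suc i) ! k)" if "k < length (greedy_word (Suc i))" for k
          using h3 frameD[OF 1(4), of "''out''"] that by (simp add: holds_def greedy_Suc(1) w_def)
        have X4: "s4 ''X'' 0 = 2 ^ c" using X frameD[OF F4, of "''X''"] by simp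
        have c4: "s4 ''c'' 0 = int c" using c3 frameD[OF 1(4), of "''c''"] by simp
        have z4: "zero s4" using z3 frameD[OF 1(4)] by (simp add: zero_def)
        have n4: "s4 ''n'' = s ''n''" using frameD[OF F4, of "''n''"] by simp
        have cost: "t1 + (6 + (t3 + (t4 + 80))) \<le> step_cost (greedy_len i) (greedy_par i)"
        proof -
          have t3: "t3 \<le> 50 * (c + 1)" using \<open>t3 \<le> 50 * (length (dec c (best (greedy_word i) c)) + 1)\<close> lw by (simp add: dw)
          have t4: "t4 \<le> 50 * (L + c + 1)" using 1(1) lw by (simp add: L_def)
          have t1: "t1 \<le> (2 ^ c + c) * (pass_cost (L + c) c + 60) + 40" using \<open>t1 \<le> (2 ^ c + c) * _ + 40\<close> by (simp add: L_def)
          define B where "B = (c + 1) * (c + 1) * (L + c + 1)"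
          have B1: "L + c + 1 \<le> B" "c + 1 \<le> B" unfolding B_def by (simp_all add: algebra_simps)
          have "(2 ^ c + c) * (pass_cost (L + c) c + 60) \<le> (2 ^ c + c) * (3000 * B)"
          proof (rule mult_le_mono2)
            have "pass_cost (L + c) c = 2000 * B" by (simp only: pass_cost_def B_def)
            thus "pass_cost (L + c) c + 60 \<le> 3000 * B" using B1 by linarith
          qed
          moreover have "40 + (6 + (50 * (c + 1) + (50 * (L + c + 1) + 80))) \<le> 3000 * B"
          proof -
            have "50 * (c + 1) \<le> 50 * B" "50 * (L + c + 1) \<le> 50 * B" using B1 by (intro mult_le_mono2; simp)+
            moreover have "1 \<le> B" using B1 by simp
            ultimately show ?thesis by linarith
          qed
          ultimately have "t1 + (6 + (t3 + (t4 + 80))) \<le> (2 ^ c + c) * (3000 * B) + 3000 * B" using t1 t3 t4 by linarith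
          also have "\<dots> = (2 ^ c + c + 1) * (3000 * B)" by (simp add: algebra_simps)
          finally show ?thesis by (simp add: step_cost_def B_def c_def L_def greedy_len_def)
        qed
        show ?case
        proof (cases "2 ^ greedy_par i < greedy_len (Suc i)")
          case True
          hence lt: "(2::int) ^ c < int (length (greedy_word (Suc i)))"
            by (metis c_def greedy_len_def of_nat_less_iff of_nat_numeral of_nat_power)
          have lt': "2 ^ c < length (greedy_word (Suc i))" using True by (simp add: c_def greedy_len_def)
          have p: "greedy_par (Suc i) = Suc c" using True by (simp add: greedy_Suc(2) c_def)
          show ?thesis
            apply (simp add: X4 e4 v4 c4 lt lt')
            apply (rule post)
            subgoal using cost by simp
            subgoal using out4 z4 by (simp add: full_rel_def base_rel_def p zero_def)
            subgoal using n4 by simp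
            done
        next
          case False
          hence lt: "\<not> (2::int) ^ c < int (length (greedy_word (Suc i)))"
            by (metis c_def greedy_len_def of_nat_less_iff of_nat_numeral of_nat_power)
          have lt': "\<not> 2 ^ c < length (greedy_word (Suc i))" using False by (simp add: c_def greedy_len_def)
          have p: "greedy_par (Suc i) = c" using False by (simp add: greedy_Suc(2) c_def)
          show ?thesis
            apply (simp add: X4 e4 v4 c4 lt lt')
            apply (rule post)
            subgoal using cost by simp
            subgoal using out4 z4 X4 c4 by (simp add: full_rel_def base_rel_def p zero_def)
            subgoal using n4 by simp
            done
        qed
      qed
    qed
  qed
qed

definition main_prog :: com where "main_prog =
  setv ''c'' (Const 2) ;; setv ''X'' (Const 4) ;; setv ''Q'' (Const 1) ;;
  While (Less (V ''N'') (V ''n'')) step_prog"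

text \<open>\<open>par_bound\<close> gives 2^c <= 4n, and the squared factor (c + 1)^2 is at most 3
  times 2^c. So the three factors of \<open>step_cost\<close> are at most 8n, 12n and 5n, apart from
  the constant 3000.\<close>

lemma step_cost_bound:
  assumes "greedy_len i < n" shows "step_cost (greedy_len i) (greedy_par i) \<le> 1440000 * n ^ 3"
proof -
  define c where "c = greedy_par i"
  have X: "2 ^ c \<le> 4 * n" using par_bound[of i] assms by (simp add: c_def)
  have sq: "(k + 1) * (k + 1) \<le> 3 * 2 ^ k" if "k \<ge> 2" for k :: nat
    using that
  proof (induction k rule: dec_induct)
    case (step k)
    have "2 * 2 \<le> k * k" using step by (intro mult_le_mono) auto
    hence "(Suc k + 1) * (Suc k + 1) \<le> 2 * ((k + 1) * (k + 1))" by (simp add: algebra_simps)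
    thus ?case using step by simp
  qed simp
  have "c + 1 \<le> 2 ^ c" using less_exp[of c] by (simp add: Suc_le_eq)
  hence c1: "c + 1 \<le> 4 * n" using X by linarith
  have "step_cost (greedy_len i) c \<le> (8 * n) * (3000 * ((12 * n) * (5 * n)))"
    unfolding step_cost_def
  proof (rule mult_le_mono[OF _ mult_le_mono[OF order_refl mult_le_mono]])
    show "2 ^ c + c + 1 \<le> 8 * n" using X c1 by linarith
    show "(c + 1) * (c + 1) \<le> 12 * n" using sq[of c] par_ge[of i] X by (simp add: c_def)
    show "greedy_len i + c + 1 \<le> 5 * n" using assms c1 by linarith
  qed
  also have "\<dots> = 1440000 * n ^ 3" by (simp add: power3_eq_cube)
  finally show ?thesis by (simp add: c_def)
qed

text \<open>Every step appends at least one digit, so at most n steps of cubic cost are made; the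
  word may overshoot n.\<close>

lemma main_correct:
  "\<exists>t s. exec main_prog (input_state n) t s \<and> (\<forall>i<n. s ''out'' (int i) = int (greedy_digit i)) \<and>
     t \<le> n * (1440000 * n ^ 3 + 10) + 50"
proof -
  define I where "I s \<longleftrightarrow> (\<exists>i. full_rel i s) \<and> s ''n'' 0 = int n" for s
  define f where "f s = n - nat (s ''N'' 0)" for s :: state
  define s0 where "s0 = (input_state n)(''c'' := (input_state n ''c'')(0 := 2), ''X'' := (input_state n ''X'')(0 := 4),
      ''Q'' := (input_state n ''Q'')(0 := 1))"
  have "W main_prog (\<lambda>t s. (\<forall>i<n. s ''out'' (int i) = int (greedy_digit i)) \<and> t \<le> n * (1440000 * n ^ 3 + 10) + 50) (input_state n)"
    unfolding main_prog_def
    apply (simp add: W_simps s0_def[symmetric])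
  proof (rule W_While[where I = I and f = f and k = "1440000 * n ^ 3"], goal_cases)
    case (1 s)
    then obtain i where r: "full_rel i s" and n: "s ''n'' 0 = int n" unfolding I_def by blast
    have N: "s ''N'' 0 = int (greedy_len i)" using r by (simp add: full_rel_def base_rel_def greedy_len_def)
    have lt: "greedy_len i < n" using 1(2) n N by simp
    show ?case
    proof (rule step_correct[OF r], goal_cases)
      case (1 t s')
      have N': "s' ''N'' 0 = int (greedy_len (Suc i))" using 1(2) by (simp add: full_rel_def base_rel_def greedy_len_def)
      have "greedy_len i < greedy_len (Suc i)" using blk_nonempty[of i] by (simp add: greedy_Suc)
      hence "f s' < f s" using lt N N' by (simp add: f_def)
      moreover have "I s'" unfolding I_def using 1(2,3) n by auto
      ultimately show ?case using 1(1) step_cost_bound[OF lt] by simp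
    qed
  next
    case 2
    have "full_rel 0 s0"
      by (simp add: full_rel_def base_rel_def greedy_0 s0_def input_state_def zero_def)
    moreover have "s0 ''n'' 0 = int n" by (simp add: s0_def input_state_def)
    ultimately show ?case unfolding I_def by blast
  next
    case (3 t s)
    then obtain i where r: "full_rel i s" and n: "s ''n'' 0 = int n" unfolding I_def by blast
    have N: "s ''N'' 0 = int (greedy_len i)" using r by (simp add: full_rel_def base_rel_def greedy_len_def)
    have le: "n \<le> greedy_len i" using 3(2) n N by simp
    have "s ''out'' (int k) = int (greedy_digit k)" if "k < n" for k
      using r that le by (simp add: full_rel_def base_rel_def wd_eq)
    moreover have "f s0 = n" by (simp add: f_def s0_def input_state_def)
    ultimately show ?case using 3(3) by (simp add: algebra_simps)
  qed
  thus ?thesis unfolding W_def by blast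
qed

theorem theorem1:
  shows "\<exists>(P :: com) (x :: real) (a :: nat \<Rightarrow> nat) (time :: nat \<Rightarrow> nat).
    0 < x \<and> x < 1 \<and> absolutely_normal x \<and> cf_normal x \<and>
    cf_expansion a x \<and> computes_prefixes P a time \<and>
    (\<lambda>n. real (time n)) \<in> O(\<lambda>n. real n ^ 4)"
proof -
  have "\<forall>n. \<exists>t. (\<exists>s. exec main_prog (input_state n) t s \<and> (\<forall>i<n. s ''out'' (int i) = int (greedy_digit i))) \<and>
      t \<le> n * (1440000 * n ^ 3 + 10) + 50"
    using main_correct by blast
  from choice[OF this] obtain time where
    time: "\<forall>n. (\<exists>s. exec main_prog (input_state n) (time n) s \<and> (\<forall>i<n. s ''out'' (int i) = int (greedy_digit i))) \<and>
      time n \<le> n * (1440000 * n ^ 3 + 10) + 50" ..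
  have "computes_prefixes main_prog greedy_digit time" unfolding computes_prefixes_def using time by blast
  moreover have "(\<lambda>n. real (time n)) \<in> O(\<lambda>n. real n ^ 4)"
  \<comment> \<open>1440060 = 1440000 + 10 + 50, since n and 1 are at most n^4 for n >= 1.\<close>
  proof (rule bigoI[where c = 1440060])
    show "\<forall>\<^sub>F n in sequentially. norm (real (time n)) \<le> 1440060 * norm (real n ^ 4)"
      using eventually_ge_at_top[of 1]
    proof eventually_elim
      case (elim n)
      have le: "n \<le> n ^ 4" using elim by (intro self_le_power) auto
      have eq: "n * (1440000 * n ^ 3 + 10) = 1440000 * n ^ 4 + 10 * n"
        using power_Suc[of n 3] by (simp add: algebra_simps)
      have "n * (1440000 * n ^ 3 + 10) + 50 \<le> 1440060 * n ^ 4"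
        unfolding eq using elim le by linarith
      hence "time n \<le> 1440060 * n ^ 4" using time[rule_format, of n] by linarith
      hence "real (time n) \<le> real (1440060 * n ^ 4)" by (rule of_nat_mono)
      thus ?case by simp
    qed
  qed
  ultimately show ?thesis
    using lim_unit[of 0, folded greedy_limit_def] absolutely_normal_lim cf_normal_lim cf_expansion_lim by blast
qed

end
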